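(* The center of a compact group depends only on its ordered representation ring. That is, let $G$ and $H$ be compact groups and suppose there is a ring isomorphism $\Phi: R(G)\to R(H)$ of their representation rings that is an isomorphism of ordered rings, i.e. $\Phi(R(G)_+)=R(H)_+$. Then the centers $Z(G)$ and $Z(H)$ are isomorphic as topological groups.
   Context: Compact groups are Hausdorff; representations are finite-dimensional, continuous, unitary and complex. $\widehat{G}$ is the set of isomorphism classes of irreducible representations of $G$. The representation ring $R(G)$ is the Grothendieck ring of finite-dimensional representations of $G$: additively it is the free abelian group with basis $\widehat{G}$, and multiplication is induced by the tensor product, so that $[X_i][X_j]=\sum_{k\in\widehat{G}}N_{ij}^k[X_k]$ with $N_{ij}^k=\dim\mathrm{Hom}_G(X_k,X_i\otimes X_j)$. Its order structure is given by the positive cone $R(G)_+$ of all finite linear combinations of elements of $\widehat{G}$ with nonnegative integer coefficients (the classes of actual representations, including $0$). The information in the ordered ring $R(G)$ is the same as that of the ring $R(G)$ together with its canonical $\mathbb{Z}$-basis $\widehat{G}$. $Z(G)$ denotes the center of $G$. *)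

theory Defs
  imports
    "HOL-Analysis.Analysis"
    "HOL-Algebra.QuotRing"
    "HOL-Library.Poly_Mapping"
    "Jordan_Normal_Form.VS_Connect"
    "Jordan_Normal_Form.Schur_Decomposition"
begin

section \<open>Compact groups\<close>

locale topological_group = group G
  for G :: "('a, 'm) monoid_scheme" (structure) +
  fixes T :: "'a topology"
  assumes topspace_eq: "topspace T = carrier G"
    and continuous_mult:
      "continuous_map (prod_topology T T) T (\<lambda>(x, y). x \<otimes> y)"
    and continuous_inv: "continuous_map T T (\<lambda>x. inv x)"

locale compact_group = topological_group +
  assumes compact: "compact_space T"
    and Hausdorff: "Hausdorff_space T"

definition group_center :: "('a, 'm) monoid_scheme \<Rightarrow> 'a set" where
  "group_center G =
     {z \<in> carrier G. \<forall>x \<in> carrier G. z \<otimes>\<^bsub>G\<^esub> x = x \<otimes>\<^bsub>G\<^esub> z}"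

definition topological_group_iso ::
  "('a, 'm) monoid_scheme \<Rightarrow> 'a topology \<Rightarrow> ('b, 'n) monoid_scheme \<Rightarrow> 'b topology \<Rightarrow> ('a \<Rightarrow> 'b) set"
  where
  "topological_group_iso G T H S = {f \<in> iso G H. homeomorphic_map T S f}"

section \<open>Representations\<close>

text \<open>Representations are on the Hilbert spaces \<open>\<complex>\<^sup>n\<close>, that is, by unitary matrices; every
  finite-dimensional unitary representation is isomorphic to one of these. Only the values on the
  carrier of the group matter.\<close>

type_synonym 'a rep = "'a \<Rightarrow> complex mat"

definition rep_dim :: "('a, 'm) monoid_scheme \<Rightarrow> 'a rep \<Rightarrow> nat" where
  "rep_dim G \<rho> = dim_row (\<rho> \<one>\<^bsub>G\<^esub>)"

definition unitary_rep :: "('a, 'm) monoid_scheme \<Rightarrow> 'a topology \<Rightarrow> 'a rep \<Rightarrow> bool" where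
  "unitary_rep G T \<rho> \<longleftrightarrow>
     (let n = rep_dim G \<rho> in
       (\<forall>g \<in> carrier G. \<rho> g \<in> carrier_mat n n \<and> mat_adjoint (\<rho> g) * \<rho> g = 1\<^sub>m n) \<and>
       \<rho> \<one>\<^bsub>G\<^esub> = 1\<^sub>m n \<and>
       (\<forall>g \<in> carrier G. \<forall>h \<in> carrier G. \<rho> (g \<otimes>\<^bsub>G\<^esub> h) = \<rho> g * \<rho> h) \<and>
       (\<forall>i < n. \<forall>j < n. continuous_map T euclidean (\<lambda>g. \<rho> g $$ (i, j))))"

definition irreducible_rep :: "('a, 'm) monoid_scheme \<Rightarrow> 'a topology \<Rightarrow> 'a rep \<Rightarrow> bool" where
  "irreducible_rep G T \<rho> \<longleftrightarrow>
     unitary_rep G T \<rho> \<and> rep_dim G \<rho> \<noteq> 0 \<and>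
     (\<forall>W. VectorSpace.subspace class_ring W (module_vec TYPE(complex) (rep_dim G \<rho>)) \<and>
          (\<forall>g \<in> carrier G. \<forall>v \<in> W. \<rho> g *\<^sub>v v \<in> W)
        \<longrightarrow> W = {0\<^sub>v (rep_dim G \<rho>)} \<or> W = carrier_vec (rep_dim G \<rho>))"

definition rep_Hom :: "('a, 'm) monoid_scheme \<Rightarrow> 'a rep \<Rightarrow> 'a rep \<Rightarrow> complex mat set" where
  "rep_Hom G \<rho> \<sigma> =
     {A \<in> carrier_mat (rep_dim G \<sigma>) (rep_dim G \<rho>). \<forall>g \<in> carrier G. A * \<rho> g = \<sigma> g * A}"

definition dim_Hom :: "('a, 'm) monoid_scheme \<Rightarrow> 'a rep \<Rightarrow> 'a rep \<Rightarrow> nat" where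
  "dim_Hom G \<rho> \<sigma> =
     vectorspace.dim class_ring
       (module_mat TYPE(complex) (rep_dim G \<sigma>) (rep_dim G \<rho>) \<lparr>carrier := rep_Hom G \<rho> \<sigma>\<rparr>)"

definition rep_iso :: "('a, 'm) monoid_scheme \<Rightarrow> 'a rep \<Rightarrow> 'a rep \<Rightarrow> bool" where
  "rep_iso G \<rho> \<sigma> \<longleftrightarrow> (\<exists>A \<in> rep_Hom G \<rho> \<sigma>. invertible_mat A)"

text \<open>The Kronecker product: the matrix of the tensor product of two linear maps, with the basis
  vector \<open>e\<^sub>p \<otimes> e\<^sub>q\<close> in position \<open>p * n + q\<close>, where \<open>n\<close> is the dimension of the second factor.\<close>

definition kronecker :: "complex mat \<Rightarrow> complex mat \<Rightarrow> complex mat" where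
  "kronecker A B =
     mat (dim_row A * dim_row B) (dim_col A * dim_col B)
       (\<lambda>(i, j). A $$ (i div dim_row B, j div dim_col B) * B $$ (i mod dim_row B, j mod dim_col B))"

definition tensor_rep :: "'a rep \<Rightarrow> 'a rep \<Rightarrow> 'a rep" where
  "tensor_rep \<rho> \<sigma> = (\<lambda>g. kronecker (\<rho> g) (\<sigma> g))"

definition trivial_rep :: "'a rep" where
  "trivial_rep = (\<lambda>g. 1\<^sub>m 1)"

section \<open>The ordered representation ring\<close>

definition irrep_rel :: "('a, 'm) monoid_scheme \<Rightarrow> 'a topology \<Rightarrow> ('a rep \<times> 'a rep) set" where
  "irrep_rel G T =
     {(\<rho>, \<sigma>). irreducible_rep G T \<rho> \<and> irreducible_rep G T \<sigma> \<and> rep_iso G \<rho> \<sigma>}"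

text \<open>The set of isomorphism classes of irreducible representations (the dual object of the
  group).\<close>

definition irrep_classes :: "('a, 'm) monoid_scheme \<Rightarrow> 'a topology \<Rightarrow> 'a rep set set" where
  "irrep_classes G T = {\<rho>. irreducible_rep G T \<rho>} // irrep_rel G T"

text \<open>The multiplicity \<open>N\<^sub>i\<^sub>j\<^sup>k = dim Hom\<^sub>G(X\<^sub>k, X\<^sub>i \<otimes> X\<^sub>j)\<close>; it does not depend on the chosen
  representatives.\<close>

definition multiplicity_coeff ::
  "('a, 'm) monoid_scheme \<Rightarrow> 'a rep set \<Rightarrow> 'a rep set \<Rightarrow> 'a rep set \<Rightarrow> nat" where
  "multiplicity_coeff G i j k =
     dim_Hom G (SOME \<rho>. \<rho> \<in> k) (tensor_rep (SOME \<rho>. \<rho> \<in> i) (SOME \<rho>. \<rho> \<in> j))"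

text \<open>The innermost sum ranges over a finite set, because a finite-dimensional representation has
  only finitely many irreducible constituents.\<close>

definition rep_ring_mult ::
  "('a, 'm) monoid_scheme \<Rightarrow> 'a topology \<Rightarrow>
    ('a rep set \<Rightarrow>\<^sub>0 int) \<Rightarrow> ('a rep set \<Rightarrow>\<^sub>0 int) \<Rightarrow> ('a rep set \<Rightarrow>\<^sub>0 int)" where
  "rep_ring_mult G T a b =
     (\<Sum>i \<in> Poly_Mapping.keys a. \<Sum>j \<in> Poly_Mapping.keys b.
       \<Sum>k \<in> {k \<in> irrep_classes G T. multiplicity_coeff G i j k \<noteq> 0}.
         Poly_Mapping.single k
           (Poly_Mapping.lookup a i * Poly_Mapping.lookup b j * int (multiplicity_coeff G i j k)))"

definition rep_ring :: "('a, 'm) monoid_scheme \<Rightarrow> 'a topology \<Rightarrow> ('a rep set \<Rightarrow>\<^sub>0 int) ring" where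
  "rep_ring G T =
     \<lparr>carrier = {c. Poly_Mapping.keys c \<subseteq> irrep_classes G T},
      mult = rep_ring_mult G T,
      one = Poly_Mapping.single (irrep_rel G T `` {trivial_rep}) 1,
      zero = 0,
      add = (+)\<rparr>"

definition rep_ring_pos :: "('a, 'm) monoid_scheme \<Rightarrow> 'a topology \<Rightarrow> ('a rep set \<Rightarrow>\<^sub>0 int) set" where
  "rep_ring_pos G T =
     {c \<in> carrier (rep_ring G T). \<forall>k. 0 \<le> Poly_Mapping.lookup c k}"

end

theory Submission
  imports Defs "Jordan_Normal_Form.Spectral_Radius"
begin

text \<open>By Schur's lemma a central element \<open>z\<close> acts in each class \<open>k\<close> of irreducible representations
  by a scalar \<open>\<omega>(k)\<close> of modulus 1, and \<open>\<omega>(k) = \<omega>(i) \<omega>(j)\<close> whenever \<open>k\<close> occurs in \<open>i \<otimes> j\<close>. The point is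
  that every function \<open>\<omega>\<close> with this property comes from exactly one \<open>z\<close>. Uniqueness holds because
  the irreducible representations separate points. For existence, multiply each irreducible
  character by its value of \<open>\<omega>\<close>. On sums of characters this operation respects products, and by
  orthogonality it preserves the norm \<open>\<integral>|u|\<^sup>2\<close>; applied to the powers of \<open>u\<close> it preserves all moments
  \<open>\<integral>|u|\<^sup>2\<^sup>n\<close>, hence the supremum of \<open>|u|\<close>. So for a finite set \<open>F\<close> of classes containing the trivial one,
  the sum of the twisted characters attains the value \<open>\<Sum>k\<in>F. dim k\<close> in modulus, which forces
  \<open>\<omega>(k) \<rho>\<^sub>k(g) = 1\<close> for some \<open>g\<close> and all \<open>k \<in> F\<close>; compactness yields one \<open>g\<close> for all classes.
  Thus the center is recovered from the fusion rules. The ordered representation ring determines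
  these, since the classes are the indecomposable elements of the positive cone.

  Integration is von Neumann's mean on continuous functions. Separation of points (Peter--Weyl) uses
  that the leading spectral projection of a positive convolution operator is the limit of its
  normalized convolution powers, which gives a finite-dimensional translation-invariant space
  without the theory of compact operators.\<close>

section \<open>The Haar mean\<close>

text \<open>The obstacle is existence: the condition on \<omega> is combinatorial, yet it must
  produce a point of the group. If the sought central element were at hand, translation by it would
  multiply each irreducible character by its value of \<omega>, and would move the maximum of |u|,
  attained at the identity, to another point. Equality of suprema stands in for this translation:
  the supremum is read off from the growth of the moments, and these involve only products and inner
  products of characters. The trivial class contributes the summand 1, which fixes the common phase
  in the equality case of the triangle inequality. In the spectral part the danger is a limit that
  vanishes. The squared norms of the convolution powers are log-convex and submultiplicative; this
  yields both the normalizing rate and the bound that keeps the limit nonzero at the identity.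
  Cauchy-Schwarz upgrades mean-square convergence to uniform convergence, so no function space has
  to be completed. The topology comes for free: agreement of scalars is a closed relation between
  two compact centers, and a bijection with such a graph is a homeomorphism.\<close>

lemma sum_list_div: "(\<Sum>x\<leftarrow>xs. f x / c) = (\<Sum>x\<leftarrow>xs. f x) / (c :: real)"
  by (induction xs) (auto simp: add_divide_distrib)

lemma sum_list_div_mono:
  fixes f :: "'c \<Rightarrow> real"
  assumes "gs \<noteq> []" "\<And>g. g \<in> set gs \<Longrightarrow> f g \<le> c"
  shows "(\<Sum>g\<leftarrow>gs. f g) / length gs \<le> c"
proof -
  have "(\<Sum>g\<leftarrow>gs. f g) \<le> (\<Sum>g\<leftarrow>gs. c)"
    using assms by (intro sum_list_mono) auto
  also have "\<dots> = c * length gs" by (simp add: sum_list_triv)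
  finally show ?thesis using assms by (simp add: divide_le_eq)
qed

lemma sum_list_div_abs:
  fixes f :: "'c \<Rightarrow> real"
  assumes "gs \<noteq> []" "\<And>g. g \<in> set gs \<Longrightarrow> \<bar>f g - c\<bar> \<le> e"
  shows "\<bar>(\<Sum>g\<leftarrow>gs. f g) / length gs - c\<bar> \<le> e"
proof -
  have 1: "(\<Sum>g\<leftarrow>gs. f g) / length gs \<le> c + e"
    using assms by (intro sum_list_div_mono) (force simp: abs_le_iff)+
  have 2: "(\<Sum>g\<leftarrow>gs. - f g) / length gs \<le> - (c - e)"
    using assms by (intro sum_list_div_mono) (force simp: abs_le_iff)+
  have "(\<Sum>g\<leftarrow>gs. - f g) = - (\<Sum>g\<leftarrow>gs. f g)"
    by (simp add: uminus_sum_list_map o_def)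
  with 1 2 show ?thesis by (simp add: abs_le_iff)
qed

context topological_group
begin

lemma continuous_map_group_mult:
  assumes "continuous_map X T u" and "continuous_map X T v"
  shows "continuous_map X T (\<lambda>x. u x \<otimes> v x)"
proof -
  have "continuous_map X (prod_topology T T) (\<lambda>x. (u x, v x))"
    using assms by (intro continuous_map_pairedI)
  from continuous_map_compose[OF this continuous_mult] show ?thesis
    by (simp add: o_def case_prod_beta)
qed

lemma continuous_map_group_inv:
  "continuous_map X T u \<Longrightarrow> continuous_map X T (\<lambda>x. inv (u x))"
  using continuous_map_compose[OF _ continuous_inv] by (simp add: o_def)

lemma continuous_map_group_const: "a \<in> carrier G \<Longrightarrow> continuous_map X T (\<lambda>x. a)"
  by (simp add: topspace_eq)

lemma continuous_map_real_comp:
  assumes "continuous_map T euclidean f" and "continuous_map X T u"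
  shows "continuous_map X euclidean (\<lambda>x. f (u x))"
  using continuous_map_compose[OF assms(2,1)] by (simp add: o_def)

lemmas group_continuous_intros =
  continuous_map_group_mult continuous_map_group_inv continuous_map_group_const
  continuous_map_fst continuous_map_snd continuous_map_id[unfolded id_def]

lemma continuous_map_right_translate:
  "continuous_map T euclidean f \<Longrightarrow> a \<in> carrier G \<Longrightarrow> continuous_map T euclidean (\<lambda>x. f (x \<otimes> a))"
  by (rule continuous_map_real_comp) (auto intro!: group_continuous_intros)

lemma continuous_map_left_translate:
  "continuous_map T euclidean f \<Longrightarrow> a \<in> carrier G \<Longrightarrow> continuous_map T euclidean (\<lambda>x. f (a \<otimes> x))"
  by (rule continuous_map_real_comp) (auto intro!: group_continuous_intros)

lemma continuous_map_inv_arg: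
  "continuous_map T euclidean f \<Longrightarrow> continuous_map T euclidean (\<lambda>x. f (inv x))"
  by (rule continuous_map_real_comp) (auto intro!: group_continuous_intros)

section \<open>Averages over finitely many translates\<close>

definition right_avg :: "'a list \<Rightarrow> ('a \<Rightarrow> real) \<Rightarrow> 'a \<Rightarrow> real" where
  "right_avg gs f x = (\<Sum>g\<leftarrow>gs. f (x \<otimes> g)) / length gs"

definition left_avg :: "'a list \<Rightarrow> ('a \<Rightarrow> real) \<Rightarrow> 'a \<Rightarrow> real" where
  "left_avg gs f x = (\<Sum>g\<leftarrow>gs. f (g \<otimes> x)) / length gs"

definition translators :: "'a list set" where
  "translators = {gs. gs \<noteq> [] \<and> set gs \<subseteq> carrier G}"

text \<open>Products \<open>h \<otimes> g\<close> may coincide, and an average of averages has to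
  count them with multiplicity; hence translators are lists and not sets.\<close>

definition list_mult :: "'a list \<Rightarrow> 'a list \<Rightarrow> 'a list" where
  "list_mult hs gs = concat (map (\<lambda>h. map (\<lambda>g. h \<otimes> g) gs) hs)"

lemma right_avg_abs:
  assumes "gs \<in> translators" "\<And>x. x \<in> carrier G \<Longrightarrow> \<bar>f x - c\<bar> \<le> e" "x \<in> carrier G"
  shows "\<bar>right_avg gs f x - c\<bar> \<le> e"
  using assms unfolding right_avg_def translators_def by (intro sum_list_div_abs) auto

lemma left_avg_abs:
  assumes "gs \<in> translators" "\<And>x. x \<in> carrier G \<Longrightarrow> \<bar>f x - c\<bar> \<le> e" "x \<in> carrier G"
  shows "\<bar>left_avg gs f x - c\<bar> \<le> e"
  using assms unfolding left_avg_def translators_def by (intro sum_list_div_abs) auto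

lemma list_mult_translators:
  "hs \<in> translators \<Longrightarrow> gs \<in> translators \<Longrightarrow> list_mult hs gs \<in> translators"
  by (cases hs) (auto simp: translators_def list_mult_def)

lemma length_list_mult: "length (list_mult hs gs) = length hs * length gs"
  by (induction hs) (auto simp: list_mult_def)

lemma right_avg_right_avg:
  assumes "hs \<in> translators" "gs \<in> translators" "x \<in> carrier G"
  shows "right_avg hs (right_avg gs f) x = right_avg (list_mult hs gs) f x"
proof -
  have "(\<Sum>k\<leftarrow>list_mult hs gs. f (x \<otimes> k)) = (\<Sum>h\<leftarrow>hs. \<Sum>g\<leftarrow>gs. f (x \<otimes> h \<otimes> g))"
    if "set hs \<subseteq> carrier G" "set gs \<subseteq> carrier G" for hs
    using that
  proof (induction hs)
    case (Cons h hs)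
    have "(\<Sum>g\<leftarrow>gs. f (x \<otimes> (h \<otimes> g))) = (\<Sum>g\<leftarrow>gs. f (x \<otimes> h \<otimes> g))"
      using Cons.prems assms(3) by (intro arg_cong[where f=sum_list] map_cong) (auto simp: m_assoc)
    then show ?case using Cons by (simp add: list_mult_def o_def)
  qed (simp add: list_mult_def)
  moreover have "set hs \<subseteq> carrier G" "set gs \<subseteq> carrier G" using assms by (auto simp: translators_def)
  ultimately show ?thesis
    by (simp add: right_avg_def length_list_mult sum_list_div mult.commute)
qed

text \<open>Left and right translations commute by associativity. Every uniqueness and invariance
  property of the mean below is extracted from this identity.\<close>

lemma left_avg_right_avg:
  assumes "hs \<in> translators" "gs \<in> translators" "x \<in> carrier G"
  shows "left_avg hs (right_avg gs f) x = right_avg gs (left_avg hs f) x"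
proof -
  have "(\<Sum>h\<leftarrow>hs. \<Sum>g\<leftarrow>gs. f (h \<otimes> x \<otimes> g)) = (\<Sum>g\<leftarrow>gs. \<Sum>h\<leftarrow>hs. f (h \<otimes> (x \<otimes> g)))"
    if "set hs \<subseteq> carrier G" "set gs \<subseteq> carrier G" for hs
    using that
  proof (induction hs)
    case (Cons h hs)
    have "(\<Sum>g\<leftarrow>gs. f (h \<otimes> (x \<otimes> g))) = (\<Sum>g\<leftarrow>gs. f (h \<otimes> x \<otimes> g))"
      using Cons.prems assms(3) by (intro arg_cong[where f=sum_list] map_cong) (auto simp: m_assoc)
    then show ?case using Cons by (simp add: sum_list_addf)
  qed simp
  moreover have "set hs \<subseteq> carrier G" "set gs \<subseteq> carrier G" using assms by (auto simp: translators_def)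
  ultimately show ?thesis
    by (simp add: right_avg_def left_avg_def sum_list_div mult.commute)
qed

text \<open>Inversion exchanges the two sides, so that facts about left averages follow from those
  about right averages of \<open>\<lambda>x. f (inv x)\<close>.\<close>

lemma left_avg_inv:
  assumes "gs \<in> translators" "x \<in> carrier G"
  shows "right_avg gs (\<lambda>x. f (inv x)) x = left_avg (map (m_inv G) gs) f (inv x)"
proof -
  have "map (\<lambda>g. f (inv (x \<otimes> g))) gs = map (\<lambda>g. f (inv g \<otimes> inv x)) gs"
    using assms by (intro map_cong) (auto simp: translators_def inv_mult_group)
  from arg_cong[OF this, of sum_list] show ?thesis by (simp add: right_avg_def left_avg_def o_def)
qed

lemma map_inv_translators: "gs \<in> translators \<Longrightarrow> map (m_inv G) gs \<in> translators"
  by (auto simp: translators_def)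

lemma right_avg_singleton: "right_avg [a] f x = f (x \<otimes> a)"
  by (simp add: right_avg_def)

lemma right_avg_add: "right_avg gs (\<lambda>x. f x + h x) x = right_avg gs f x + right_avg gs h x"
  by (simp add: right_avg_def sum_list_addf add_divide_distrib)

lemma right_avg_cmult: "right_avg gs (\<lambda>x. c * f x) x = c * right_avg gs f x"
  by (simp add: right_avg_def sum_list_const_mult)

lemma continuous_map_right_avg:
  assumes "gs \<in> translators" "continuous_map T euclideanreal f"
  shows "continuous_map T euclideanreal (right_avg gs f)"
proof -
  have "continuous_map T euclideanreal (\<lambda>x. (\<Sum>g\<leftarrow>gs. f (x \<otimes> g)))" if "set gs \<subseteq> carrier G" for gs
    using that assms(2)
    by (induction gs) (auto intro!: continuous_intros continuous_map_right_translate)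
  then show ?thesis
    using assms unfolding right_avg_def translators_def
    by (intro continuous_map_real_divide) auto
qed

end

section \<open>Uniformity from compactness, and averages of small oscillation\<close>

context compact_group
begin

text \<open>The tube lemma replaces uniform continuity: the set where \<open>F y x\<close> and
  \<open>F y0 x\<close> differ by less than \<open>e\<close> is open and contains the slice over
  \<open>y0\<close>, hence a whole tube around it, as \<open>T\<close> is compact.\<close>

lemma tube_uniform:
  fixes F :: "'c \<Rightarrow> 'a \<Rightarrow> real"
  assumes F: "continuous_map (prod_topology Y T) euclideanreal (\<lambda>(y, x). F y x)"
    and y0: "y0 \<in> topspace Y" and e: "e > 0"
  obtains U where "openin Y U" "y0 \<in> U" "\<And>y x. y \<in> U \<Longrightarrow> x \<in> carrier G \<Longrightarrow> \<bar>F y x - F y0 x\<bar> < e"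
proof -
  define D where "D = (\<lambda>p::'c \<times> 'a. \<bar>F (fst p) (snd p) - F y0 (snd p)\<bar>)"
  have 1: "continuous_map (prod_topology Y T) euclideanreal (\<lambda>p. F (fst p) (snd p))"
    using F by (simp add: case_prod_beta')
  have "continuous_map (prod_topology Y T) (prod_topology Y T) (\<lambda>p. (y0, snd p))"
    using y0 by (intro continuous_intros) (auto simp: continuous_map_snd)
  from continuous_map_compose[OF this 1]
  have 2: "continuous_map (prod_topology Y T) euclideanreal (\<lambda>p. F y0 (snd p))"
    by (simp add: o_def)
  have D: "continuous_map (prod_topology Y T) euclideanreal D"
    unfolding D_def using 1 2 by (intro continuous_intros)
  define W where "W = {p \<in> topspace (prod_topology Y T). D p \<in> {..<e}}"
  have W: "openin (prod_topology Y T) W"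
    unfolding W_def by (rule openin_continuous_map_preimage[OF D]) auto
  have "{y0} \<times> topspace T \<subseteq> W"
    using y0 e by (auto simp: W_def D_def)
  from tube_lemma_right[OF W _ y0 this] compact
  obtain U V where UV: "openin Y U" "y0 \<in> U" "topspace T \<subseteq> V" "U \<times> V \<subseteq> W"
    by (auto simp: compact_space_def)
  show thesis
  proof
    show "openin Y U" "y0 \<in> U" by fact+
    fix y x assume "y \<in> U" "x \<in> carrier G"
    then have "(y, x) \<in> W" using UV topspace_eq by auto
    then show "\<bar>F y x - F y0 x\<bar> < e" by (simp add: W_def D_def)
  qed
qed

text \<open>The open sets of those \<open>x\<close> with \<open>x \<otimes> c \<in> U\<close> cover
  the group, since \<open>c = inv x \<otimes> a\<close> sends \<open>x\<close> to \<open>a\<close>;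
  compactness leaves finitely many \<open>c\<close>.\<close>

lemma finite_translates_cover:
  assumes U: "openin T U" and a: "a \<in> U"
  obtains cs where "cs \<in> translators" "\<And>x. x \<in> carrier G \<Longrightarrow> \<exists>c\<in>set cs. x \<otimes> c \<in> U"
proof -
  define \<U> where "\<U> = (\<lambda>c. {x \<in> topspace T. x \<otimes> c \<in> U}) ` carrier G"
  have aG: "a \<in> carrier G" using a openin_subset[OF U] topspace_eq by auto
  have op: "openin T V" if "V \<in> \<U>" for V
  proof -
    obtain c where c: "c \<in> carrier G" "V = {x \<in> topspace T. x \<otimes> c \<in> U}"
      using \<open>V \<in> \<U>\<close> by (auto simp: \<U>_def)
    have "continuous_map T T (\<lambda>x. x \<otimes> c)" using c by (auto intro!: group_continuous_intros)
    from openin_continuous_map_preimage[OF this U] show ?thesis by (simp add: c)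
  qed
  have "topspace T \<subseteq> \<Union>\<U>"
  proof
    fix x assume x: "x \<in> topspace T"
    have "x \<otimes> (inv x \<otimes> a) \<in> U" using x a aG topspace_eq by (simp flip: m_assoc)
    moreover have "inv x \<otimes> a \<in> carrier G" using x aG topspace_eq by auto
    ultimately show "x \<in> \<Union>\<U>" using x \<U>_def by blast
  qed
  from compactinD[OF compact[unfolded compact_space_def] op this]
  obtain \<F> where \<F>: "finite \<F>" "\<F> \<subseteq> \<U>" "topspace T \<subseteq> \<Union>\<F>" by metis
  from finite_subset_image[OF \<F>(1) \<F>(2)[unfolded \<U>_def]]
  obtain C where C: "C \<subseteq> carrier G" "finite C" "\<F> = (\<lambda>c. {x \<in> topspace T. x \<otimes> c \<in> U}) ` C"
    by auto
  obtain cs where cs: "set cs = C" using finite_list C by auto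
  have cov: "\<exists>c\<in>set cs. x \<otimes> c \<in> U" if "x \<in> carrier G" for x
    using that \<F>(3) C cs topspace_eq by auto
  show thesis
  proof
    show "cs \<in> translators" using cov[of a] aG C cs by (auto simp: translators_def)
    show "\<And>x. x \<in> carrier G \<Longrightarrow> \<exists>c\<in>set cs. x \<otimes> c \<in> U" by (rule cov)
  qed
qed

text \<open>If \<open>h\<close> stays above \<open>B + e\<close>, the lower bound is raised for
  free. Otherwise take \<open>x0\<close> with a value below \<open>B + e\<close> and average over
  the elements \<open>c \<otimes> x0\<close>: for each \<open>x\<close> some
  \<open>x \<otimes> c\<close> lies in \<open>V\<close>, so that at least one summand is at most
  \<open>B + 2 * e < A - e\<close>, and the upper bound drops by \<open>e\<close> divided by the
  number of summands.\<close>

lemma right_avg_osc_step: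
  assumes hcont: "\<And>v x. v \<in> V \<Longrightarrow> x \<in> carrier G \<Longrightarrow> \<bar>h (v \<otimes> x) - h x\<bar> \<le> e"
    and cs: "cs \<in> translators" "\<And>x. x \<in> carrier G \<Longrightarrow> \<exists>c\<in>set cs. x \<otimes> c \<in> V"
    and V: "V \<subseteq> carrier G"
    and bd: "\<And>x. x \<in> carrier G \<Longrightarrow> B \<le> h x \<and> h x \<le> A"
    and AB: "A - B > 3 * e" and e: "e > 0"
  shows "\<exists>hs\<in>translators. \<exists>A' B'. (\<forall>x\<in>carrier G. B' \<le> right_avg hs h x \<and> right_avg hs h x \<le> A')
            \<and> A' - B' \<le> A - B - e / length cs"
proof (cases "\<exists>x0\<in>carrier G. h x0 < B + e")
  case False
  have len: "length cs \<ge> 1" using cs by (cases cs) (auto simp: translators_def)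
  then have "e / length cs \<le> e" using e by (simp add: divide_le_eq)
  moreover have "right_avg [\<one>] h x = h x" if "x \<in> carrier G" for x
    using that by (simp add: right_avg_singleton)
  moreover have "[\<one>] \<in> translators" by (simp add: translators_def)
  ultimately show ?thesis using False bd
    by (intro bexI[of _ "[\<one>]"] exI[of _ A] exI[of _ "B + e"]) (auto simp: not_less)
next
  case True
  then obtain x0 where x0: "x0 \<in> carrier G" "h x0 < B + e" by auto
  define hs where "hs = map (\<lambda>c. c \<otimes> x0) cs"
  have hs: "hs \<in> translators" using cs x0 by (auto simp: hs_def translators_def)
  have N: "real (length cs) \<ge> 1" "length cs = length hs"
    using cs by (cases cs; auto simp: translators_def hs_def)+
  have "B \<le> right_avg hs h x \<and> right_avg hs h x \<le> A - e / length cs" if x: "x \<in> carrier G" for x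
  proof
    have "(\<Sum>g\<leftarrow>hs. - h (x \<otimes> g)) / length hs \<le> - B"
      using hs x bd by (intro sum_list_div_mono) (auto simp: translators_def)
    moreover have "(\<Sum>g\<leftarrow>hs. - h (x \<otimes> g)) = - (\<Sum>g\<leftarrow>hs. h (x \<otimes> g))"
      by (simp add: uminus_sum_list_map o_def)
    ultimately show "B \<le> right_avg hs h x" by (simp add: right_avg_def)
    obtain c where c: "c \<in> set cs" "x \<otimes> c \<in> V" using cs x by auto
    have cG: "c \<in> carrier G" using c cs by (auto simp: translators_def)
    have "h (x \<otimes> (c \<otimes> x0)) = h (x \<otimes> c \<otimes> x0)" using cG x x0 by (simp add: m_assoc)
    also have "\<dots> \<le> h x0 + e" using hcont[OF c(2) x0(1)] by (simp add: abs_le_iff)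
    also have "\<dots> \<le> B + 2 * e" using x0 by simp
    finally have low: "h (x \<otimes> (c \<otimes> x0)) \<le> A - e" using AB by simp
    have mem: "c \<otimes> x0 \<in> set hs" using c by (auto simp: hs_def)
    have "(\<Sum>g\<leftarrow>hs. h (x \<otimes> g)) \<le> A * length hs - e"
    proof -
      obtain ys zs where sp: "hs = ys @ (c \<otimes> x0) # zs" using split_list[OF mem] by auto
      have *: "(\<Sum>g\<leftarrow>ks. h (x \<otimes> g)) \<le> A * length ks" if "set ks \<subseteq> carrier G" for ks
        using that
      proof (induction ks)
        case (Cons k ks)
        then have "h (x \<otimes> k) \<le> A" using bd x by auto
        with Cons show ?case by (simp add: algebra_simps)
      qed simp
      have "set ys \<subseteq> carrier G" "set zs \<subseteq> carrier G" using hs sp by (auto simp: translators_def)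
      with *[of ys] *[of zs] low show ?thesis by (simp add: sp algebra_simps)
    qed
    then have "right_avg hs h x \<le> (A * length hs - e) / length hs"
      unfolding right_avg_def using N by (intro divide_right_mono) auto
    also have "\<dots> = A - e / length cs" using N hs by (simp add: diff_divide_distrib translators_def)
    finally show "right_avg hs h x \<le> A - e / length cs" .
  qed
  then show ?thesis using hs by (intro bexI[of _ hs] exI[of _ B] exI[of _ "A - e / length cs"]) auto
qed

lemma continuous_bounded:
  assumes "continuous_map T euclideanreal f"
  obtains D where "D > 0" "\<And>x. x \<in> carrier G \<Longrightarrow> \<bar>f x\<bar> \<le> D"
proof -
  have "compactin euclideanreal (f ` topspace T)"
    using image_compactin[OF _ assms] compact by (auto simp: compact_space_def)
  then have "bounded (f ` carrier G)"
    by (simp add: compact_imp_bounded topspace_eq)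
  then show thesis using that unfolding bounded_pos by auto
qed

text \<open>Following von Neumann, averages over translates have arbitrarily small oscillation: since
  all of them share one modulus of continuity, one averaging step over a fixed finite list
  diminishes the oscillation by a fixed amount as long as it is large.\<close>

lemma right_avg_almost_constant:
  assumes f: "continuous_map T euclideanreal f" and e: "e > 0"
  shows "\<exists>gs\<in>translators. \<exists>c. \<forall>x\<in>carrier G. \<bar>right_avg gs f x - c\<bar> \<le> 3 * e"
proof -
  have "continuous_map (prod_topology T T) euclideanreal (\<lambda>(y, x). f (y \<otimes> x))"
    using continuous_map_compose[OF continuous_mult f] by (simp add: o_def case_prod_beta')
  from tube_uniform[OF this _ e, of \<one>] topspace_eq
  obtain V where V: "openin T V" "\<one> \<in> V"
    "\<And>v x. v \<in> V \<Longrightarrow> x \<in> carrier G \<Longrightarrow> \<bar>f (v \<otimes> x) - f (\<one> \<otimes> x)\<bar> < e" by auto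
  have VG: "V \<subseteq> carrier G" using openin_subset[OF V(1)] topspace_eq by simp
  obtain cs where cs: "cs \<in> translators" "\<And>x. x \<in> carrier G \<Longrightarrow> \<exists>c\<in>set cs. x \<otimes> c \<in> V"
    using finite_translates_cover[OF V(1,2)] by auto
  obtain D where D: "\<And>x. x \<in> carrier G \<Longrightarrow> \<bar>f x\<bar> \<le> D"
    using continuous_bounded[OF f] by auto
  have N: "real (length cs) > 0" using cs by (auto simp: translators_def)
  \<comment> \<open>Either the oscillation is already small, or each of \<open>n\<close> steps has
    lowered the initial bound \<open>2 * D\<close> by the same amount.\<close>
  have step: "\<exists>gs\<in>translators. \<exists>A B. (\<forall>x\<in>carrier G. B \<le> right_avg gs f x \<and> right_avg gs f x \<le> A) \<and>
     (A - B \<le> 3 * e \<or> A - B \<le> 2 * D - real n * (e / length cs))" for n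
  proof (induction n)
    case 0
    have "[\<one>] \<in> translators" by (simp add: translators_def)
    moreover have "- D \<le> right_avg [\<one>] f x \<and> right_avg [\<one>] f x \<le> D" if "x \<in> carrier G" for x
      using D[OF that] that by (auto simp: right_avg_singleton abs_le_iff)
    ultimately show ?case
      by (intro bexI[of _ "[\<one>]"] exI[of _ D] exI[of _ "- D"]) auto
  next
    case (Suc n)
    then obtain gs A B where gs: "gs \<in> translators"
      and AB: "\<And>x. x \<in> carrier G \<Longrightarrow> B \<le> right_avg gs f x \<and> right_avg gs f x \<le> A"
      and or: "A - B \<le> 3 * e \<or> A - B \<le> 2 * D - real n * (e / length cs)" by blast
    show ?case
    proof (cases "A - B \<le> 3 * e")
      case True
      then show ?thesis using gs AB by blast
    next
      case False
      \<comment> \<open>Right averaging commutes with left translation by \<open>v\<close>, so the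
        average inherits the modulus of continuity of \<open>f\<close> on the same
        \<open>V\<close>.\<close>
      have hcont: "\<bar>right_avg gs f (v \<otimes> x) - right_avg gs f x\<bar> \<le> e" if "v \<in> V" "x \<in> carrier G" for v x
      proof -
        have "right_avg gs f (v \<otimes> x) - right_avg gs f x = (\<Sum>g\<leftarrow>gs. f (v \<otimes> x \<otimes> g) - f (x \<otimes> g)) / length gs"
          by (simp add: right_avg_def sum_list_subtractf diff_divide_distrib)
        moreover have "\<bar>(\<Sum>g\<leftarrow>gs. f (v \<otimes> x \<otimes> g) - f (x \<otimes> g)) / length gs - 0\<bar> \<le> e"
        proof (rule sum_list_div_abs)
          show "gs \<noteq> []" using gs by (simp add: translators_def)
          fix g assume "g \<in> set gs"
          then have "g \<in> carrier G" using gs by (auto simp: translators_def)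
          then show "\<bar>f (v \<otimes> x \<otimes> g) - f (x \<otimes> g) - 0\<bar> \<le> e"
            using V(3)[OF that(1), of "x \<otimes> g"] that VG by (auto simp: m_assoc)
        qed
        ultimately show ?thesis by simp
      qed
      from right_avg_osc_step[OF hcont cs VG AB _ e] False
      obtain hs A' B' where hs: "hs \<in> translators"
        "\<forall>x\<in>carrier G. B' \<le> right_avg hs (right_avg gs f) x \<and> right_avg hs (right_avg gs f) x \<le> A'"
        "A' - B' \<le> A - B - e / length cs" by fastforce
      show ?thesis
      proof (intro bexI exI conjI)
        show "list_mult hs gs \<in> translators" by (rule list_mult_translators[OF hs(1) gs])
        show "\<forall>x\<in>carrier G. B' \<le> right_avg (list_mult hs gs) f x \<and> right_avg (list_mult hs gs) f x \<le> A'"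
          using hs gs by (simp add: right_avg_right_avg)
        show "A' - B' \<le> 3 * e \<or> A' - B' \<le> 2 * D - real (Suc n) * (e / length cs)"
          using or False hs(3) by (simp add: algebra_simps add_divide_distrib)
      qed
    qed
  qed
  \<comment> \<open>For such \<open>n\<close> the second alternative would give a negative bound, so
    \<open>A - B \<le> 3 * e\<close> holds in either case.\<close>
  obtain n where n: "real n * (e / length cs) > 2 * D"
    using reals_Archimedean3[of "e / length cs"] e N by fastforce
  from step[of n] obtain gs A B where gs: "gs \<in> translators"
      and AB: "\<And>x. x \<in> carrier G \<Longrightarrow> B \<le> right_avg gs f x \<and> right_avg gs f x \<le> A"
      and or: "A - B \<le> 3 * e \<or> A - B \<le> 2 * D - real n * (e / length cs)" by blast
  have "A - B \<le> 3 * e" using or n e by linarith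
  then have "\<bar>right_avg gs f x - B\<bar> \<le> 3 * e" if "x \<in> carrier G" for x
    using AB[OF that] by (simp add: abs_le_iff)
  then show ?thesis using gs by blast
qed

lemma right_avg_almost_const:
  assumes "continuous_map T euclideanreal f" "e > 0"
  obtains gs c where "gs \<in> translators" "\<And>x. x \<in> carrier G \<Longrightarrow> \<bar>right_avg gs f x - c\<bar> \<le> e"
  using right_avg_almost_constant[OF assms(1), of "e / 3"] assms(2) by auto

lemma left_avg_almost_const:
  assumes "continuous_map T euclideanreal f" "e > 0"
  obtains gs c where "gs \<in> translators" "\<And>x. x \<in> carrier G \<Longrightarrow> \<bar>left_avg gs f x - c\<bar> \<le> e"
proof -
  obtain gs c where gs: "gs \<in> translators"
    "\<And>x. x \<in> carrier G \<Longrightarrow> \<bar>right_avg gs (\<lambda>x. f (inv x)) x - c\<bar> \<le> e"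
    using right_avg_almost_const[OF continuous_map_inv_arg[OF assms(1)] assms(2)] by auto
  show thesis
  proof
    show "map (m_inv G) gs \<in> translators" by (rule map_inv_translators[OF gs(1)])
    fix x assume x: "x \<in> carrier G"
    then show "\<bar>left_avg (map (m_inv G) gs) f x - c\<bar> \<le> e"
      using gs(2)[of "inv x"] left_avg_inv[OF gs(1), of "inv x" f] by simp
  qed
qed

text \<open>The two-sided average at \<open>\<one>\<close> is within \<open>e\<close> of
  \<open>c\<close> when seen as a left average of \<open>right_avg gs f\<close>, and within
  \<open>e'\<close> of \<open>d\<close> when seen as a right average of
  \<open>left_avg hs f\<close>. So left and right averages can only approach one and the same
  constant.\<close>

lemma right_left_avg_close:
  assumes "gs \<in> translators" "\<And>x. x \<in> carrier G \<Longrightarrow> \<bar>right_avg gs f x - c\<bar> \<le> e"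
    and "hs \<in> translators" "\<And>x. x \<in> carrier G \<Longrightarrow> \<bar>left_avg hs f x - d\<bar> \<le> e'"
  shows "\<bar>c - d\<bar> \<le> e + e'"
proof -
  have "\<bar>left_avg hs (right_avg gs f) \<one> - c\<bar> \<le> e"
    using assms by (intro left_avg_abs) auto
  moreover have "\<bar>right_avg gs (left_avg hs f) \<one> - d\<bar> \<le> e'"
    using assms by (intro right_avg_abs) auto
  ultimately show ?thesis using left_avg_right_avg[of hs gs \<one> f] assms by simp
qed

text \<open>A choice-free name for the constant that the averages of a continuous function approach:
  the supremum of the lower bounds of its right averages.\<close>

definition mean :: "('a \<Rightarrow> real) \<Rightarrow> real" where
  "mean f = Sup {B. \<exists>gs\<in>translators. \<forall>x\<in>carrier G. B \<le> right_avg gs f x}"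

text \<open>The number \<open>c - e / 2\<close> belongs to the set whose supremum is the mean. No
  member exceeds \<open>c + e / 2\<close>: a member bounds two-sided averages from below, and these
  are compared with a left average that is constant up to an arbitrary \<open>d\<close>.\<close>

lemma mean_approx_right:
  assumes f: "continuous_map T euclideanreal f" and e: "e > 0"
  obtains gs where "gs \<in> translators" "\<And>x. x \<in> carrier G \<Longrightarrow> \<bar>right_avg gs f x - mean f\<bar> \<le> e"
proof -
  let ?S = "{B. \<exists>gs\<in>translators. \<forall>x\<in>carrier G. B \<le> right_avg gs f x}"
  obtain gs c where gs: "gs \<in> translators" "\<And>x. x \<in> carrier G \<Longrightarrow> \<bar>right_avg gs f x - c\<bar> \<le> e / 2"
    using right_avg_almost_const[OF f, of "e/2"] e by auto
  have mem: "c - e / 2 \<in> ?S" 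
  proof -
    have "c - e / 2 \<le> right_avg gs f x" if "x \<in> carrier G" for x
      using gs(2)[OF that] by (simp only: abs_le_iff) linarith
    then show ?thesis using gs(1) by blast
  qed
  have ub: "B \<le> c + e / 2" if "B \<in> ?S" for B
  proof (rule field_le_epsilon)
    fix d :: real assume d: "d > 0"
    obtain hs k where hs: "hs \<in> translators" "\<And>x. x \<in> carrier G \<Longrightarrow> \<bar>left_avg hs f x - k\<bar> \<le> d / 2"
      using left_avg_almost_const[OF f, of "d/2"] d by auto
    obtain gs' where gs': "gs' \<in> translators" "\<forall>x\<in>carrier G. B \<le> right_avg gs' f x"
      using \<open>B \<in> ?S\<close> by auto
    have 1: "\<bar>c - k\<bar> \<le> e / 2 + d / 2" by (rule right_left_avg_close[OF gs hs])
    have "\<bar>right_avg gs' (left_avg hs f) \<one> - k\<bar> \<le> d / 2"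
      using hs gs' by (intro right_avg_abs) auto
    moreover have "right_avg gs' (left_avg hs f) \<one> = left_avg hs (right_avg gs' f) \<one>"
      using left_avg_right_avg[of hs gs' \<one> f] hs gs' by simp
    moreover have "- left_avg hs (right_avg gs' f) \<one> \<le> - B"
    proof -
      have "(\<Sum>h\<leftarrow>hs. - right_avg gs' f (h \<otimes> \<one>)) / length hs \<le> - B"
        using hs gs' by (intro sum_list_div_mono) (auto simp: translators_def)
      moreover have "(\<Sum>h\<leftarrow>hs. - right_avg gs' f (h \<otimes> \<one>)) = - (\<Sum>h\<leftarrow>hs. right_avg gs' f (h \<otimes> \<one>))"
        by (simp add: uminus_sum_list_map o_def)
      ultimately show ?thesis by (simp add: left_avg_def)
    qed
    ultimately show "B \<le> c + e / 2 + d" using 1 by linarith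
  qed
  have "mean f \<le> c + e / 2" unfolding mean_def using mem ub by (intro cSup_least) auto
  moreover have "c - e / 2 \<le> mean f" unfolding mean_def
    using mem ub by (intro cSup_upper bdd_aboveI) auto
  ultimately have "\<bar>right_avg gs f x - mean f\<bar> \<le> e" if "x \<in> carrier G" for x
    using gs(2)[OF that] by linarith
  then show thesis using that gs by auto
qed

lemma mean_approx_left:
  assumes f: "continuous_map T euclideanreal f" and e: "e > 0"
  obtains gs where "gs \<in> translators" "\<And>x. x \<in> carrier G \<Longrightarrow> \<bar>left_avg gs f x - mean f\<bar> \<le> e"
proof -
  obtain hs k where hs: "hs \<in> translators" "\<And>x. x \<in> carrier G \<Longrightarrow> \<bar>left_avg hs f x - k\<bar> \<le> e / 3"
    using left_avg_almost_const[OF f, of "e/3"] e by auto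
  obtain gs where gs: "gs \<in> translators" "\<And>x. x \<in> carrier G \<Longrightarrow> \<bar>right_avg gs f x - mean f\<bar> \<le> e / 3"
    using mean_approx_right[OF f, of "e/3"] e by auto
  have "\<bar>mean f - k\<bar> \<le> e / 3 + e / 3" by (rule right_left_avg_close[OF gs hs])
  then have "\<bar>left_avg hs f x - mean f\<bar> \<le> e" if "x \<in> carrier G" for x
    using hs(2)[OF that] by linarith
  then show thesis using that hs by auto
qed

lemma mean_eqI_right:
  assumes f: "continuous_map T euclideanreal f"
    and c: "\<And>e. e > 0 \<Longrightarrow> \<exists>gs\<in>translators. \<forall>x\<in>carrier G. \<bar>right_avg gs f x - c\<bar> \<le> e"
  shows "mean f = c"
proof -
  have "\<bar>c - mean f\<bar> \<le> 0 + e" if e: "e > 0" for e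
  proof -
    obtain gs where gs: "gs \<in> translators" "\<And>x. x \<in> carrier G \<Longrightarrow> \<bar>right_avg gs f x - c\<bar> \<le> e / 2"
      using c[of "e/2"] e by auto
    obtain hs where hs: "hs \<in> translators" "\<And>x. x \<in> carrier G \<Longrightarrow> \<bar>left_avg hs f x - mean f\<bar> \<le> e / 2"
      using mean_approx_left[OF f, of "e/2"] e by auto
    from right_left_avg_close[OF gs hs] show ?thesis by simp
  qed
  then have "\<bar>c - mean f\<bar> \<le> 0" by (rule field_le_epsilon)
  then show ?thesis by simp
qed

lemma mean_eqI_left:
  assumes f: "continuous_map T euclideanreal f"
    and c: "\<And>e. e > 0 \<Longrightarrow> \<exists>gs\<in>translators. \<forall>x\<in>carrier G. \<bar>left_avg gs f x - c\<bar> \<le> e"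
  shows "mean f = c"
proof -
  have "\<bar>mean f - c\<bar> \<le> 0 + e" if e: "e > 0" for e
  proof -
    obtain hs where hs: "hs \<in> translators" "\<And>x. x \<in> carrier G \<Longrightarrow> \<bar>left_avg hs f x - c\<bar> \<le> e / 2"
      using c[of "e/2"] e by auto
    obtain gs where gs: "gs \<in> translators" "\<And>x. x \<in> carrier G \<Longrightarrow> \<bar>right_avg gs f x - mean f\<bar> \<le> e / 2"
      using mean_approx_right[OF f, of "e/2"] e by auto
    from right_left_avg_close[OF gs hs] show ?thesis by simp
  qed
  then have "\<bar>mean f - c\<bar> \<le> 0" by (rule field_le_epsilon)
  then show ?thesis by simp
qed

text \<open>Left averages that approximate \<open>mean f\<close> uniformly still do so after a right
  average, because the two commute. Right invariance is the case of a single translate.\<close>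

lemma mean_right_avg:
  assumes f: "continuous_map T euclideanreal f" and gs: "gs \<in> translators"
  shows "mean (right_avg gs f) = mean f"
proof (rule mean_eqI_left)
  show "continuous_map T euclideanreal (right_avg gs f)" by (rule continuous_map_right_avg[OF gs f])
  fix e :: real assume "e > 0"
  then obtain hs where hs: "hs \<in> translators" "\<And>x. x \<in> carrier G \<Longrightarrow> \<bar>left_avg hs f x - mean f\<bar> \<le> e"
    using mean_approx_left[OF f] by auto
  have "\<bar>left_avg hs (right_avg gs f) x - mean f\<bar> \<le> e" if "x \<in> carrier G" for x
    using left_avg_right_avg[OF hs(1) gs that] right_avg_abs[OF gs hs(2) that] by simp
  then show "\<exists>hs\<in>translators. \<forall>x\<in>carrier G. \<bar>left_avg hs (right_avg gs f) x - mean f\<bar> \<le> e"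
    using hs by blast
qed

lemma mean_cong:
  assumes "\<And>x. x \<in> carrier G \<Longrightarrow> f x = h x"
  shows "mean f = mean h"
proof -
  have "right_avg gs f x = right_avg gs h x" if "gs \<in> translators" "x \<in> carrier G" for gs x
    unfolding right_avg_def using that assms
    by (intro arg_cong2[where f="(/)"] arg_cong[where f=sum_list] map_cong)
      (auto simp: translators_def)
  then show ?thesis unfolding mean_def by (intro arg_cong[where f=Sup]) auto
qed

lemma mean_right:
  assumes f: "continuous_map T euclideanreal f" and a: "a \<in> carrier G"
  shows "mean (\<lambda>x. f (x \<otimes> a)) = mean f"
  using mean_right_avg[OF f, of "[a]"] a by (simp add: right_avg_def[abs_def] translators_def)

lemma mean_inv:
  assumes f: "continuous_map T euclideanreal f"
  shows "mean (\<lambda>x. f (inv x)) = mean f"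
proof (rule sym, rule mean_eqI_left[OF f])
  fix e :: real assume "e > 0"
  then obtain gs where gs: "gs \<in> translators"
    "\<And>x. x \<in> carrier G \<Longrightarrow> \<bar>right_avg gs (\<lambda>x. f (inv x)) x - mean (\<lambda>x. f (inv x))\<bar> \<le> e"
    using mean_approx_right[OF continuous_map_inv_arg[OF f]] by auto
  have "\<bar>left_avg (map (m_inv G) gs) f x - mean (\<lambda>x. f (inv x))\<bar> \<le> e" if "x \<in> carrier G" for x
    using gs(2)[of "inv x"] left_avg_inv[OF gs(1), of "inv x" f] that by simp
  with map_inv_translators[OF gs(1)]
  show "\<exists>hs\<in>translators. \<forall>x\<in>carrier G. \<bar>left_avg hs f x - mean (\<lambda>x. f (inv x))\<bar> \<le> e" by blast
qed

lemma mean_left: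
  assumes f: "continuous_map T euclideanreal f" and a: "a \<in> carrier G"
  shows "mean (\<lambda>x. f (a \<otimes> x)) = mean f"
proof -
  have "mean (\<lambda>x. f (a \<otimes> x)) = mean (\<lambda>x. f (a \<otimes> inv x))"
    using mean_inv[OF continuous_map_left_translate[OF f a]] by simp
  also have "\<dots> = mean (\<lambda>x. f (inv (x \<otimes> inv a)))"
    using a by (intro mean_cong) (simp add: inv_mult_group)
  also have "\<dots> = mean (\<lambda>x. f (inv x))"
    using mean_right[OF continuous_map_inv_arg[OF f], of "inv a"] a by simp
  finally show ?thesis using mean_inv[OF f] by simp
qed

text \<open>Further averaging does not spoil functions whose average is already nearly constant, so
  the functions are treated one after another and the lists multiplied.\<close>

lemma mean_approx_simultaneous:
  assumes "finite F" "\<And>f. f \<in> F \<Longrightarrow> continuous_map T euclideanreal f" "e > 0"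
  shows "\<exists>gs\<in>translators. \<forall>f\<in>F. \<forall>x\<in>carrier G. \<bar>right_avg gs f x - mean f\<bar> \<le> e"
  using assms(1,2)
proof (induction F)
  case empty
  have "[\<one>] \<in> translators" by (simp add: translators_def)
  then show ?case by blast
next
  case (insert f F)
  then obtain gs where gs: "gs \<in> translators" "\<forall>f\<in>F. \<forall>x\<in>carrier G. \<bar>right_avg gs f x - mean f\<bar> \<le> e"
    by auto
  have f: "continuous_map T euclideanreal f" using insert by auto
  obtain hs where hs: "hs \<in> translators"
    "\<And>x. x \<in> carrier G \<Longrightarrow> \<bar>right_avg hs (right_avg gs f) x - mean (right_avg gs f)\<bar> \<le> e"
    using mean_approx_right[OF continuous_map_right_avg[OF gs(1) f] assms(3)] by auto
  show ?case
  proof (intro bexI ballI)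
    show "list_mult hs gs \<in> translators" using hs gs by (simp add: list_mult_translators)
    fix h x assume h: "h \<in> insert f F" and x: "x \<in> carrier G"
    show "\<bar>right_avg (list_mult hs gs) h x - mean h\<bar> \<le> e"
    proof (cases "h = f")
      case True
      then show ?thesis using hs(2)[OF x] right_avg_right_avg[OF hs(1) gs(1) x, of f] mean_right_avg[OF f gs(1)]
        by simp
    next
      case False
      then show ?thesis using right_avg_abs[OF hs(1), of "right_avg gs h" "mean h" e x] gs h x
          right_avg_right_avg[OF hs(1) gs(1) x, of h] by auto
    qed
  qed
qed

section \<open>Linearity, monotonicity and positivity of the mean\<close>

lemma mean_add:
  assumes f: "continuous_map T euclideanreal f" and h: "continuous_map T euclideanreal h"
  shows "mean (\<lambda>x. f x + h x) = mean f + mean h"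
proof (rule mean_eqI_right)
  show "continuous_map T euclideanreal (\<lambda>x. f x + h x)" using f h by (intro continuous_intros)
  fix e :: real assume e: "e > 0"
  obtain gs where gs: "gs \<in> translators" "\<forall>f\<in>{f,h}. \<forall>x\<in>carrier G. \<bar>right_avg gs f x - mean f\<bar> \<le> e / 2"
    using mean_approx_simultaneous[of "{f,h}" "e/2"] f h e by auto
  have "\<bar>right_avg gs (\<lambda>x. f x + h x) x - (mean f + mean h)\<bar> \<le> e" if "x \<in> carrier G" for x
  proof -
    have "\<bar>right_avg gs f x - mean f\<bar> \<le> e / 2" "\<bar>right_avg gs h x - mean h\<bar> \<le> e / 2"
      using gs(2) that by auto
    then show ?thesis unfolding right_avg_add by linarith
  qed
  then show "\<exists>gs\<in>translators. \<forall>x\<in>carrier G. \<bar>right_avg gs (\<lambda>x. f x + h x) x - (mean f + mean h)\<bar> \<le> e"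
    using gs by blast
qed

lemma mean_cmult:
  assumes f: "continuous_map T euclideanreal f"
  shows "mean (\<lambda>x. c * f x) = c * mean f"
proof (rule mean_eqI_right)
  show "continuous_map T euclideanreal (\<lambda>x. c * f x)" by (rule continuous_map_real_mult_left[OF f])
  fix e :: real assume e: "e > 0"
  obtain gs where gs: "gs \<in> translators" "\<And>x. x \<in> carrier G \<Longrightarrow> \<bar>right_avg gs f x - mean f\<bar> \<le> e / (\<bar>c\<bar> + 1)"
    using mean_approx_right[OF f, of "e/(\<bar>c\<bar>+1)"] e by auto
  have "\<bar>right_avg gs (\<lambda>x. c * f x) x - c * mean f\<bar> \<le> e" if "x \<in> carrier G" for x
  proof -
    have "\<bar>right_avg gs (\<lambda>x. c * f x) x - c * mean f\<bar> = \<bar>c\<bar> * \<bar>right_avg gs f x - mean f\<bar>"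
      unfolding right_avg_cmult by (simp flip: abs_mult right_diff_distrib)
    also have "\<dots> \<le> \<bar>c\<bar> * (e / (\<bar>c\<bar> + 1))" using gs(2)[OF that] by (intro mult_left_mono) auto
    also have "\<dots> \<le> e" using e by (simp add: field_simps)
    finally show ?thesis .
  qed
  then show "\<exists>gs\<in>translators. \<forall>x\<in>carrier G. \<bar>right_avg gs (\<lambda>x. c * f x) x - c * mean f\<bar> \<le> e"
    using gs by blast
qed

text \<open>Averaging leaves the mean unchanged, so it is enough that one average of
  \<open>f\<close> is bounded below; \<open>f\<close> itself may dip under \<open>c\<close>.\<close>

lemma mean_ge:
  assumes f: "continuous_map T euclideanreal f" and gs: "gs \<in> translators"
    and c: "\<And>x. x \<in> carrier G \<Longrightarrow> c \<le> right_avg gs f x"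
  shows "c \<le> mean f"
proof (rule field_le_epsilon)
  fix e :: real assume e: "e > 0"
  have r: "continuous_map T euclideanreal (right_avg gs f)" by (rule continuous_map_right_avg[OF gs f])
  obtain hs where hs: "hs \<in> translators"
    "\<And>x. x \<in> carrier G \<Longrightarrow> \<bar>right_avg hs (right_avg gs f) x - mean (right_avg gs f)\<bar> \<le> e"
    using mean_approx_right[OF r e] by auto
  have "(\<Sum>h\<leftarrow>hs. - right_avg gs f (\<one> \<otimes> h)) / length hs \<le> - c"
    using hs c by (intro sum_list_div_mono) (auto simp: translators_def)
  moreover have "(\<Sum>h\<leftarrow>hs. - right_avg gs f (\<one> \<otimes> h)) = - (\<Sum>h\<leftarrow>hs. right_avg gs f (\<one> \<otimes> h))"
    by (simp add: uminus_sum_list_map o_def)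
  ultimately have "c \<le> right_avg hs (right_avg gs f) \<one>" by (simp add: right_avg_def)
  with hs(2)[of \<one>] mean_right_avg[OF f gs] show "c \<le> mean f + e" by (simp add: abs_le_iff)
qed

lemma mean_const: "mean (\<lambda>x. c) = c"
proof (rule mean_eqI_right)
  fix e :: real assume "e > 0"
  then show "\<exists>gs\<in>translators. \<forall>x\<in>carrier G. \<bar>right_avg gs (\<lambda>x. c) x - c\<bar> \<le> e"
    by (intro bexI[of _ "[\<one>]"]) (auto simp: translators_def right_avg_def)
qed auto

lemma mean_ge_const:
  assumes f: "continuous_map T euclideanreal f" and c: "\<And>x. x \<in> carrier G \<Longrightarrow> c \<le> f x"
  shows "c \<le> mean f"
  using mean_ge[OF f, of "[\<one>]" c] c by (simp add: translators_def right_avg_def)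

lemma mean_uminus:
  "continuous_map T euclideanreal f \<Longrightarrow> mean (\<lambda>x. - f x) = - mean f"
  using mean_cmult[of f "-1"] by simp

lemma mean_diff:
  assumes f: "continuous_map T euclideanreal f" and h: "continuous_map T euclideanreal h"
  shows "mean (\<lambda>x. f x - h x) = mean f - mean h"
proof -
  have "continuous_map T euclideanreal (\<lambda>x. - h x)" using h by (intro continuous_intros)
  from mean_add[OF f this] show ?thesis by (simp add: mean_uminus[OF h])
qed

lemma mean_mono:
  assumes f: "continuous_map T euclideanreal f" and h: "continuous_map T euclideanreal h"
    and "\<And>x. x \<in> carrier G \<Longrightarrow> f x \<le> h x"
  shows "mean f \<le> mean h"
  using mean_ge_const[of "\<lambda>x. h x - f x" 0] mean_diff[OF h f] assms
  by (auto intro: continuous_intros)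

lemma mean_le_const:
  assumes f: "continuous_map T euclideanreal f" and c: "\<And>x. x \<in> carrier G \<Longrightarrow> f x \<le> c"
  shows "mean f \<le> c"
  using mean_mono[OF f, of "\<lambda>_. c"] c by (simp add: mean_const)

lemma mean_abs_diff_le:
  assumes f: "continuous_map T euclideanreal f" and h: "continuous_map T euclideanreal h"
    and e: "\<And>x. x \<in> carrier G \<Longrightarrow> \<bar>f x - h x\<bar> \<le> e"
  shows "\<bar>mean f - mean h\<bar> \<le> e"
proof -
  have d: "continuous_map T euclideanreal (\<lambda>x. f x - h x)" using f h by (rule continuous_map_diff)
  have b: "f x - h x \<le> e \<and> - e \<le> f x - h x" if "x \<in> carrier G" for x
    using e[OF that] by linarith
  have "mean (\<lambda>x. f x - h x) \<le> e" by (rule mean_le_const[OF d]) (use b in blast)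
  moreover have "- e \<le> mean (\<lambda>x. f x - h x)" by (rule mean_ge_const[OF d]) (use b in blast)
  ultimately show ?thesis using mean_diff[OF f h] by linarith
qed

lemma mean_sum:
  assumes "finite I" "\<And>i. i \<in> I \<Longrightarrow> continuous_map T euclideanreal (f i)"
  shows "mean (\<lambda>x. \<Sum>i\<in>I. f i x) = (\<Sum>i\<in>I. mean (f i))"
  using assms
  by (induction I) (auto simp: mean_const mean_add continuous_map_sum)

text \<open>Some translate of every point lies in \<open>U\<close>, so each average over the
  covering list has a summand at least \<open>c\<close> while the others are nonnegative;
  \<open>d\<close> is the reciprocal of the length of the list. It is fixed before \<open>f\<close>,
  which matters when \<open>f\<close> runs through a sequence of powers.\<close>

lemma mean_lower_bound:
  assumes U: "openin T U" "a \<in> U"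
  obtains d where "d > 0" "\<And>f. continuous_map T euclideanreal f \<Longrightarrow>
     (\<And>x. x \<in> carrier G \<Longrightarrow> 0 \<le> f x) \<Longrightarrow> (\<And>x. x \<in> U \<Longrightarrow> c \<le> f x) \<Longrightarrow> d * c \<le> mean f"
proof -
  obtain cs where cs: "cs \<in> translators" "\<And>x. x \<in> carrier G \<Longrightarrow> \<exists>c\<in>set cs. x \<otimes> c \<in> U"
    using finite_translates_cover[OF U] by auto
  have N: "real (length cs) > 0" using cs by (auto simp: translators_def)
  show thesis
  proof
    show "1 / real (length cs) > 0" using N by simp
    fix f assume f: "continuous_map T euclideanreal f" and pos: "\<And>x. x \<in> carrier G \<Longrightarrow> 0 \<le> f x"
      and c: "\<And>x. x \<in> U \<Longrightarrow> c \<le> f x"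
    show "1 / real (length cs) * c \<le> mean f"
    proof (rule mean_ge[OF f cs(1)])
      fix x assume x: "x \<in> carrier G"
      obtain k where k: "k \<in> set cs" "x \<otimes> k \<in> U" using cs(2)[OF x] by auto
      have "c \<le> f (x \<otimes> k)" using c k by auto
      also have "\<dots> \<le> (\<Sum>g\<leftarrow>cs. f (x \<otimes> g))"
        using k cs x pos by (intro member_le_sum_list) (auto simp: translators_def)
      finally show "1 / real (length cs) * c \<le> right_avg cs f x"
        using N by (simp add: right_avg_def divide_right_mono)
    qed
  qed
qed

lemma mean_pos:
  assumes f: "continuous_map T euclideanreal f" and pos: "\<And>x. x \<in> carrier G \<Longrightarrow> 0 \<le> f x"
    and a: "a \<in> carrier G" "f a > 0"
  shows "mean f > 0"
proof -
  let ?U = "{x \<in> topspace T. f x \<in> {f a / 2 <..}}"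
  have "openin T ?U" by (rule openin_continuous_map_preimage[OF f]) auto
  moreover have "a \<in> ?U" using a topspace_eq by simp
  ultimately obtain d where d: "d > 0" "\<And>h. continuous_map T euclideanreal h \<Longrightarrow>
     (\<And>x. x \<in> carrier G \<Longrightarrow> 0 \<le> h x) \<Longrightarrow> (\<And>x. x \<in> ?U \<Longrightarrow> f a / 2 \<le> h x) \<Longrightarrow> d * (f a / 2) \<le> mean h"
    using mean_lower_bound[of ?U a "f a / 2"] by blast
  have "d * (f a / 2) \<le> mean f" using f pos by (intro d(2)) auto
  then show ?thesis using d(1) a(2) by (smt (verit) half_gt_zero mult_pos_pos)
qed

section \<open>Means depending on a parameter\<close>

lemma continuous_map_slice:
  assumes F: "continuous_map (prod_topology Y T) euclideanreal (\<lambda>(y, x). F y x)" and y: "y \<in> topspace Y"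
  shows "continuous_map T euclideanreal (F y)"
proof -
  have "continuous_map T (prod_topology Y T) (\<lambda>x. (y, x))" using y by (intro continuous_intros) auto
  from continuous_map_compose[OF this F] show ?thesis by (simp add: o_def)
qed

lemma continuous_map_mean:
  assumes F: "continuous_map (prod_topology Y T) euclideanreal (\<lambda>(y, x). F y x)"
  shows "continuous_map Y euclideanreal (\<lambda>y. mean (F y))"
proof -
  have "\<exists>U. openin Y U \<and> y0 \<in> U \<and> (\<forall>y\<in>U. mean (F y) \<in> ball (mean (F y0)) e)"
    if y0: "y0 \<in> topspace Y" and e: "e > 0" for y0 e
  proof -
    obtain U where U: "openin Y U" "y0 \<in> U"
      "\<And>y x. y \<in> U \<Longrightarrow> x \<in> carrier G \<Longrightarrow> \<bar>F y x - F y0 x\<bar> < e / 2"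
      using tube_uniform[OF F y0, of "e/2"] e by auto
    have "\<bar>mean (F y) - mean (F y0)\<bar> < e" if y: "y \<in> U" for y
    proof -
      have yt: "y \<in> topspace Y" using y U openin_subset by blast
      have "\<bar>mean (F y) - mean (F y0)\<bar> \<le> e / 2"
        using U(3)[OF y] by (intro mean_abs_diff_le continuous_map_slice[OF F] yt y0) (simp add: less_imp_le)
      then show ?thesis using e by linarith
    qed
    then show ?thesis using U by (intro exI[of _ U]) (auto simp: dist_real_def abs_minus_commute)
  qed
  then show ?thesis
    unfolding mtopology_is_euclidean[symmetric] Met_TC.continuous_map_to_metric by simp
qed

text \<open>By compactness finitely many slices \<open>F y0\<close> approximate all slices
  uniformly. One list \<open>gs\<close> that averages these slices and \<open>h\<close> at once
  therefore gives \<open>right_avg gs (F y) \<one>\<close> close to \<open>mean (F y)\<close> for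
  every \<open>y\<close>. Taking the mean over \<open>y\<close> of this finite sum gives
  \<open>right_avg gs h \<one>\<close>, which is close to \<open>mean h\<close>.\<close>

lemma mean_Fubini:
  assumes F: "continuous_map (prod_topology T T) euclideanreal (\<lambda>(y, x). F y x)"
  shows "mean (\<lambda>y. mean (\<lambda>x. F y x)) = mean (\<lambda>x. mean (\<lambda>y. F y x))"
proof -
  have F': "continuous_map (prod_topology T T) euclideanreal (\<lambda>(x, y). F y x)"
  proof -
    have "continuous_map (prod_topology T T) (prod_topology T T) (\<lambda>p. (snd p, fst p))"
      by (intro continuous_intros continuous_map_fst continuous_map_snd)
    from continuous_map_compose[OF this F] show ?thesis by (simp add: o_def case_prod_beta')
  qed
  note cy = continuous_map_slice[OF F, unfolded topspace_eq]
  note cx = continuous_map_slice[OF F', unfolded topspace_eq]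
  define h where "h = (\<lambda>x. mean (\<lambda>y. F y x))"
  define k where "k = (\<lambda>y. mean (F y))"
  have h: "continuous_map T euclideanreal h" unfolding h_def by (rule continuous_map_mean[OF F'])
  have k: "continuous_map T euclideanreal k" unfolding k_def by (rule continuous_map_mean[OF F])
  have "\<bar>mean k - mean h\<bar> \<le> 0 + e" if e: "e > 0" for e
  proof -
    have "\<exists>U. openin T U \<and> y0 \<in> U \<and> (\<forall>y\<in>U. \<forall>x\<in>carrier G. \<bar>F y x - F y0 x\<bar> < e / 8)"
      if y0: "y0 \<in> carrier G" for y0
      using tube_uniform[OF F, of y0 "e/8"] y0 topspace_eq e by (metis zero_less_divide_iff zero_less_numeral)
    then obtain U where U: "\<And>y0. y0 \<in> carrier G \<Longrightarrow> openin T (U y0) \<and> y0 \<in> U y0 \<and>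
        (\<forall>y\<in>U y0. \<forall>x\<in>carrier G. \<bar>F y x - F y0 x\<bar> < e / 8)" by metis
    have "\<exists>\<F>. finite \<F> \<and> \<F> \<subseteq> U ` carrier G \<and> topspace T \<subseteq> \<Union>\<F>"
    proof (rule compactinD[OF compact[unfolded compact_space_def]])
      show "openin T V" if "V \<in> U ` carrier G" for V using that U by blast
      show "topspace T \<subseteq> \<Union> (U ` carrier G)" using U topspace_eq by blast
    qed
    then obtain Y where Y: "finite Y" "Y \<subseteq> carrier G" "topspace T \<subseteq> (\<Union>y\<in>Y. U y)"
      by (metis finite_subset_image)
    have "\<And>f. f \<in> insert h (F ` Y) \<Longrightarrow> continuous_map T euclideanreal f"
      using Y(2) h cy by blast
    then obtain gs where gs: "gs \<in> translators"
      "\<And>f x. f \<in> insert h (F ` Y) \<Longrightarrow> x \<in> carrier G \<Longrightarrow> \<bar>right_avg gs f x - mean f\<bar> \<le> e / 8"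
      using mean_approx_simultaneous[of "insert h (F ` Y)" "e/8"] Y(1) e
      by (metis finite.insertI finite_imageI zero_less_divide_iff zero_less_numeral)
    have close: "\<bar>right_avg gs (F y) \<one> - k y\<bar> \<le> e / 2" if y: "y \<in> carrier G" for y
    proof -
      obtain y0 where y0: "y0 \<in> Y" "y \<in> U y0" using Y y topspace_eq by auto
      have y0G: "y0 \<in> carrier G" using y0 Y by auto
      have d: "\<bar>F y x - F y0 x\<bar> < e / 8" if "x \<in> carrier G" for x using U[OF y0G] y0 that by auto
      have 1: "\<bar>right_avg gs (F y0) \<one> - mean (F y0)\<bar> \<le> e / 8" using gs y0 by auto
      have 2: "\<bar>mean (F y) - mean (F y0)\<bar> \<le> e / 8"
        using d by (intro mean_abs_diff_le cy y y0G) (simp add: less_imp_le)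
      have "\<bar>right_avg gs (\<lambda>x. F y x - F y0 x) \<one> - 0\<bar> \<le> e / 8"
        using d by (intro right_avg_abs[OF gs(1)]) (auto intro: less_imp_le)
      moreover have "right_avg gs (\<lambda>x. F y x - F y0 x) \<one> = right_avg gs (F y) \<one> - right_avg gs (F y0) \<one>"
        by (simp add: right_avg_def sum_list_subtractf diff_divide_distrib)
      ultimately show ?thesis using 1 2 e unfolding k_def by linarith
    qed
    have gsG: "set gs \<subseteq> carrier G" using gs by (simp add: translators_def)
    have m: "continuous_map T euclideanreal (\<lambda>y. \<Sum>g\<leftarrow>gs. F y (\<one> \<otimes> g)) \<and>
       mean (\<lambda>y. \<Sum>g\<leftarrow>gs. F y (\<one> \<otimes> g)) = (\<Sum>g\<leftarrow>gs. h (\<one> \<otimes> g))" if "set gs \<subseteq> carrier G" for gs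
      using that
    proof (induction gs)
      case Nil
      then show ?case by (simp add: mean_const)
    next
      case (Cons g gs)
      then show ?case using cx[of g]
        by (auto simp: mean_add h_def intro!: continuous_intros)
    qed
    have rc: "continuous_map T euclideanreal (\<lambda>y. right_avg gs (F y) \<one>)"
      unfolding right_avg_def using m[OF gsG] gs(1)
      by (intro continuous_map_real_divide) (auto simp: translators_def)
    have mr: "mean (\<lambda>y. right_avg gs (F y) \<one>) = right_avg gs h \<one>"
      using mean_cmult[of "\<lambda>y. \<Sum>g\<leftarrow>gs. F y (\<one> \<otimes> g)" "1 / length gs"] m[OF gsG]
      by (simp add: right_avg_def)
    have "\<bar>right_avg gs h \<one> - mean k\<bar> \<le> e / 2"
      using mean_abs_diff_le[OF rc k close] mr by simp
    moreover have "\<bar>right_avg gs h \<one> - mean h\<bar> \<le> e / 8" using gs(2)[of h \<one>] by simp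
    ultimately show ?thesis using e by linarith
  qed
  then have "\<bar>mean k - mean h\<bar> \<le> 0" by (rule field_le_epsilon)
  then show ?thesis by (simp add: h_def k_def)
qed

end

section \<open>Convolution\<close>

context compact_group
begin

abbreviation cont :: "('a \<Rightarrow> real) \<Rightarrow> bool" where
  "cont \<equiv> continuous_map T euclideanreal"

text \<open>Real functions suffice: continuous real functions separate points, and the orthogonal
  matrices that arise from them are unitary over the complex numbers.\<close>

definition ip :: "('a \<Rightarrow> real) \<Rightarrow> ('a \<Rightarrow> real) \<Rightarrow> real" where
  "ip f g = mean (\<lambda>x. f x * g x)"

definition conv :: "('a \<Rightarrow> real) \<Rightarrow> ('a \<Rightarrow> real) \<Rightarrow> 'a \<Rightarrow> real" where
  "conv f g x = mean (\<lambda>y. f y * g (inv y \<otimes> x))"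

definition reflect :: "('a \<Rightarrow> real) \<Rightarrow> 'a \<Rightarrow> real" where
  "reflect f x = f (inv x)"

lemma cont_reflect: "cont f \<Longrightarrow> cont (reflect f)"
  unfolding reflect_def[abs_def] by (rule continuous_map_inv_arg)

lemma cont_mult: "cont f \<Longrightarrow> cont g \<Longrightarrow> cont (\<lambda>x. f x * g x)"
  by (rule continuous_map_real_mult)

lemma cont_diff: "cont f \<Longrightarrow> cont g \<Longrightarrow> cont (\<lambda>x. f x - g x)"
  by (rule continuous_map_diff)

lemma cont_cmult: "cont f \<Longrightarrow> cont (\<lambda>x. c * f x)"
  by (rule continuous_map_real_mult_left)

lemma cont_inv_mult: "cont f \<Longrightarrow> x \<in> carrier G \<Longrightarrow> cont (\<lambda>y. f (inv y \<otimes> x))"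
  by (rule continuous_map_real_comp) (auto intro!: group_continuous_intros)

lemma cont_mult_inv: "cont f \<Longrightarrow> x \<in> carrier G \<Longrightarrow> cont (\<lambda>y. f (x \<otimes> inv y))"
  by (rule continuous_map_real_comp) (auto intro!: group_continuous_intros)

lemma cont_conv:
  assumes f: "cont f" and g: "cont g"
  shows "cont (conv f g)"
proof -
  have "continuous_map (prod_topology T T) euclideanreal (\<lambda>(x, y). f y * g (inv y \<otimes> x))"
    unfolding case_prod_beta'
    by (intro continuous_map_real_mult continuous_map_real_comp[OF f] continuous_map_real_comp[OF g]
        group_continuous_intros)
  from continuous_map_mean[OF this] show ?thesis by (simp add: conv_def[abs_def])
qed

lemma conv_cong:
  assumes "\<And>y. y \<in> carrier G \<Longrightarrow> f y = f' y" "\<And>y. y \<in> carrier G \<Longrightarrow> g y = g' y" "x \<in> carrier G"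
  shows "conv f g x = conv f' g' x"
  unfolding conv_def using assms by (intro mean_cong) auto

lemma ip_cong:
  assumes "\<And>y. y \<in> carrier G \<Longrightarrow> f y = f' y" "\<And>y. y \<in> carrier G \<Longrightarrow> g y = g' y"
  shows "ip f g = ip f' g'"
  unfolding ip_def using assms by (intro mean_cong) auto

text \<open>Substitute \<open>x \<otimes> inv y\<close> for \<open>y\<close>, by invariance under
  inversion and right translation. As an inner product the value is open to Cauchy-Schwarz and to
  linearity.\<close>

lemma conv_alt:
  assumes f: "cont f" and g: "cont g" and x: "x \<in> carrier G"
  shows "conv f g x = ip (\<lambda>y. f (x \<otimes> inv y)) g"
proof -
  have c: "cont (\<lambda>y. f y * g (inv y \<otimes> x))" using f g x by (intro cont_mult cont_inv_mult)
  have "conv f g x = mean (\<lambda>y. f (inv y) * g (inv (inv y) \<otimes> x))"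
    unfolding conv_def using mean_inv[OF c] by simp
  also have "\<dots> = mean (\<lambda>y. f (inv (y \<otimes> inv x)) * g (inv (inv (y \<otimes> inv x)) \<otimes> x))"
    using x by (intro mean_right[symmetric] continuous_map_inv_arg[OF c]) auto
  also have "\<dots> = ip (\<lambda>y. f (x \<otimes> inv y)) g"
    unfolding ip_def using x by (intro mean_cong) (simp add: inv_mult_group m_assoc)
  finally show ?thesis .
qed

text \<open>Fubini exchanges the two means, and left invariance replaces
  \<open>inv y \<otimes> z\<close> by a new variable.\<close>

lemma conv_assoc:
  assumes f: "cont f" and g: "cont g" and h: "cont h" and x: "x \<in> carrier G"
  shows "conv (conv f g) h x = conv f (conv g h) x"
proof -
  have c: "continuous_map (prod_topology T T) euclideanreal (\<lambda>(z, y). f y * g (inv y \<otimes> z) * h (inv z \<otimes> x))"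
    unfolding case_prod_beta' using x
    by (intro continuous_map_real_mult continuous_map_real_comp[OF f] continuous_map_real_comp[OF g]
        continuous_map_real_comp[OF h] group_continuous_intros)
  have "conv (conv f g) h x = mean (\<lambda>z. mean (\<lambda>y. f y * g (inv y \<otimes> z) * h (inv z \<otimes> x)))"
    unfolding conv_def
  proof (rule mean_cong)
    fix z assume z: "z \<in> carrier G"
    have "cont (\<lambda>y. f y * g (inv y \<otimes> z))" using f g z by (intro cont_mult cont_inv_mult)
    from mean_cmult[OF this, of "h (inv z \<otimes> x)"]
    show "mean (\<lambda>y. f y * g (inv y \<otimes> z)) * h (inv z \<otimes> x) = mean (\<lambda>y. f y * g (inv y \<otimes> z) * h (inv z \<otimes> x))"
      by (simp add: mult_ac)
  qed
  also have "\<dots> = mean (\<lambda>y. mean (\<lambda>z. f y * g (inv y \<otimes> z) * h (inv z \<otimes> x)))"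
    by (rule mean_Fubini[OF c])
  also have "\<dots> = conv f (conv g h) x"
    unfolding conv_def
  proof (rule mean_cong)
    fix y assume y: "y \<in> carrier G"
    have c1: "cont (\<lambda>w. g w * h (inv w \<otimes> (inv y \<otimes> x)))"
      using g h x y by (intro cont_mult cont_inv_mult) auto
    have "mean (\<lambda>w. g w * h (inv w \<otimes> (inv y \<otimes> x))) =
          mean (\<lambda>z. g (inv y \<otimes> z) * h (inv (inv y \<otimes> z) \<otimes> (inv y \<otimes> x)))"
      using y by (intro mean_left[OF c1, symmetric]) auto
    also have "\<dots> = mean (\<lambda>z. g (inv y \<otimes> z) * h (inv z \<otimes> x))"
    proof (rule mean_cong)
      fix z assume z: "z \<in> carrier G"
      have "inv (inv y \<otimes> z) \<otimes> (inv y \<otimes> x) = inv z \<otimes> (y \<otimes> inv y) \<otimes> x"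
        using x y z by (simp add: inv_mult_group m_assoc del: r_inv Units_r_inv)
      then show "g (inv y \<otimes> z) * h (inv (inv y \<otimes> z) \<otimes> (inv y \<otimes> x)) = g (inv y \<otimes> z) * h (inv z \<otimes> x)"
        using x y z by simp
    qed
    finally have e: "mean (\<lambda>w. g w * h (inv w \<otimes> (inv y \<otimes> x))) = mean (\<lambda>z. g (inv y \<otimes> z) * h (inv z \<otimes> x))" .
    have "cont (\<lambda>z. g (inv y \<otimes> z) * h (inv z \<otimes> x))"
      using g h x y by (intro cont_mult cont_inv_mult continuous_map_left_translate) auto
    from mean_cmult[OF this, of "f y"]
    show "mean (\<lambda>z. f y * g (inv y \<otimes> z) * h (inv z \<otimes> x)) = f y * mean (\<lambda>w. g w * h (inv w \<otimes> (inv y \<otimes> x)))"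
      unfolding e by (simp add: mult_ac)
  qed
  finally show ?thesis .
qed

lemma reflect_conv:
  assumes f: "cont f" and g: "cont g" and x: "x \<in> carrier G"
  shows "reflect (conv f g) x = conv (reflect g) (reflect f) x"
proof -
  have "reflect (conv f g) x = mean (\<lambda>y. f (inv x \<otimes> inv y) * g y)"
    using conv_alt[OF f g, of "inv x"] x by (simp add: reflect_def ip_def)
  also have "\<dots> = mean (\<lambda>y. f (inv x \<otimes> inv (inv y)) * g (inv y))"
    using x by (intro mean_inv[symmetric] cont_mult cont_mult_inv f g) auto
  also have "\<dots> = conv (reflect g) (reflect f) x"
    unfolding conv_def reflect_def using x by (intro mean_cong) (simp add: inv_mult_group)
  finally show ?thesis .
qed

text \<open>Evaluation at \<open>\<one>\<close> plays the role of a trace for convolution operators,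
  and reflection that of the adjoint.\<close>

lemma conv_reflect_one: "conv f (reflect g) \<one> = ip f g"
  unfolding conv_def ip_def reflect_def by (intro mean_cong) simp

lemma ip_commute: "ip f g = ip g f"
  unfolding ip_def by (simp add: mult.commute)

lemma ip_diff_right: "cont f \<Longrightarrow> cont g \<Longrightarrow> cont h \<Longrightarrow> ip f (\<lambda>x. g x - h x) = ip f g - ip f h"
  unfolding ip_def right_diff_distrib by (intro mean_diff cont_mult)

lemma ip_cmult_right: "cont f \<Longrightarrow> cont g \<Longrightarrow> ip f (\<lambda>x. c * g x) = c * ip f g"
  unfolding ip_def using mean_cmult[of "\<lambda>x. f x * g x" c] by (simp add: mult_ac cont_mult)

lemma cont_sum:
  assumes "\<And>i. i < (k :: nat) \<Longrightarrow> cont (e i)"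
  shows "cont (\<lambda>x. \<Sum>i<k. c i * e i x)"
  using assms by (intro continuous_map_sum cont_cmult) auto

lemma ip_sum_right:
  assumes f: "cont f" and e: "\<And>i. i < (k :: nat) \<Longrightarrow> cont (e i)"
  shows "ip f (\<lambda>x. \<Sum>i<k. c i * e i x) = (\<Sum>i<k. c i * ip f (e i))"
proof -
  have "ip f (\<lambda>x. \<Sum>i<k. c i * e i x) = mean (\<lambda>x. \<Sum>i<k. f x * (c i * e i x))"
    unfolding ip_def sum_distrib_left ..
  also have "\<dots> = (\<Sum>i<k. mean (\<lambda>x. f x * (c i * e i x)))"
    using f e by (intro mean_sum cont_mult cont_cmult) auto
  also have "\<dots> = (\<Sum>i<k. c i * ip f (e i))"
    using f e ip_cmult_right[OF f] by (intro sum.cong) (auto simp: ip_def)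
  finally show ?thesis .
qed

lemma ip_self_nonneg: "cont f \<Longrightarrow> ip f f \<ge> 0"
  unfolding ip_def by (intro mean_ge_const cont_mult) auto

lemma ip_self_pos: "cont f \<Longrightarrow> x \<in> carrier G \<Longrightarrow> f x \<noteq> 0 \<Longrightarrow> ip f f > 0"
  unfolding ip_def by (rule mean_pos[of _ x]) (auto intro: cont_mult simp: zero_less_mult_iff)

lemma ip_Cauchy_Schwarz:
  assumes f: "cont f" and g: "cont g"
  shows "(ip f g)\<^sup>2 \<le> ip f f * ip g g"
proof (cases "ip g g = 0")
  case True
  then have "g x = 0" if "x \<in> carrier G" for x using ip_self_pos[OF g that] by force
  then have "ip f g = ip f (\<lambda>x. 0)" by (intro ip_cong) auto
  then show ?thesis using True by (simp add: ip_def mean_const)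
next
  case False
  \<comment> \<open>The component of \<open>f\<close> orthogonal to \<open>g\<close>, scaled by
    \<open>ip g g\<close> to avoid a division.\<close>
  define h where "h = (\<lambda>x. ip g g * f x - ip f g * g x)"
  have c: "cont (\<lambda>x. ip g g * f x)" "cont (\<lambda>x. ip f g * g x)" using f g by (auto intro: cont_cmult)
  have h: "cont h" unfolding h_def using c by (rule cont_diff)
  have hf: "ip h f = ip g g * ip f f - ip f g * ip f g"
    using f g c ip_commute[of h f] by (simp add: h_def ip_diff_right ip_cmult_right ip_commute[of f g])
  have hg: "ip h g = 0"
    using f g c ip_commute[of h g] by (simp add: h_def ip_diff_right ip_cmult_right ip_commute[of g f])
  have "0 \<le> ip h h" by (rule ip_self_nonneg[OF h])
  also have "ip h h = ip h (\<lambda>x. ip g g * f x - ip f g * g x)" by (simp add: h_def)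
  also have "\<dots> = ip g g * (ip g g * ip f f - ip f g * ip f g)"
    using h f g c by (simp add: ip_diff_right ip_cmult_right hf hg)
  finally show ?thesis using False ip_self_nonneg[OF g]
    by (simp add: zero_le_mult_iff power2_eq_square mult.commute)
qed

lemma ip_translate_inv:
  assumes f: "cont f" and x: "x \<in> carrier G"
  shows "ip (\<lambda>y. f (x \<otimes> inv y)) (\<lambda>y. f (x \<otimes> inv y)) = ip f f"
proof -
  have ff: "cont (\<lambda>y. f y * f y)" using f by (intro cont_mult)
  have "ip (\<lambda>y. f (x \<otimes> inv y)) (\<lambda>y. f (x \<otimes> inv y)) = mean (\<lambda>y. f (x \<otimes> y) * f (x \<otimes> y))"
    unfolding ip_def using x mean_inv[OF continuous_map_left_translate[OF ff x]] by simp
  also have "\<dots> = ip f f" unfolding ip_def using mean_left[OF ff x] by simp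
  finally show ?thesis .
qed

text \<open>This is Cauchy-Schwarz for the inner product form of the convolution. One convolution
  with a fixed function thus turns mean-square estimates into uniform ones.\<close>

lemma conv_bound:
  assumes f: "cont f" and g: "cont g" and x: "x \<in> carrier G"
  shows "(conv f g x)\<^sup>2 \<le> ip f f * ip g g"
  using ip_Cauchy_Schwarz[OF cont_mult_inv[OF f x] g] conv_alt[OF f g x] ip_translate_inv[OF f x] by simp

lemma mean_uniform_limit:
  assumes F: "\<And>n. cont (F n)" and L: "cont L" and lim: "uniform_limit (carrier G) F L sequentially"
  shows "(\<lambda>n. mean (F n)) \<longlonglongrightarrow> mean L"
proof (rule LIMSEQ_I)
  fix e :: real assume e: "e > 0"
  obtain N where N: "\<And>n x. n \<ge> N \<Longrightarrow> x \<in> carrier G \<Longrightarrow> dist (F n x) (L x) < e / 2"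
    using lim e unfolding uniform_limit_sequentially_iff by (metis half_gt_zero)
  have "norm (mean (F n) - mean L) < e" if n: "n \<ge> N" for n
  proof -
    have "\<bar>mean (F n) - mean L\<bar> \<le> e / 2"
      using N[OF n] by (intro mean_abs_diff_le F L) (simp add: dist_real_def less_imp_le)
    then show ?thesis using e by simp
  qed
  then show "\<exists>N. \<forall>n\<ge>N. norm (mean (F n) - mean L) < e" by blast
qed

lemma cont_bounded: "cont f \<Longrightarrow> bounded (f ` carrier G)"
  using continuous_bounded[of f] unfolding bounded_pos by (metis imageE real_norm_def)

lemma conv_uniform_limit:
  assumes F: "\<And>n. cont (F n)" "cont f" "uniform_limit (carrier G) F f sequentially"
    and H: "\<And>n. cont (H n)" "cont h" "uniform_limit (carrier G) H h sequentially"
    and x: "x \<in> carrier G"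
  shows "(\<lambda>n. conv (F n) (H n) x) \<longlonglongrightarrow> conv f h x"
  unfolding conv_def
proof (rule mean_uniform_limit)
  show "cont (\<lambda>y. F n y * H n (inv y \<otimes> x))" for n using F H x by (intro cont_mult cont_inv_mult)
  show "cont (\<lambda>y. f y * h (inv y \<otimes> x))" using F H x by (intro cont_mult cont_inv_mult)
  show "uniform_limit (carrier G) (\<lambda>n y. F n y * H n (inv y \<otimes> x)) (\<lambda>y. f y * h (inv y \<otimes> x)) sequentially"
  proof (rule uniform_lim_mult[OF F(3)])
    show "uniform_limit (carrier G) (\<lambda>n y. H n (inv y \<otimes> x)) (\<lambda>y. h (inv y \<otimes> x)) sequentially"
      using H(3) x unfolding uniform_limit_sequentially_iff by (metis inv_closed m_closed)
    show "bounded (f ` carrier G)" by (rule cont_bounded[OF F(2)])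
    show "bounded ((\<lambda>y. h (inv y \<otimes> x)) ` carrier G)"
      using H(2) x by (intro cont_bounded cont_inv_mult)
  qed
qed

end

section \<open>The leading spectral projection of a convolution operator\<close>

text \<open>The model is the sum of the powers with exponent \<open>n + 1\<close> of positive
  eigenvalues, counted with multiplicity; \<mu> is the largest of them, and
  \<open>\<mu> ^ Suc n \<le> A n\<close> says that it occurs at least once. Log-convexity makes the
  ratios increase to \<mu>. If a normalized term were below 1, submultiplicativity would force
  exponential decay of the normalized sequence, which ratios tending to \<mu> exclude.\<close>

lemma log_convex_submultiplicative:
  fixes A :: "nat \<Rightarrow> real"
  assumes pos: "\<And>n. A n > 0"
    and logconv: "\<And>n. (A (Suc n))\<^sup>2 \<le> A n * A (Suc (Suc n))"
    and submult: "\<And>m n. A (Suc (m + n)) \<le> A m * A n"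
  obtains \<mu> where "\<mu> > 0" "\<And>n. A (Suc n) \<le> \<mu> * A n" "\<And>n. \<mu> ^ Suc n \<le> A n"
proof -
  define r where "r = (\<lambda>n. A (Suc n) / A n)"
  have r_inc: "incseq r"
  proof (rule incseq_SucI)
    fix n
    show "r n \<le> r (Suc n)"
      using logconv[of n] pos[of n] pos[of "Suc n"] unfolding r_def
      by (simp add: field_simps power2_eq_square)
  qed
  have r_le: "r n \<le> A 0" for n
    using submult[of n 0] pos[of n] unfolding r_def by (simp add: field_simps)
  define \<mu> where "\<mu> = (SUP n. r n)"
  have bdd: "bdd_above (range r)" using r_le by (intro bdd_aboveI[of _ "A 0"]) auto
  have r_mu: "r n \<le> \<mu>" for n unfolding \<mu>_def using bdd by (rule cSUP_upper[rotated]) auto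
  have "r 0 > 0" unfolding r_def using pos by simp
  then have mu: "\<mu> > 0" using r_mu[of 0] by linarith
  have lim: "r \<longlonglongrightarrow> \<mu>" unfolding \<mu>_def using LIMSEQ_incseq_SUP[OF bdd r_inc] .
  have dec: "A (Suc n) \<le> \<mu> * A n" for n
    using r_mu[of n] pos[of n] unfolding r_def by (simp add: field_simps)
  define b where "b = (\<lambda>n. A n / \<mu> ^ Suc n)"
  have b_pos: "b n > 0" for n unfolding b_def using pos mu by simp
  have b_dec: "decseq b"
  proof (rule decseq_SucI)
    fix n show "b (Suc n) \<le> b n"
      using dec[of n] mu unfolding b_def by (simp add: field_simps)
  qed
  have b_sub: "b (Suc (m + n)) \<le> b m * b n" for m n
    using submult[of m n] mu unfolding b_def by (simp add: field_simps power_add)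
  have b_ge: "b n \<ge> 1" for n
  proof (rule ccontr)
    assume "\<not> b n \<ge> 1"
    define \<beta> where "\<beta> = b n"
    have beta: "0 < \<beta>" "\<beta> < 1" using b_pos \<open>\<not> b n \<ge> 1\<close> by (auto simp: \<beta>_def)
    define N where "N = Suc n"
    \<comment> \<open>Since \<open>b n = \<beta>\<close>, submultiplicativity makes each further
      block of \<open>N = Suc n\<close> indices cost another factor \<beta>.\<close>
    have up: "b (k * N + n) \<le> \<beta> ^ Suc k" for k
    proof (induction k)
      case (Suc k)
      have "b (Suc k * N + n) = b (Suc (n + (k * N + n)))" by (simp add: N_def algebra_simps)
      also have "\<dots> \<le> \<beta> * b (k * N + n)" unfolding \<beta>_def by (rule b_sub)
      also have "\<dots> \<le> \<beta> * \<beta> ^ Suc k" using Suc beta by (intro mult_left_mono) auto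
      finally show ?case by simp
    qed (simp add: \<beta>_def)
    \<comment> \<open>Chosen so that Bernoulli's inequality gives
      \<open>(1 - \<delta>) ^ N \<ge> (1 + \<beta>) / 2 > \<beta>\<close>: over a block of length
      \<open>N\<close> the ratios eventually allow less decay than \<beta>.\<close>
    define \<delta> where "\<delta> = (1 - \<beta>) / (2 * N)"
    have delta: "0 < \<delta>" "\<delta> \<le> 1" using beta by (auto simp: \<delta>_def N_def field_simps)
    have "(1 - \<delta>) * \<mu> < \<mu>" using mu delta by simp
    with lim have "eventually (\<lambda>n. r n > (1 - \<delta>) * \<mu>) sequentially" by (rule order_tendstoD)
    then obtain n0 where n0: "\<And>m. m \<ge> n0 \<Longrightarrow> r m > (1 - \<delta>) * \<mu>"
      unfolding eventually_sequentially by auto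
    have low1: "b (Suc m) \<ge> (1 - \<delta>) * b m" if "m \<ge> n0" for m
    proof -
      have "(1 - \<delta>) * A m \<le> A (Suc m) / \<mu>"
        using n0[OF that] pos[of m] mu unfolding r_def by (simp add: field_simps)
      then have "(1 - \<delta>) * A m / \<mu> ^ Suc m \<le> A (Suc m) / \<mu> / \<mu> ^ Suc m"
        using mu by (intro divide_right_mono) auto
      then show ?thesis by (simp add: b_def)
    qed
    have low: "b (n0 + j) \<ge> (1 - \<delta>) ^ j * b n0" for j
    proof (induction j)
      case (Suc j)
      have "(1 - \<delta>) ^ Suc j * b n0 \<le> (1 - \<delta>) * b (n0 + j)"
        using Suc delta by (simp add: mult.assoc mult_left_mono)
      also have "\<dots> \<le> b (n0 + Suc j)" using low1[of "n0 + j"] by simp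
      finally show ?case .
    qed simp
    define \<gamma> where "\<gamma> = (1 - \<delta>) ^ N"
    have "1 + real N * (- \<delta>) \<le> (1 + (- \<delta>)) ^ N" using delta by (intro Bernoulli_inequality) auto
    then have "\<gamma> \<ge> 1 - N * \<delta>" by (simp add: \<gamma>_def)
    moreover have "1 - N * \<delta> = (1 + \<beta>) / 2" by (simp add: \<delta>_def N_def field_simps)
    ultimately have gamma: "\<gamma> > \<beta>" using beta by simp
    \<comment> \<open>The lower bound at \<open>n0 + Suc k * N\<close> meets the upper bound at the
      smaller index \<open>k * N + n\<close>, because \<open>b\<close> decreases. Since
      \<open>\<gamma> / \<beta> > 1\<close>, this fails for large \<open>k\<close>.\<close>
    have bound: "(\<gamma> / \<beta>) ^ Suc k \<le> 1 / b n0" for k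
    proof -
      have "\<gamma> ^ Suc k * b n0 \<le> b (n0 + Suc k * N)"
        using low[of "Suc k * N"] unfolding \<gamma>_def by (metis power_mult mult.commute)
      also have "\<dots> \<le> b (k * N + n)" using b_dec by (simp add: decseq_def N_def)
      also have "\<dots> \<le> \<beta> ^ Suc k" by (rule up)
      finally show ?thesis using beta b_pos[of n0] by (simp add: field_simps power_divide)
    qed
    have gb: "\<gamma> / \<beta> > 1" using gamma beta by simp
    obtain k where k: "(\<gamma> / \<beta>) ^ k > 1 / b n0" using real_arch_pow[OF gb] by blast
    have "(\<gamma> / \<beta>) ^ k \<le> (\<gamma> / \<beta>) ^ Suc k" using gb by (intro power_increasing) auto
    with k bound[of k] show False by linarith
  qed
  show thesis
  proof (rule that[OF mu dec])
    fix n show "\<mu> ^ Suc n \<le> A n" using b_ge[of n] mu unfolding b_def by (simp add: field_simps)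
  qed
qed


context compact_group
begin

text \<open>\<open>conv_pow \<phi> n\<close> is the convolution power of exponent \<open>n + 1\<close>.\<close>

primrec conv_pow :: "('a \<Rightarrow> real) \<Rightarrow> nat \<Rightarrow> 'a \<Rightarrow> real" where
  "conv_pow \<phi> 0 = \<phi>"
| "conv_pow \<phi> (Suc n) = conv \<phi> (conv_pow \<phi> n)"

lemma cont_conv_pow: "cont \<phi> \<Longrightarrow> cont (conv_pow \<phi> n)"
  by (induction n) (auto intro: cont_conv)

text \<open>The exponents \<open>m + 1\<close> and \<open>n + 1\<close> add up to
  \<open>m + n + 2\<close>, which has index \<open>Suc (m + n)\<close>.\<close>

lemma conv_pow_add:
  assumes "cont \<phi>" "x \<in> carrier G"
  shows "conv (conv_pow \<phi> m) (conv_pow \<phi> n) x = conv_pow \<phi> (Suc (m + n)) x"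
  using assms(2)
proof (induction m arbitrary: x)
  case (Suc m)
  have "conv (conv_pow \<phi> (Suc m)) (conv_pow \<phi> n) x = conv \<phi> (conv (conv_pow \<phi> m) (conv_pow \<phi> n)) x"
    using assms Suc.prems by (simp add: conv_assoc cont_conv_pow)
  also have "\<dots> = conv \<phi> (conv_pow \<phi> (Suc (m + n))) x"
    using Suc by (intro conv_cong) auto
  finally show ?case by simp
qed simp

lemma reflect_conv_pow:
  assumes "cont \<phi>" "\<And>x. x \<in> carrier G \<Longrightarrow> reflect \<phi> x = \<phi> x" "x \<in> carrier G"
  shows "reflect (conv_pow \<phi> n) x = conv_pow \<phi> n x"
  using assms(3)
proof (induction n arbitrary: x)
  case (Suc n)
  have "reflect (conv_pow \<phi> (Suc n)) x = conv (reflect (conv_pow \<phi> n)) (reflect \<phi>) x"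
    using assms Suc.prems by (simp add: reflect_conv cont_conv_pow)
  also have "\<dots> = conv (conv_pow \<phi> n) (conv_pow \<phi> 0) x"
    using Suc assms by (intro conv_cong) auto
  also have "\<dots> = conv_pow \<phi> (Suc n) x"
    using conv_pow_add[OF assms(1) Suc.prems, of n 0] by simp
  finally show ?case .
qed (use assms in auto)

lemma ip_conv_pow:
  assumes "cont \<phi>" "\<And>x. x \<in> carrier G \<Longrightarrow> reflect \<phi> x = \<phi> x"
  shows "ip (conv_pow \<phi> m) (conv_pow \<phi> n) = conv_pow \<phi> (Suc (m + n)) \<one>"
proof -
  have "ip (conv_pow \<phi> m) (conv_pow \<phi> n) = conv (conv_pow \<phi> m) (reflect (conv_pow \<phi> n)) \<one>"
    by (simp add: conv_reflect_one)
  also have "\<dots> = conv (conv_pow \<phi> m) (conv_pow \<phi> n) \<one>"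
    using assms by (intro conv_cong reflect_conv_pow) auto
  finally show ?thesis using conv_pow_add[OF assms(1), of \<one> m n] by simp
qed

lemma ip_cmult_left: "cont f \<Longrightarrow> cont g \<Longrightarrow> ip (\<lambda>x. c * f x) g = c * ip f g"
  using ip_cmult_right[of g f c] by (simp add: ip_commute)

lemma ip_diff_self:
  assumes "cont f" "cont g"
  shows "ip (\<lambda>x. f x - g x) (\<lambda>x. f x - g x) = ip f f - 2 * ip f g + ip g g"
proof -
  have d: "cont (\<lambda>x. f x - g x)" using assms by (rule cont_diff)
  have "ip (\<lambda>x. f x - g x) (\<lambda>x. f x - g x) = ip f (\<lambda>x. f x - g x) - ip g (\<lambda>x. f x - g x)"
    using ip_diff_right[OF d assms] ip_commute[of "\<lambda>x. f x - g x" f]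
      ip_commute[of "\<lambda>x. f x - g x" g] by linarith
  then show ?thesis
    using ip_diff_right[OF assms(1) assms] ip_diff_right[OF assms(2) assms] ip_commute[of g f] by linarith
qed

lemma conv_cmult_right:
  assumes "cont f" "cont g" "x \<in> carrier G"
  shows "conv f (\<lambda>y. c * g y) x = c * conv f g x"
  using mean_cmult[of "\<lambda>y. f y * g (inv y \<otimes> x)" c] assms
  by (simp add: conv_def mult_ac cont_mult cont_inv_mult)

lemma conv_cmult_left:
  assumes "cont f" "cont g" "x \<in> carrier G"
  shows "conv (\<lambda>y. c * f y) g x = c * conv f g x"
  using mean_cmult[of "\<lambda>y. f y * g (inv y \<otimes> x)" c] assms
  by (simp add: conv_def mult_ac cont_mult cont_inv_mult)

lemma conv_diff_right:
  assumes "cont f" "cont g" "cont h" "x \<in> carrier G"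
  shows "conv f (\<lambda>y. g y - h y) x = conv f g x - conv f h x"
  using mean_diff[of "\<lambda>y. f y * g (inv y \<otimes> x)" "\<lambda>y. f y * h (inv y \<otimes> x)"] assms
  by (simp add: conv_def right_diff_distrib cont_mult cont_inv_mult)

declare conv_pow.simps(2) [simp del]

lemma conv_pow_one: "conv_pow \<phi> (Suc 0) = conv \<phi> \<phi>"
  by (simp add: conv_pow.simps)

text \<open>With \<open>u n\<close> the normalized even powers, \<open>ip (u m) (u n)\<close>
  depends only on \<open>m + n\<close> and converges, so the squared distances
  \<open>b (Suc (m + m)) - 2 * b (Suc (m + n)) + b (Suc (n + n))\<close> tend to 0. The limit
  \<open>p\<close> is idempotent because \<open>u m\<close> convolved with \<open>u n\<close> is
  \<open>u (Suc (m + n))\<close>, and it is nonzero because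
  \<open>u n \<one> = b n \<ge> 1\<close>.\<close>

lemma spectral_projection:
  assumes phi: "cont \<phi>" and sym: "\<And>x. x \<in> carrier G \<Longrightarrow> reflect \<phi> x = \<phi> x"
    and x0: "x0 \<in> carrier G" "\<phi> x0 \<noteq> 0"
  obtains p \<mu> where "cont p" "p \<one> \<ge> 1" "\<mu> > 0"
    "\<And>x. x \<in> carrier G \<Longrightarrow> conv p p x = p x"
    "\<And>x. x \<in> carrier G \<Longrightarrow> reflect p x = p x"
    "\<And>x. x \<in> carrier G \<Longrightarrow> conv p (conv \<phi> \<phi>) x = \<mu> * p x"
proof -
  define A where "A = (\<lambda>n. ip (conv_pow \<phi> n) (conv_pow \<phi> n))"
  note cp = cont_conv_pow[OF phi] and ipp = ip_conv_pow[OF phi sym]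
  have A_eq: "A n = conv_pow \<phi> (Suc (n + n)) \<one>" for n unfolding A_def by (rule ipp)
  have logconv: "(A (Suc n))\<^sup>2 \<le> A n * A (Suc (Suc n))" for n
  proof -
    have "A (Suc n) = ip (conv_pow \<phi> n) (conv_pow \<phi> (Suc (Suc n)))"
      using A_eq[of "Suc n"] ipp[of n "Suc (Suc n)"] by simp
    then show ?thesis using ip_Cauchy_Schwarz[OF cp[of n] cp[of "Suc (Suc n)"]]
      by (simp add: A_def)
  qed
  \<comment> \<open>Two consecutive terms are carried along, since log-convexity yields positivity
    of a term only from the two before it. The start uses that the convolution square of \<phi> has
    value \<open>A 0\<close> at \<open>\<one>\<close>.\<close>
  have A_pos: "A n > 0 \<and> A (Suc n) > 0" for n
  proof (induction n)
    case 0
    have 1: "A 0 > 0" unfolding A_def using ip_self_pos[OF phi x0] by simp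
    have "conv_pow \<phi> 1 \<one> = A 0" unfolding A_eq by simp
    with 1 have "A 1 > 0" unfolding A_def by (intro ip_self_pos[OF cp, of \<one>]) auto
    with 1 show ?case by simp
  next
    case (Suc n)
    then have "0 < (A (Suc n))\<^sup>2" by simp
    then have "0 < A n * A (Suc (Suc n))" using logconv[of n] by linarith
    with Suc show ?case by (simp add: zero_less_mult_iff)
  qed
  have submult: "A (Suc (m + n)) \<le> A m * A n" for m n
  proof -
    have b: "conv_pow \<phi> (Suc (m + n)) x * conv_pow \<phi> (Suc (m + n)) x \<le> A m * A n" if x: "x \<in> carrier G" for x
      using conv_bound[OF cp[of m] cp[of n] x] conv_pow_add[OF phi x, of m n] by (simp add: A_def power2_eq_square)
    have "A (Suc (m + n)) = mean (\<lambda>x. conv_pow \<phi> (Suc (m + n)) x * conv_pow \<phi> (Suc (m + n)) x)"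
      by (simp add: A_def ip_def)
    also have "\<dots> \<le> A m * A n" using b by (intro mean_le_const cont_mult cp)
    finally show ?thesis .
  qed
  obtain \<mu> where mu: "\<mu> > 0" "\<And>n. A (Suc n) \<le> \<mu> * A n" "\<And>n. \<mu> ^ Suc n \<le> A n"
    using log_convex_submultiplicative[of A] A_pos logconv submult by blast
  define b where "b = (\<lambda>n. A n / \<mu> ^ Suc n)"
  have b_ge: "b n \<ge> 1" for n using mu(3)[of n] mu(1) by (simp add: b_def)
  have b_dec: "decseq b"
  proof (rule decseq_SucI)
    fix n show "b (Suc n) \<le> b n"
      using mu(2)[of n] mu(1) unfolding b_def by (simp add: field_simps)
  qed
  obtain L where L: "b \<longlonglongrightarrow> L" using decseq_convergent[OF b_dec, of 1] b_ge by metis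
  \<comment> \<open>Index \<open>2 * n + 1\<close> is the even exponent \<open>2 * (n + 1)\<close>;
    as \<mu> is the growth rate of squared norms, it is the square of the leading eigenvalue in
    modulus and goes with two factors \<phi>.\<close>
  define u where "u = (\<lambda>n x. inverse (\<mu> ^ Suc n) * conv_pow \<phi> (2 * n + 1) x)"
  have u_cont: "cont (u n)" for n unfolding u_def by (intro cont_cmult cp)
  have idx: "Suc (2 * m + 1 + (2 * n + 1)) = Suc (Suc (m + n) + Suc (m + n))"
    "Suc (2 * m + 1 + (2 * n + 1)) = 2 * Suc (m + n) + 1"
    "Suc (2 * m + 1 + Suc 0) = 2 * Suc m + 1" for m n :: nat
    by simp_all
  have ip_u: "ip (u m) (u n) = b (Suc (m + n))" for m n
  proof -
    have "ip (u m) (u n) = inverse (\<mu> ^ Suc m) * (inverse (\<mu> ^ Suc n) * ip (conv_pow \<phi> (2 * m + 1)) (conv_pow \<phi> (2 * n + 1)))"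
      unfolding u_def ip_cmult_left[OF cp cont_cmult[OF cp]] ip_cmult_right[OF cp cp] ..
    also have "ip (conv_pow \<phi> (2 * m + 1)) (conv_pow \<phi> (2 * n + 1)) = A (Suc (m + n))"
      using ipp[of "2 * m + 1" "2 * n + 1"] unfolding A_eq idx(1) by simp
    finally show ?thesis by (simp add: b_def power_add field_simps)
  qed
  have u_one: "u n \<one> = b n" for n
    unfolding u_def b_def A_eq mult_2 by (simp add: divide_inverse mult.commute)
  have u_conv: "conv (u m) (u n) x = u (Suc (m + n)) x" if x: "x \<in> carrier G" for m n x
  proof -
    have "conv (u m) (u n) x = inverse (\<mu> ^ Suc m) * (inverse (\<mu> ^ Suc n) * conv (conv_pow \<phi> (2 * m + 1)) (conv_pow \<phi> (2 * n + 1)) x)"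
      unfolding u_def conv_cmult_left[OF cp cont_cmult[OF cp] x] conv_cmult_right[OF cp cp x] ..
    also have "conv (conv_pow \<phi> (2 * m + 1)) (conv_pow \<phi> (2 * n + 1)) x = conv_pow \<phi> (2 * Suc (m + n) + 1) x"
      unfolding conv_pow_add[OF phi x] idx(2) ..
    finally show ?thesis by (simp add: u_def power_add field_simps)
  qed
  have u_phi: "conv (u n) (conv \<phi> \<phi>) x = \<mu> * u (Suc n) x" if x: "x \<in> carrier G" for n x
  proof -
    have "conv (u n) (conv \<phi> \<phi>) x = inverse (\<mu> ^ Suc n) * conv (conv_pow \<phi> (2 * n + 1)) (conv_pow \<phi> (Suc 0)) x"
      unfolding u_def conv_pow_one[symmetric] conv_cmult_left[OF cp cp x] ..
    also have "conv (conv_pow \<phi> (2 * n + 1)) (conv_pow \<phi> (Suc 0)) x = conv_pow \<phi> (2 * Suc n + 1) x"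
      unfolding conv_pow_add[OF phi x] idx(3) ..
    finally show ?thesis using mu(1) by (simp add: u_def field_simps)
  qed
  \<comment> \<open>Writing \<open>u (Suc m)\<close> as the convolution of \<open>u 0\<close> and
    \<open>u m\<close> spends one convolution on passing from mean square to uniform distance;
    \<open>b 1\<close> is the squared norm of \<open>u 0\<close>.\<close>
  have u_bound: "(u (Suc m) x - u (Suc n) x)\<^sup>2 \<le> b 1 * (b (Suc (m + m)) - 2 * b (Suc (m + n)) + b (Suc (n + n)))"
    if x: "x \<in> carrier G" for m n x
  proof -
    have d: "cont (\<lambda>x. u m x - u n x)" using u_cont u_cont by (rule cont_diff)
    have "conv (u 0) (\<lambda>x. u m x - u n x) x = u (Suc m) x - u (Suc n) x"
      using conv_diff_right[OF u_cont u_cont u_cont x, of 0 m n] u_conv[OF x, of 0] by simp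
    then show ?thesis
      using conv_bound[OF u_cont[of 0] d x] ip_diff_self[OF u_cont u_cont, of m n]
      by (simp add: ip_u)
  qed
  have "uniformly_Cauchy_on (carrier G) (\<lambda>n. u (Suc n))"
    unfolding uniformly_Cauchy_on_def
  proof (intro allI impI)
    fix e :: real assume e: "e > 0"
    define \<delta> where "\<delta> = e\<^sup>2 / (b 1 * 8)"
    have delta: "\<delta> > 0" using e b_ge[of 1] by (simp add: \<delta>_def)
    obtain M where M: "\<And>n. n \<ge> M \<Longrightarrow> \<bar>b n - L\<bar> < \<delta>"
      using LIMSEQ_D[OF L delta] by auto
    show "\<exists>M. \<forall>x\<in>carrier G. \<forall>m\<ge>M. \<forall>n\<ge>M. dist (u (Suc m) x) (u (Suc n) x) < e"
    proof (intro exI ballI allI impI)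
      fix x m n assume x: "x \<in> carrier G" and mn: "M \<le> m" "M \<le> n"
      have "\<bar>b (Suc (m + m)) - L\<bar> < \<delta>" "\<bar>b (Suc (m + n)) - L\<bar> < \<delta>" "\<bar>b (Suc (n + n)) - L\<bar> < \<delta>"
        using mn by (auto intro!: M)
      then have "b (Suc (m + m)) - 2 * b (Suc (m + n)) + b (Suc (n + n)) < 4 * \<delta>" by linarith
      then have "b 1 * (b (Suc (m + m)) - 2 * b (Suc (m + n)) + b (Suc (n + n))) < b 1 * (4 * \<delta>)"
        using b_ge[of 1] by (intro mult_strict_left_mono) auto
      also have "\<dots> < e\<^sup>2" using e b_ge[of 1] by (simp add: \<delta>_def)
      finally have "(u (Suc m) x - u (Suc n) x)\<^sup>2 < e\<^sup>2" using u_bound[OF x, of m n] by linarith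
      then have "\<bar>u (Suc m) x - u (Suc n) x\<bar> < e" using e by (metis abs_of_pos power2_abs power2_less_imp_less less_imp_le)
      then show "dist (u (Suc m) x) (u (Suc n) x) < e" by (simp add: dist_real_def)
    qed
  qed
  then have "uniformly_convergent_on (carrier G) (\<lambda>n. u (Suc n))" by (rule Cauchy_uniformly_convergent)
  then obtain p where p1: "uniform_limit (carrier G) (\<lambda>n. u (Suc n)) p sequentially"
    unfolding uniformly_convergent_on_def by blast
  have p2: "(\<lambda>n. u n x) \<longlonglongrightarrow> p x" if "x \<in> carrier G" for x
    using tendsto_uniform_limitI[OF p1 that] by (rule LIMSEQ_imp_Suc)
  have p_cont: "cont p"
    unfolding mtopology_is_euclidean[symmetric]
  proof (rule Met_TC.continuous_map_uniform_limit)
    show "\<forall>\<^sub>F n in sequentially. continuous_map T Met_TC.mtopology (u (Suc n))"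
      using u_cont by simp
    show "\<forall>\<^sub>F n in sequentially. \<forall>x\<in>topspace T. p x \<in> UNIV \<and> dist (u (Suc n) x) (p x) < e" if "e > 0" for e
      using p1 that unfolding uniform_limit_iff topspace_eq by simp
  qed simp
  note lim = conv_uniform_limit[OF u_cont p_cont p1]
  show thesis
  proof (rule that[OF p_cont _ mu(1)])
    show "p \<one> \<ge> 1"
      using LIMSEQ_le_const[OF p2[of \<one>], of 1] b_ge by (simp add: u_one)
    show "conv p p x = p x" if x: "x \<in> carrier G" for x
    proof -
      have "(\<lambda>n. conv (u (Suc n)) (u (Suc n)) x) \<longlonglongrightarrow> conv p p x"
        by (rule lim[OF u_cont p_cont p1 x])
      moreover have "(\<lambda>n. u (2 * n + 3) x) \<longlonglongrightarrow> p x"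
        using LIMSEQ_subseq_LIMSEQ[OF p2[OF x], of "\<lambda>n. 2 * n + 3"] by (simp add: strict_mono_def o_def)
      moreover have "conv (u (Suc n)) (u (Suc n)) x = u (2 * n + 3) x" for n
        using u_conv[OF x, of "Suc n" "Suc n"] by (simp add: eval_nat_numeral)
      ultimately show ?thesis using LIMSEQ_unique by simp
    qed
    show "reflect p x = p x" if x: "x \<in> carrier G" for x
    proof -
      have "u n (inv x) = u n x" for n
        using reflect_conv_pow[OF phi sym x, of "2*n+1"] by (simp add: u_def reflect_def)
      then show ?thesis using p2[OF x] p2[of "inv x"] x LIMSEQ_unique by (simp add: reflect_def)
    qed
    show "conv p (conv \<phi> \<phi>) x = \<mu> * p x" if x: "x \<in> carrier G" for x
    proof -
      have pp: "cont (conv \<phi> \<phi>)" using phi phi by (rule cont_conv)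
      have "(\<lambda>n. conv (u (Suc n)) (conv \<phi> \<phi>) x) \<longlonglongrightarrow> conv p (conv \<phi> \<phi>) x"
        by (rule lim[OF pp pp _ x]) (rule uniform_limit_const)
      moreover have "(\<lambda>n. \<mu> * u (Suc (Suc n)) x) \<longlonglongrightarrow> \<mu> * p x"
        by (intro tendsto_mult_left LIMSEQ_Suc p2[OF x])
      moreover have "conv (u (Suc n)) (conv \<phi> \<phi>) x = \<mu> * u (Suc (Suc n)) x" for n by (rule u_phi[OF x])
      ultimately show ?thesis using LIMSEQ_unique by simp
    qed
  qed
qed

end

section \<open>Isometries and adjoints of complex matrices\<close>

abbreviation adj :: "complex mat \<Rightarrow> complex mat" where
  "adj \<equiv> mat_adjoint"

lemma adj_eq: "adj A = mat (dim_col A) (dim_row A) (\<lambda>(i, j). cnj (A $$ (j, i)))"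
  by (rule eq_matI) (auto simp: mat_adjoint_def mat_of_rows_index)

lemma adj_dim [simp]: "dim_row (adj A) = dim_col A" "dim_col (adj A) = dim_row A"
  by (auto simp: adj_eq)

lemma adj_carrier [simp]: "A \<in> carrier_mat n m \<Longrightarrow> adj A \<in> carrier_mat m n"
  by (rule carrier_matI) simp_all

lemma adj_index [simp]: "i < dim_col A \<Longrightarrow> j < dim_row A \<Longrightarrow> adj A $$ (i, j) = cnj (A $$ (j, i))"
  by (simp add: adj_eq)

lemma adj_adj [simp]: "adj (adj A) = A"
  by (rule eq_matI) auto

lemma adj_one [simp]: "adj (1\<^sub>m n) = 1\<^sub>m n"
  by (rule eq_matI) auto

lemma adj_zero [simp]: "adj (0\<^sub>m n m) = 0\<^sub>m m n"
  by (rule eq_matI) auto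

lemma index_mult_mat_sum:
  assumes "i < dim_row A" "j < dim_col B" "dim_col A = dim_row B"
  shows "(A * B) $$ (i, j) = (\<Sum>k<dim_row B. A $$ (i, k) * B $$ (k, j))"
  using assms by (simp add: scalar_prod_def atLeast0LessThan)

lemma adj_mult: "dim_col A = dim_row B \<Longrightarrow> adj (A * B) = adj B * adj A"
  by (rule eq_matI) (auto simp: index_mult_mat_sum mult.commute simp del: index_mult_mat(1))

lemma mult_mat_assoc_dim:
  "dim_col A = dim_row B \<Longrightarrow> dim_col B = dim_row C \<Longrightarrow> A * B * C = A * (B * (C :: 'a :: semiring_0 mat))"
  by (rule assoc_mult_mat) (rule carrier_matI; simp)+

lemma one_mult_mat_dim: "dim_row A = n \<Longrightarrow> 1\<^sub>m n * A = (A :: 'a :: semiring_1 mat)"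
  by (rule left_mult_one_mat) (rule carrier_matI; simp)+

lemma mult_one_mat_dim: "dim_col A = n \<Longrightarrow> A * 1\<^sub>m n = (A :: 'a :: semiring_1 mat)"
  by (rule right_mult_one_mat) (rule carrier_matI; simp)+

lemma zero_mult_mat_dim: "dim_row A = n \<Longrightarrow> 0\<^sub>m m n * A = 0\<^sub>m m (dim_col (A :: 'a :: semiring_1 mat))"
  by (rule left_mult_zero_mat) (rule carrier_matI; simp)+

lemma mult_zero_mat_dim: "dim_col A = n \<Longrightarrow> A * 0\<^sub>m n m = 0\<^sub>m (dim_row (A :: 'a :: semiring_1 mat)) m"
  by (rule right_mult_zero_mat) (rule carrier_matI; simp)+

lemma mult_mat_vec_assoc_dim:
  "dim_col A = dim_row B \<Longrightarrow> dim_col B = dim_vec v \<Longrightarrow> A * B *\<^sub>v v = A *\<^sub>v (B *\<^sub>v (v :: 'a :: comm_ring_1 vec))"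
  by (rule assoc_mult_mat_vec) (rule carrier_matI carrier_vecI; simp)+

lemma mult_mat_vec_in_carrier [simp]: "A *\<^sub>v v \<in> carrier_vec n \<longleftrightarrow> dim_row A = n"
  by (metis carrier_vecD carrier_vecI dim_mult_mat_vec)

lemmas mat_dim_simps = mult_mat_assoc_dim one_mult_mat_dim mult_one_mat_dim zero_mult_mat_dim
  mult_zero_mat_dim adj_mult

lemma mult_mat_unit_vec:
  assumes "i < dim_row (A :: 'a :: comm_ring_1 mat)" "j < dim_col A"
  shows "(A *\<^sub>v unit_vec (dim_col A) j) $ i = A $$ (i, j)"
  using assms by (simp add: scalar_prod_right_unit)

lemma eq_mat_vecI:
  fixes A B :: "'a :: comm_ring_1 mat"
  assumes A: "A \<in> carrier_mat n m" and B: "B \<in> carrier_mat n m"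
    and eq: "\<And>v. v \<in> carrier_vec m \<Longrightarrow> A *\<^sub>v v = B *\<^sub>v v"
  shows "A = B"
proof (rule eq_matI)
  fix i j assume "i < dim_row B" "j < dim_col B"
  then show "A $$ (i, j) = B $$ (i, j)"
    using eq[of "unit_vec m j"] mult_mat_unit_vec[of i A j] mult_mat_unit_vec[of i B j] A B by simp
qed (use A B in auto)

lemma zero_mat_vecI:
  fixes A :: "'a :: comm_ring_1 mat"
  assumes "A \<in> carrier_mat n m" and "\<And>v. v \<in> carrier_vec m \<Longrightarrow> A *\<^sub>v v = 0\<^sub>v n"
  shows "A = 0\<^sub>m n m"
proof (rule eq_mat_vecI[OF assms(1)])
  fix v :: "'a vec" assume v: "v \<in> carrier_vec m"
  have "0\<^sub>m n m *\<^sub>v v = 0\<^sub>v n" using v by (auto intro!: eq_vecI)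
  then show "A *\<^sub>v v = 0\<^sub>m n m *\<^sub>v v" using assms(2)[OF v] by simp
qed simp

definition mat_trace :: "complex mat \<Rightarrow> complex" where
  "mat_trace A = (\<Sum>i<dim_row A. A $$ (i, i))"

lemma mat_trace_mult_commute:
  assumes "A \<in> carrier_mat n m" "B \<in> carrier_mat m n"
  shows "mat_trace (A * B) = mat_trace (B * A)"
proof -
  have "mat_trace (A * B) = (\<Sum>i<n. \<Sum>k<m. A $$ (i, k) * B $$ (k, i))"
    unfolding mat_trace_def using assms by (simp add: index_mult_mat_sum del: index_mult_mat(1))
  also have "\<dots> = (\<Sum>k<m. \<Sum>i<n. B $$ (k, i) * A $$ (i, k))"
    by (subst sum.swap) (simp add: mult.commute)
  also have "\<dots> = mat_trace (B * A)"
    unfolding mat_trace_def using assms by (simp add: index_mult_mat_sum del: index_mult_mat(1))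
  finally show ?thesis .
qed

lemma mat_trace_add: "A \<in> carrier_mat n n \<Longrightarrow> B \<in> carrier_mat n n \<Longrightarrow> mat_trace (A + B) = mat_trace A + mat_trace B"
  by (simp add: mat_trace_def sum.distrib)

lemma mat_trace_one: "mat_trace (1\<^sub>m n) = of_nat n"
  by (simp add: mat_trace_def)

lemma mat_trace_adj_mult:
  assumes "A \<in> carrier_mat n m"
  shows "mat_trace (adj A * A) = (\<Sum>j<m. \<Sum>i<n. complex_of_real ((cmod (A $$ (i, j)))\<^sup>2))"
  unfolding mat_trace_def using assms
  by (simp add: index_mult_mat_sum complex_norm_square mult.commute del: index_mult_mat(1) of_real_power)

text \<open>The columns are \<open>m\<close> orthonormal vectors of length \<open>n\<close>. Such
  matrices carry a subspace together with an orthonormal basis, and \<open>A * adj A\<close> is the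
  projection onto it.\<close>

definition isometry :: "nat \<Rightarrow> nat \<Rightarrow> complex mat \<Rightarrow> bool" where
  "isometry n m A \<longleftrightarrow> A \<in> carrier_mat n m \<and> adj A * A = 1\<^sub>m m"

lemma isometry_cancel:
  "isometry n m A \<Longrightarrow> dim_row X = m \<Longrightarrow> adj A * (A * X) = X"
  by (auto simp: isometry_def one_mult_mat_dim simp flip: mult_mat_assoc_dim)

lemma isometry_nonzero:
  assumes "isometry n m C" "m \<noteq> 0"
  shows "C \<noteq> 0\<^sub>m n m"
proof
  assume "C = 0\<^sub>m n m"
  then have "(1\<^sub>m m :: complex mat) = 0\<^sub>m m m" using assms(1) by (simp add: isometry_def)
  then have "(1\<^sub>m m :: complex mat) $$ (0, 0) = 0\<^sub>m m m $$ (0, 0)" by simp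
  then show False using assms(2) by simp
qed

text \<open>The complementary projection \<open>Q\<close> satisfies \<open>adj Q * Q = Q\<close>, so
  its trace is a sum of squares; on the other hand that trace is \<open>n - m\<close>.\<close>

lemma isometry_dim_le:
  assumes "isometry n m A"
  shows "m \<le> n"
proof -
  have A: "A \<in> carrier_mat n m" and AA: "adj A * A = 1\<^sub>m m" using assms by (auto simp: isometry_def)
  define Q where "Q = 1\<^sub>m n - A * adj A"
  have Q: "Q \<in> carrier_mat n n" using A by (auto simp: Q_def)
  have AQ: "adj A * Q = 0\<^sub>m m n"
  proof -
    have "adj A * Q = adj A * 1\<^sub>m n - adj A * (A * adj A)"
      unfolding Q_def using A by (intro mult_minus_distrib_mat) auto
    also have "adj A * (A * adj A) = adj A" using isometry_cancel[OF assms] A by simp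
    finally show ?thesis using A by (simp add: mult_one_mat_dim minus_r_inv_mat[of "adj A" m n])
  qed
  have adjQ: "adj Q = Q"
  proof (rule eq_matI)
    fix i j assume "i < dim_row Q" "j < dim_col Q"
    then have ij: "i < n" "j < n" using Q by auto
    have "adj (A * adj A) = A * adj A" using A by (simp add: adj_mult)
    moreover have "adj (A * adj A) $$ (i, j) = cnj ((A * adj A) $$ (j, i))"
      using A ij by (intro adj_index) auto
    ultimately have "cnj ((A * adj A) $$ (j, i)) = (A * adj A) $$ (i, j)" by simp
    then show "adj Q $$ (i, j) = Q $$ (i, j)" using ij A Q
      by (simp add: Q_def del: index_mult_mat(1))
  qed (use Q in auto)
  have "Q * Q = 1\<^sub>m n * Q - A * adj A * Q"
    using A Q by (subst Q_def, subst minus_mult_distrib_mat[of _ n n]) auto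
  also have "\<dots> = Q" using A Q AQ
    by (simp add: mat_dim_simps) (auto simp: Q_def)
  finally have QQ: "adj Q * Q = Q" by (simp add: adjQ)
  have "Q + A * adj A = 1\<^sub>m n" unfolding Q_def using A by (intro eq_matI) auto
  then have "mat_trace Q + mat_trace (A * adj A) = of_nat n"
    using mat_trace_add[OF Q, of "A * adj A"] A by (simp add: mat_trace_one)
  moreover have "mat_trace (A * adj A) = of_nat m"
    using mat_trace_mult_commute[OF A, of "adj A"] A AA by (simp add: mat_trace_one)
  moreover have "Re (mat_trace Q) \<ge> 0"
    using mat_trace_adj_mult[OF Q] QQ by (simp add: sum_nonneg)
  ultimately have "Re (complex_of_nat n) \<ge> Re (complex_of_nat m)"
    by (metis add.commute add_le_cancel_left add.right_neutral plus_complex.sel(1))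
  then show ?thesis by simp
qed

lemma isometry_square:
  assumes "isometry n n A"
  shows "A * adj A = 1\<^sub>m n"
  using assms mat_mult_left_right_inverse[of "adj A" n A] by (auto simp: isometry_def)

definition vec_subspace :: "nat \<Rightarrow> complex vec set \<Rightarrow> bool" where
  "vec_subspace n W \<longleftrightarrow> W \<subseteq> carrier_vec n \<and> 0\<^sub>v n \<in> W \<and>
     (\<forall>v\<in>W. \<forall>w\<in>W. v + w \<in> W) \<and> (\<forall>c. \<forall>v\<in>W. c \<cdot>\<^sub>v v \<in> W)"

lemma subspace_iff_vec_subspace:
  "VectorSpace.subspace class_ring W (module_vec TYPE(complex) n) \<longleftrightarrow> vec_subspace n W"
proof -
  interpret vec_space "TYPE(complex)" n .
  have "VectorSpace.subspace class_ring W V \<longleftrightarrow> submodule class_ring W V"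
    by (auto simp: VectorSpace.subspace_def vec_vs)
  also have "\<dots> \<longleftrightarrow> vec_subspace n W"
    unfolding submodule_def vec_subspace_def by (auto simp: module_vec_simps class_ring_simps module_axioms)
  finally show ?thesis .
qed

text \<open>The columns of \<open>A\<close> are an orthonormal family of maximal length in \<open>W\<close>.\<close>

lemma isometry_onto_subspace:
  assumes W: "vec_subspace n W"
  obtains m A where "isometry n m A" "\<And>v. v \<in> carrier_vec m \<Longrightarrow> A *\<^sub>v v \<in> W"
    "\<And>w. w \<in> W \<Longrightarrow> A *\<^sub>v (adj A *\<^sub>v w) = w"
proof -
  define P where "P = (\<lambda>m. \<exists>A. isometry n m A \<and> (\<forall>v\<in>carrier_vec m. A *\<^sub>v v \<in> W))"
  have "P 0"
  proof -
    have "isometry n 0 (0\<^sub>m n 0)" by (auto simp: isometry_def)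
    moreover have "0\<^sub>m n 0 *\<^sub>v v \<in> W" if "v \<in> carrier_vec 0" for v
    proof -
      have "0\<^sub>m n 0 *\<^sub>v v = 0\<^sub>v n" using that by (intro eq_vecI) (auto simp: scalar_prod_def)
      then show ?thesis using W by (simp add: vec_subspace_def)
    qed
    ultimately show ?thesis unfolding P_def by blast
  qed
  moreover have "\<forall>m. P m \<longrightarrow> m \<le> n" unfolding P_def using isometry_dim_le by blast
  ultimately obtain m where m: "P m" "\<And>k. P k \<Longrightarrow> k \<le> m"
    using GreatestI_nat[of P 0 n] Greatest_le_nat[of P _ n] by blast
  then obtain A where A: "isometry n m A" "\<And>v. v \<in> carrier_vec m \<Longrightarrow> A *\<^sub>v v \<in> W"
    unfolding P_def by blast
  have Ac: "A \<in> carrier_mat n m" and AA: "adj A * A = 1\<^sub>m m" using A by (auto simp: isometry_def)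
  show thesis
  proof (rule that[OF A])
    fix w assume w: "w \<in> W"
    have wc: "w \<in> carrier_vec n" using w W by (auto simp: vec_subspace_def)
    show "A *\<^sub>v (adj A *\<^sub>v w) = w"
    proof (rule ccontr)
      assume neq: "A *\<^sub>v (adj A *\<^sub>v w) \<noteq> w"
      \<comment> \<open>The residual is orthogonal to the columns of \<open>A\<close> and nonzero;
        normalized to \<open>u\<close>, it can be appended as a further column, against the
        maximality of \<open>m\<close>.\<close>
      define r where "r = w + (-1) \<cdot>\<^sub>v (A *\<^sub>v (adj A *\<^sub>v w))"
      have r: "r \<in> W" unfolding r_def using w A(2)[of "adj A *\<^sub>v w"] W Ac wc
        by (auto simp: vec_subspace_def)
      have rc: "r \<in> carrier_vec n" using r W by (auto simp: vec_subspace_def)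
      have Ar: "adj A *\<^sub>v r = 0\<^sub>v m"
      proof -
        have "adj A *\<^sub>v r = adj A *\<^sub>v w + (-1) \<cdot>\<^sub>v (adj A *\<^sub>v (A *\<^sub>v (adj A *\<^sub>v w)))"
          unfolding r_def using Ac wc by (subst mult_add_distrib_mat_vec[of _ m n]) (auto simp: mult_mat_vec)
        also have "adj A *\<^sub>v (A *\<^sub>v (adj A *\<^sub>v w)) = adj A *\<^sub>v w"
          using mult_mat_vec_assoc_dim[of "adj A" A "adj A *\<^sub>v w"] Ac wc AA by simp
        finally show ?thesis using Ac wc by (auto intro!: eq_vecI)
      qed
      have r0: "r \<noteq> 0\<^sub>v n"
      proof
        assume "r = 0\<^sub>v n"
        then have "(A *\<^sub>v (adj A *\<^sub>v w)) $ i = w $ i" if "i < n" for i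
        proof -
          have "r $ i = w $ i - (A *\<^sub>v (adj A *\<^sub>v w)) $ i"
            using that Ac wc by (simp add: r_def del: index_mult_mat_vec)
          then show ?thesis using \<open>r = 0\<^sub>v n\<close> that by simp
        qed
        then show False using neq Ac wc by (metis carrier_matD(1) carrier_vecD dim_mult_mat_vec eq_vecI)
      qed
      define s where "s = (\<Sum>i<n. (cmod (r $ i))\<^sup>2)"
      have s: "s > 0"
      proof -
        obtain i where "i < n" "r $ i \<noteq> 0" using r0 rc by (metis carrier_vecD eq_vecI index_zero_vec)
        then show ?thesis unfolding s_def by (intro sum_pos2[of _ i]) auto
      qed
      define u where "u = complex_of_real (1 / sqrt s) \<cdot>\<^sub>v r"
      have u: "u \<in> W" "u \<in> carrier_vec n" using r rc W by (auto simp: u_def vec_subspace_def)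
      have uu: "(\<Sum>i<n. cnj (u $ i) * u $ i) = 1"
      proof -
        have "(\<Sum>i<n. cnj (u $ i) * u $ i) = (\<Sum>i<n. complex_of_real ((cmod (r $ i))\<^sup>2 / s))"
        proof (rule sum.cong)
          fix i assume i: "i \<in> {..<n}"
          have "cnj (u $ i) * u $ i = complex_of_real ((cmod (u $ i))\<^sup>2)"
            by (simp add: complex_norm_square mult.commute del: of_real_power)
          also have "cmod (u $ i) = cmod (r $ i) / sqrt s" using i rc s by (simp add: u_def norm_divide)
          finally show "cnj (u $ i) * u $ i = complex_of_real ((cmod (r $ i))\<^sup>2 / s)"
            using s by (simp add: power_divide)
        qed simp
        also have "\<dots> = complex_of_real (s / s)"
          unfolding of_real_sum[symmetric] s_def sum_divide_distrib ..
        finally show ?thesis using s by simp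
      qed
      have Au: "(\<Sum>i<n. cnj (A $$ (i, j)) * u $ i) = 0" if j: "j < m" for j
      proof -
        have "(adj A *\<^sub>v r) $ j = (\<Sum>i<n. cnj (A $$ (i, j)) * r $ i)"
          using j Ac rc by (simp add: scalar_prod_def atLeast0LessThan)
        then have "(\<Sum>i<n. cnj (A $$ (i, j)) * r $ i) = 0" using Ar j by simp
        moreover have "(\<Sum>i<n. cnj (A $$ (i, j)) * u $ i) = complex_of_real (1 / sqrt s) * (\<Sum>i<n. cnj (A $$ (i, j)) * r $ i)"
          unfolding sum_distrib_left using rc by (intro sum.cong) (auto simp: u_def)
        ultimately show ?thesis by simp
      qed
      have uA: "(\<Sum>i<n. cnj (u $ i) * A $$ (i, j)) = 0" if j: "j < m" for j
      proof -
        have "(\<Sum>i<n. cnj (u $ i) * A $$ (i, j)) = cnj (\<Sum>i<n. cnj (A $$ (i, j)) * u $ i)"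
          by (simp add: mult.commute)
        then show ?thesis using Au[OF j] by simp
      qed
      define B where "B = mat n (Suc m) (\<lambda>(i, j). if j < m then A $$ (i, j) else u $ i)"
      have B: "B \<in> carrier_mat n (Suc m)" by (simp add: B_def)
      have AAij: "(\<Sum>k<n. cnj (A $$ (k, i)) * A $$ (k, j)) = (if i = j then 1 else 0)" if "i < m" "j < m" for i j
        using arg_cong[OF AA, of "\<lambda>M. M $$ (i, j)"] that Ac
        by (simp add: index_mult_mat_sum del: index_mult_mat(1))
      have "adj B * B = 1\<^sub>m (Suc m)"
      proof (rule eq_matI)
        fix i j assume "i < dim_row (1\<^sub>m (Suc m) :: complex mat)" "j < dim_col (1\<^sub>m (Suc m) :: complex mat)"
        then have ij: "i < Suc m" "j < Suc m" by auto
        have "(adj B * B) $$ (i, j) = (\<Sum>k<n. cnj (B $$ (k, i)) * B $$ (k, j))"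
          using ij B by (simp add: index_mult_mat_sum del: index_mult_mat(1))
        also have "\<dots> = (\<Sum>k<n. cnj (if i < m then A $$ (k, i) else u $ k) * (if j < m then A $$ (k, j) else u $ k))"
          using ij by (intro sum.cong) (auto simp: B_def)
        also have "\<dots> = (if i = j then 1 else 0)"
          using ij AAij Au uA uu by (cases "i < m"; cases "j < m") auto
        finally show "(adj B * B) $$ (i, j) = 1\<^sub>m (Suc m) $$ (i, j)" using ij by simp
      qed (use B in auto)
      then have "isometry n (Suc m) B" using B by (simp add: isometry_def)
      moreover have "B *\<^sub>v v \<in> W" if v: "v \<in> carrier_vec (Suc m)" for v
      proof -
        define v' where "v' = vec m (\<lambda>i. v $ i)"
        have "B *\<^sub>v v = A *\<^sub>v v' + v $ m \<cdot>\<^sub>v u"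
          using v Ac u
          by (intro eq_vecI) (auto simp: B_def v'_def scalar_prod_def atLeast0LessThan[symmetric] mult.commute)
        then show ?thesis using A(2)[of v'] u W by (auto simp: vec_subspace_def v'_def)
      qed
      ultimately have "P (Suc m)" unfolding P_def by blast
      then show False using m(2) by fastforce
    qed
  qed
qed

text \<open>\<open>B\<close> is an orthonormal basis of the kernel of \<open>adj A\<close>, the
  orthogonal complement of the range of \<open>A\<close>.\<close>

lemma isometry_complement:
  assumes A: "isometry n m A"
  obtains k B where "isometry n k B" "adj A * B = 0\<^sub>m m k" "adj B * A = 0\<^sub>m k m"
    "A * adj A + B * adj B = 1\<^sub>m n"
proof -
  have Ac: "A \<in> carrier_mat n m" and AA: "adj A * A = 1\<^sub>m m" using A by (auto simp: isometry_def)
  define W where "W = {v \<in> carrier_vec n. adj A *\<^sub>v v = 0\<^sub>v m}"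
  have "vec_subspace n W"
    unfolding vec_subspace_def W_def using Ac
    by (auto simp: mult_add_distrib_mat_vec[of "adj A" m n] mult_mat_vec[of "adj A" m n])
  from isometry_onto_subspace[OF this] obtain k B where B: "isometry n k B"
    "\<And>v. v \<in> carrier_vec k \<Longrightarrow> B *\<^sub>v v \<in> W" "\<And>w. w \<in> W \<Longrightarrow> B *\<^sub>v (adj B *\<^sub>v w) = w"
    by metis
  have Bc: "B \<in> carrier_mat n k" using B by (auto simp: isometry_def)
  have AB: "adj A * B = 0\<^sub>m m k"
  proof (rule zero_mat_vecI)
    fix v :: "complex vec" assume v: "v \<in> carrier_vec k"
    have "adj A * B *\<^sub>v v = adj A *\<^sub>v (B *\<^sub>v v)" using Ac Bc v by (simp add: mult_mat_vec_assoc_dim)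
    then show "adj A * B *\<^sub>v v = 0\<^sub>v m" using B(2)[OF v] by (simp add: W_def)
  qed (use Ac Bc in auto)
  have BA: "adj B * A = 0\<^sub>m k m"
    using arg_cong[OF AB, of adj] Ac Bc by (simp add: adj_mult)
  have "A * adj A + B * adj B = 1\<^sub>m n"
  proof (rule eq_mat_vecI)
    fix v :: "complex vec" assume v: "v \<in> carrier_vec n"
    define a where "a = A *\<^sub>v (adj A *\<^sub>v v)"
    have a: "a \<in> carrier_vec n" using Ac v by (auto simp: a_def)
    have "adj A *\<^sub>v a = adj A *\<^sub>v v" unfolding a_def using mult_mat_vec_assoc_dim[of "adj A" A "adj A *\<^sub>v v"] Ac v AA by simp
    then have "adj A *\<^sub>v (v - a) = 0\<^sub>v m"
      using Ac v a by (auto simp: mult_minus_distrib_mat_vec[of _ m n])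
    then have w: "v - a \<in> W" using v a by (simp add: W_def)
    have "adj B *\<^sub>v a = 0\<^sub>v k"
    proof -
      have "adj B *\<^sub>v a = adj B * A *\<^sub>v (adj A *\<^sub>v v)" using Ac Bc v by (simp add: a_def mult_mat_vec_assoc_dim)
      also have "\<dots> = 0\<^sub>v k" unfolding BA using Ac v by (auto intro!: eq_vecI)
      finally show ?thesis .
    qed
    then have "adj B *\<^sub>v (v - a) = adj B *\<^sub>v v"
      using Bc v a by (auto simp: mult_minus_distrib_mat_vec[of _ k n])
    then have "B *\<^sub>v (adj B *\<^sub>v v) = v - a" using B(3)[OF w] by simp
    moreover have "(A * adj A + B * adj B) *\<^sub>v v = a + B *\<^sub>v (adj B *\<^sub>v v)"
      using Ac Bc v by (simp add: a_def add_mult_distrib_mat_vec[of _ n n] mult_mat_vec_assoc_dim)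
    ultimately show "(A * adj A + B * adj B) *\<^sub>v v = 1\<^sub>m n *\<^sub>v v"
      using v a by (auto intro!: eq_vecI)
  qed (use Ac Bc in auto)
  with B(1) AB BA that show thesis by blast
qed

section \<open>Unitary representations\<close>

context topological_group
begin

lemma unitary_rep_carrier:
  "unitary_rep G T \<rho> \<Longrightarrow> g \<in> carrier G \<Longrightarrow> \<rho> g \<in> carrier_mat (rep_dim G \<rho>) (rep_dim G \<rho>)"
  by (simp add: unitary_rep_def Let_def)

lemma unitary_rep_dims:
  assumes "unitary_rep G T \<rho>" "g \<in> carrier G"
  shows "dim_row (\<rho> g) = rep_dim G \<rho>" "dim_col (\<rho> g) = rep_dim G \<rho>"
  using unitary_rep_carrier[OF assms] by auto

lemma unitary_rep_unitary:
  "unitary_rep G T \<rho> \<Longrightarrow> g \<in> carrier G \<Longrightarrow> adj (\<rho> g) * \<rho> g = 1\<^sub>m (rep_dim G \<rho>)"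
  by (simp add: unitary_rep_def Let_def)

lemma unitary_rep_one: "unitary_rep G T \<rho> \<Longrightarrow> \<rho> \<one> = 1\<^sub>m (rep_dim G \<rho>)"
  by (simp add: unitary_rep_def Let_def)

lemma unitary_rep_mult:
  "unitary_rep G T \<rho> \<Longrightarrow> g \<in> carrier G \<Longrightarrow> h \<in> carrier G \<Longrightarrow> \<rho> (g \<otimes> h) = \<rho> g * \<rho> h"
  by (simp add: unitary_rep_def Let_def)

lemma unitary_rep_continuous:
  "unitary_rep G T \<rho> \<Longrightarrow> i < rep_dim G \<rho> \<Longrightarrow> j < rep_dim G \<rho> \<Longrightarrow>
    continuous_map T euclidean (\<lambda>g. \<rho> g $$ (i, j))"
  by (simp add: unitary_rep_def Let_def)

lemma unitary_repI:
  assumes "\<And>g. g \<in> carrier G \<Longrightarrow> \<rho> g \<in> carrier_mat n n"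
    and "\<And>g. g \<in> carrier G \<Longrightarrow> adj (\<rho> g) * \<rho> g = 1\<^sub>m n" "\<rho> \<one> = 1\<^sub>m n"
    and "\<And>g h. g \<in> carrier G \<Longrightarrow> h \<in> carrier G \<Longrightarrow> \<rho> (g \<otimes> h) = \<rho> g * \<rho> h"
    and "\<And>i j. i < n \<Longrightarrow> j < n \<Longrightarrow> continuous_map T euclidean (\<lambda>g. \<rho> g $$ (i, j))"
  shows "unitary_rep G T \<rho>" and "rep_dim G \<rho> = n"
  using assms by (auto simp: unitary_rep_def rep_dim_def Let_def)

lemma unitary_rep_adj:
  assumes \<rho>: "unitary_rep G T \<rho>" and g: "g \<in> carrier G"
  shows "adj (\<rho> g) = \<rho> (inv g)"
proof -
  note d = unitary_rep_dims[OF \<rho>]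
  have "\<rho> g * \<rho> (inv g) = 1\<^sub>m (rep_dim G \<rho>)"
    using unitary_rep_mult[OF \<rho> g, of "inv g"] unitary_rep_one[OF \<rho>] g by simp
  then have "adj (\<rho> g) * (\<rho> g * \<rho> (inv g)) = adj (\<rho> g)"
    using g d by (simp add: mat_dim_simps)
  moreover have "adj (\<rho> g) * (\<rho> g * \<rho> (inv g)) = \<rho> (inv g)"
    using unitary_rep_unitary[OF \<rho> g] g d by (simp add: one_mult_mat_dim flip: mult_mat_assoc_dim)
  ultimately show ?thesis by simp
qed

lemma rep_HomI:
  "A \<in> carrier_mat (rep_dim G \<sigma>) (rep_dim G \<rho>) \<Longrightarrow>
    (\<And>g. g \<in> carrier G \<Longrightarrow> A * \<rho> g = \<sigma> g * A) \<Longrightarrow> A \<in> rep_Hom G \<rho> \<sigma>"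
  by (simp add: rep_Hom_def)

lemma rep_Hom_carrier: "A \<in> rep_Hom G \<rho> \<sigma> \<Longrightarrow> A \<in> carrier_mat (rep_dim G \<sigma>) (rep_dim G \<rho>)"
  by (simp add: rep_Hom_def)

lemma rep_Hom_dims:
  "A \<in> rep_Hom G \<rho> \<sigma> \<Longrightarrow> dim_row A = rep_dim G \<sigma>"
  "A \<in> rep_Hom G \<rho> \<sigma> \<Longrightarrow> dim_col A = rep_dim G \<rho>"
  by (auto simp: rep_Hom_def)

lemma rep_Hom_commute: "A \<in> rep_Hom G \<rho> \<sigma> \<Longrightarrow> g \<in> carrier G \<Longrightarrow> A * \<rho> g = \<sigma> g * A"
  by (simp add: rep_Hom_def)

lemma rep_Hom_mult:
  assumes "unitary_rep G T \<rho>" "unitary_rep G T \<sigma>" "unitary_rep G T \<tau>"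
    and "A \<in> rep_Hom G \<sigma> \<tau>" "B \<in> rep_Hom G \<rho> \<sigma>"
  shows "A * B \<in> rep_Hom G \<rho> \<tau>"
proof (rule rep_HomI)
  fix g assume g: "g \<in> carrier G"
  note d = assms(1-3)[THEN unitary_rep_dims(1), OF g] assms(1-3)[THEN unitary_rep_dims(2), OF g]
    rep_Hom_dims[OF assms(4)] rep_Hom_dims[OF assms(5)]
  have "A * B * \<rho> g = A * (\<sigma> g * B)"
    using rep_Hom_commute[OF assms(5) g] d by (simp add: mult_mat_assoc_dim)
  also have "\<dots> = (\<tau> g * A) * B"
    using rep_Hom_commute[OF assms(4) g] d by (simp flip: mult_mat_assoc_dim)
  finally show "A * B * \<rho> g = \<tau> g * (A * B)" using d by (simp add: mult_mat_assoc_dim)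
qed (use assms(4,5) rep_Hom_dims in auto)

lemma rep_Hom_adj:
  assumes "unitary_rep G T \<rho>" "unitary_rep G T \<sigma>" "A \<in> rep_Hom G \<rho> \<sigma>"
  shows "adj A \<in> rep_Hom G \<sigma> \<rho>"
proof (rule rep_HomI)
  fix g assume g: "g \<in> carrier G"
  note d = assms(1,2)[THEN unitary_rep_dims(1), OF g] assms(1,2)[THEN unitary_rep_dims(2), OF g]
    assms(1,2)[THEN unitary_rep_dims(1), of "inv g"] assms(1,2)[THEN unitary_rep_dims(2), of "inv g"]
    rep_Hom_dims[OF assms(3)]
  have "adj (A * \<rho> (inv g)) = adj (\<sigma> (inv g) * A)" using rep_Hom_commute[OF assms(3)] g by simp
  then have "adj (\<rho> (inv g)) * adj A = adj A * adj (\<sigma> (inv g))" using d g by (simp add: adj_mult)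
  then show "adj A * \<sigma> g = \<rho> g * adj A" using assms g by (simp add: unitary_rep_adj)
qed (use rep_Hom_carrier[OF assms(3)] in auto)

text \<open>Hypothesis \<open>invA\<close> expresses that the range of \<open>A\<close> is
  invariant, since \<open>A * adj A\<close> projects onto it. The new matrices describe the
  restriction in the basis formed by the columns of \<open>A\<close>.\<close>

lemma unitary_subrep:
  assumes \<rho>: "unitary_rep G T \<rho>" and A: "isometry (rep_dim G \<rho>) m A"
    and invA: "\<And>g. g \<in> carrier G \<Longrightarrow> A * (adj A * (\<rho> g * A)) = \<rho> g * A"
  shows "unitary_rep G T (\<lambda>g. adj A * (\<rho> g * A))" (is "unitary_rep G T ?\<sigma>")
    and "rep_dim G (\<lambda>g. adj A * (\<rho> g * A)) = m"
    and "A \<in> rep_Hom G (\<lambda>g. adj A * (\<rho> g * A)) \<rho>"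
proof -
  have Ac: "A \<in> carrier_mat (rep_dim G \<rho>) m" and AA: "adj A * A = 1\<^sub>m m" using A by (auto simp: isometry_def)
  note d = unitary_rep_dims[OF \<rho>] carrier_matD[OF Ac]
  have 1: "?\<sigma> g \<in> carrier_mat m m" if "g \<in> carrier G" for g using that d by (intro carrier_matI) auto
  have 2: "adj (?\<sigma> g) * ?\<sigma> g = 1\<^sub>m m" if g: "g \<in> carrier G" for g
  proof -
    have "adj (?\<sigma> g) * ?\<sigma> g = adj A * (adj (\<rho> g) * (A * (adj A * (\<rho> g * A))))"
      using d g by (simp add: mat_dim_simps)
    also have "\<dots> = adj A * ((adj (\<rho> g) * \<rho> g) * A)" unfolding invA[OF g] using d g by (simp add: mat_dim_simps)
    also have "\<dots> = 1\<^sub>m m" unfolding unitary_rep_unitary[OF \<rho> g] using d AA by (simp add: mat_dim_simps)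
    finally show ?thesis .
  qed
  have 3: "?\<sigma> \<one> = 1\<^sub>m m" unfolding unitary_rep_one[OF \<rho>] using d AA by (simp add: mat_dim_simps)
  have 4: "?\<sigma> (g \<otimes> h) = ?\<sigma> g * ?\<sigma> h" if g: "g \<in> carrier G" "h \<in> carrier G" for g h
  proof -
    have "?\<sigma> g * ?\<sigma> h = adj A * (\<rho> g * (A * (adj A * (\<rho> h * A))))" using d g by (simp add: mat_dim_simps)
    also have "\<dots> = ?\<sigma> (g \<otimes> h)" unfolding invA[OF g(2)] unitary_rep_mult[OF \<rho> g] using d g by (simp add: mat_dim_simps)
    finally show ?thesis by simp
  qed
  have 5: "continuous_map T euclidean (\<lambda>g. ?\<sigma> g $$ (i, j))" if ij: "i < m" "j < m" for i j
  proof -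
    define f where "f = (\<lambda>g. \<Sum>k<rep_dim G \<rho>. \<Sum>l<rep_dim G \<rho>. cnj (A $$ (k, i)) * \<rho> g $$ (k, l) * A $$ (l, j))"
    have c: "continuous_map T euclidean f"
    proof -
      have "continuous_map T euclidean (\<lambda>g. cnj (A $$ (k, i)) * \<rho> g $$ (k, l) * A $$ (l, j))"
        if "k < rep_dim G \<rho>" "l < rep_dim G \<rho>" for k l
      proof -
        have "continuous_map euclidean euclidean (\<lambda>z. cnj (A $$ (k, i)) * z * A $$ (l, j))"
          by (auto intro!: continuous_intros)
        from continuous_map_compose[OF unitary_rep_continuous[OF \<rho> that] this] show ?thesis
          by (simp add: o_def)
      qed
      then show ?thesis unfolding f_def by (intro continuous_map_sum) auto
    qed
    have "f g = ?\<sigma> g $$ (i, j)" if "g \<in> topspace T" for g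
      using that ij d unfolding f_def topspace_eq
      by (simp add: index_mult_mat_sum sum_distrib_left mult.assoc del: index_mult_mat(1))
    from continuous_map_eq[OF c this] show ?thesis .
  qed
  show \<sigma>: "unitary_rep G T ?\<sigma>" and dim: "rep_dim G ?\<sigma> = m"
    by (rule unitary_repI[of ?\<sigma> m]; (rule 1 2 3 4 5; assumption)?)+
  show "A \<in> rep_Hom G ?\<sigma> \<rho>"
    by (rule rep_HomI) (use Ac dim invA in auto)
qed

lemma irreducible_rep_iff:
  "irreducible_rep G T \<rho> \<longleftrightarrow> unitary_rep G T \<rho> \<and> rep_dim G \<rho> \<noteq> 0 \<and>
     (\<forall>W. vec_subspace (rep_dim G \<rho>) W \<and> (\<forall>g\<in>carrier G. \<forall>v\<in>W. \<rho> g *\<^sub>v v \<in> W) \<longrightarrow>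
        W = {0\<^sub>v (rep_dim G \<rho>)} \<or> W = carrier_vec (rep_dim G \<rho>))"
  unfolding irreducible_rep_def subspace_iff_vec_subspace ..

lemma irreducible_rep_unitary: "irreducible_rep G T \<rho> \<Longrightarrow> unitary_rep G T \<rho>"
  by (simp add: irreducible_rep_def)

text \<open>An invariant subspace that is neither zero nor everything, and its orthogonal
  complement, both have smaller dimension; the complement is invariant because the adjoint of
  \<open>\<rho> g\<close> is \<open>\<rho> (inv g)\<close>.\<close>

lemma reducible_split:
  assumes \<rho>: "unitary_rep G T \<rho>" and n0: "rep_dim G \<rho> \<noteq> 0" and red: "\<not> irreducible_rep G T \<rho>"
  obtains m k A B where "isometry (rep_dim G \<rho>) m A" "isometry (rep_dim G \<rho>) k B"
    "m < rep_dim G \<rho>" "k < rep_dim G \<rho>" "A * adj A + B * adj B = 1\<^sub>m (rep_dim G \<rho>)"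
    "\<And>g. g \<in> carrier G \<Longrightarrow> A * (adj A * (\<rho> g * A)) = \<rho> g * A"
    "\<And>g. g \<in> carrier G \<Longrightarrow> B * (adj B * (\<rho> g * B)) = \<rho> g * B"
proof -
  let ?n = "rep_dim G \<rho>"
  obtain W where W: "vec_subspace ?n W" and Winv: "\<And>g v. g \<in> carrier G \<Longrightarrow> v \<in> W \<Longrightarrow> \<rho> g *\<^sub>v v \<in> W"
    and W0: "W \<noteq> {0\<^sub>v ?n}" and W1: "W \<noteq> carrier_vec ?n"
    using red \<rho> n0 unfolding irreducible_rep_iff by blast
  obtain m A where A: "isometry ?n m A" and AW: "\<And>v. v \<in> carrier_vec m \<Longrightarrow> A *\<^sub>v v \<in> W"
    and WA: "\<And>w. w \<in> W \<Longrightarrow> A *\<^sub>v (adj A *\<^sub>v w) = w"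
    using isometry_onto_subspace[OF W] by metis
  obtain k B where B: "isometry ?n k B" "adj A * B = 0\<^sub>m m k" "adj B * A = 0\<^sub>m k m"
    "A * adj A + B * adj B = 1\<^sub>m ?n" using isometry_complement[OF A] by metis
  have Ac: "A \<in> carrier_mat ?n m" and Bc: "B \<in> carrier_mat ?n k" using A B by (auto simp: isometry_def)
  note d = unitary_rep_dims[OF \<rho>] carrier_matD[OF Ac] carrier_matD[OF Bc]
  have WC: "W \<subseteq> carrier_vec ?n" "0\<^sub>v ?n \<in> W" using W by (auto simp: vec_subspace_def)
  have "m \<noteq> ?n"
  proof
    assume m: "m = ?n"
    have "v \<in> W" if v: "v \<in> carrier_vec ?n" for v
    proof -
      have "A *\<^sub>v (adj A *\<^sub>v v) = A * adj A *\<^sub>v v" using Ac v by (simp add: mult_mat_vec_assoc_dim)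
      also have "\<dots> = v" using isometry_square A m v by simp
      finally show ?thesis using AW[of "adj A *\<^sub>v v"] Ac by simp
    qed
    then show False using W1 WC by blast
  qed
  then have mn: "m < ?n" using isometry_dim_le[OF A] by simp
  have "k \<noteq> ?n"
  proof
    assume k: "k = ?n"
    have "w = 0\<^sub>v ?n" if w: "w \<in> W" for w
    proof -
      have wc: "w \<in> carrier_vec ?n" using w WC by blast
      have "adj B *\<^sub>v w = adj B *\<^sub>v (A *\<^sub>v (adj A *\<^sub>v w))" using WA[OF w] by simp
      also have "\<dots> = 0\<^sub>m k m *\<^sub>v (adj A *\<^sub>v w)"
        using mult_mat_vec_assoc_dim[of "adj B" A "adj A *\<^sub>v w"] B(3) Ac Bc wc by simp
      also have "\<dots> = 0\<^sub>v k" using Ac by (auto intro!: eq_vecI)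
      finally have z: "adj B *\<^sub>v w = 0\<^sub>v k" .
      have "w = B * adj B *\<^sub>v w" using isometry_square B(1) k wc by simp
      also have "\<dots> = B *\<^sub>v (adj B *\<^sub>v w)" using Bc wc by (simp add: mult_mat_vec_assoc_dim)
      also have "\<dots> = 0\<^sub>v ?n" unfolding z using Bc by (auto intro!: eq_vecI)
      finally show ?thesis .
    qed
    then show False using W0 WC by blast
  qed
  then have kn: "k < ?n" using isometry_dim_le[OF B(1)] by simp
  have invA: "A * (adj A * (\<rho> g * A)) = \<rho> g * A" if g: "g \<in> carrier G" for g
  proof (rule eq_mat_vecI)
    fix v :: "complex vec" assume v: "v \<in> carrier_vec m"
    have "A * (adj A * (\<rho> g * A)) *\<^sub>v v = A *\<^sub>v (adj A *\<^sub>v (\<rho> g *\<^sub>v (A *\<^sub>v v)))"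
      using d g v by (simp add: mult_mat_vec_assoc_dim)
    also have "\<dots> = \<rho> g *\<^sub>v (A *\<^sub>v v)" by (rule WA[OF Winv[OF g AW[OF v]]])
    finally show "A * (adj A * (\<rho> g * A)) *\<^sub>v v = \<rho> g * A *\<^sub>v v" using d g v by (simp add: mult_mat_vec_assoc_dim)
  qed (use d g in \<open>auto intro!: carrier_matI\<close>)
  \<comment> \<open>Invariance of the range of \<open>A\<close> under \<open>inv g\<close> gives
    \<open>adj B * (\<rho> (inv g) * A) = 0\<close>; its adjoint says that
    \<open>\<rho> g * B\<close> has no component in the range of \<open>A\<close>.\<close>
  have invB: "B * (adj B * (\<rho> g * B)) = \<rho> g * B" if g: "g \<in> carrier G" for g
  proof -
    have "adj B * (\<rho> (inv g) * A) = (adj B * A) * (adj A * (\<rho> (inv g) * A))"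
      using invA[of "inv g"] g d by (simp add: mat_dim_simps)
    then have z: "adj B * (\<rho> (inv g) * A) = 0\<^sub>m k m" unfolding B(3) using d g by (simp add: mat_dim_simps)
    have "adj A * (\<rho> g * B) = adj (adj B * (\<rho> (inv g) * A))"
      using d g by (simp add: mat_dim_simps unitary_rep_adj[OF \<rho>])
    then have z: "adj A * (\<rho> g * B) = 0\<^sub>m m k" unfolding z by simp
    have "\<rho> g * B = (A * adj A + B * adj B) * (\<rho> g * B)" unfolding B(4) using d g by (simp add: mat_dim_simps)
    also have "\<dots> = A * adj A * (\<rho> g * B) + B * adj B * (\<rho> g * B)"
      using d g by (intro add_mult_distrib_mat[of _ ?n ?n _ _ k]) (auto intro!: carrier_matI)
    also have "A * adj A * (\<rho> g * B) = 0\<^sub>m ?n k" using d g z by (simp add: mat_dim_simps)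
    also have "0\<^sub>m ?n k + B * adj B * (\<rho> g * B) = B * adj B * (\<rho> g * B)"
      using d g by (intro left_add_zero_mat carrier_matI) auto
    finally show ?thesis using d g by (simp add: mat_dim_simps)
  qed
  from that[OF A B(1) mn kn B(4) invA invB] show thesis by blast
qed

text \<open>The last clause says that the ranges of the \<open>C\<close> together span the space, in
  the form in which it is applied: a nonzero \<open>X\<close> has a nonzero component
  \<open>adj C * X\<close>. The trace clause is the decomposition of the character, with repetitions
  in the list counting multiplicities.\<close>

definition decomposition :: "'a rep \<Rightarrow> ('a rep \<times> complex mat) list \<Rightarrow> bool" where
  "decomposition \<rho> L \<longleftrightarrow>
    (\<forall>\<sigma> C. (\<sigma>, C) \<in> set L \<longrightarrow> irreducible_rep G T \<sigma> \<and> C \<in> rep_Hom G \<sigma> \<rho> \<and>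
       isometry (rep_dim G \<rho>) (rep_dim G \<sigma>) C) \<and>
    (\<forall>g\<in>carrier G. mat_trace (\<rho> g) = (\<Sum>(\<sigma>, C)\<leftarrow>L. mat_trace (\<sigma> g))) \<and>
    (\<forall>m X. X \<in> carrier_mat (rep_dim G \<rho>) m \<longrightarrow>
       (\<forall>\<sigma> C. (\<sigma>, C) \<in> set L \<longrightarrow> adj C * X = 0\<^sub>m (rep_dim G \<sigma>) m) \<longrightarrow> X = 0\<^sub>m (rep_dim G \<rho>) m)"

text \<open>Complete reducibility by induction on the dimension: the embeddings for the two halves
  are composed with \<open>A\<close> and \<open>B\<close>. Dimension 0 has the empty list.\<close>

lemma irreducible_decomposition:
  assumes "unitary_rep G T \<rho>"
  shows "\<exists>L. decomposition \<rho> L"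
  using assms
proof (induction "rep_dim G \<rho>" arbitrary: \<rho> rule: less_induct)
  case less
  let ?n = "rep_dim G \<rho>"
  note \<rho> = less.prems
  note d = unitary_rep_dims[OF \<rho>]
  consider "?n = 0" | "irreducible_rep G T \<rho>" | "?n \<noteq> 0" "\<not> irreducible_rep G T \<rho>" by blast
  then show ?case
  proof cases
    case 1
    have "mat_trace (\<rho> g) = 0" if "g \<in> carrier G" for g using d[OF that] 1 by (simp add: mat_trace_def)
    then show ?thesis using 1 unfolding decomposition_def by (intro exI[of _ "[]"]) (auto intro!: eq_matI)
  next
    case 2
    have "1\<^sub>m ?n \<in> rep_Hom G \<rho> \<rho>" by (rule rep_HomI) (use d in \<open>auto simp: mat_dim_simps\<close>)
    moreover have "isometry ?n ?n (1\<^sub>m ?n)" by (simp add: isometry_def)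
    ultimately show ?thesis using 2 unfolding decomposition_def
      by (intro exI[of _ "[(\<rho>, 1\<^sub>m ?n)]"]) (auto simp: mat_dim_simps)
  next
    case 3
    obtain m k A B where A: "isometry ?n m A" and B: "isometry ?n k B"
      and mk: "m < ?n" "k < ?n" and AB: "A * adj A + B * adj B = 1\<^sub>m ?n"
      and invA: "\<And>g. g \<in> carrier G \<Longrightarrow> A * (adj A * (\<rho> g * A)) = \<rho> g * A"
      and invB: "\<And>g. g \<in> carrier G \<Longrightarrow> B * (adj B * (\<rho> g * B)) = \<rho> g * B"
      using reducible_split[OF \<rho> 3] by metis
    have Ac: "A \<in> carrier_mat ?n m" and Bc: "B \<in> carrier_mat ?n k" using A B by (auto simp: isometry_def)
    note dA = carrier_matD[OF Ac] and dB = carrier_matD[OF Bc]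
    define \<sigma>1 where "\<sigma>1 = (\<lambda>g. adj A * (\<rho> g * A))"
    define \<sigma>2 where "\<sigma>2 = (\<lambda>g. adj B * (\<rho> g * B))"
    have s1: "unitary_rep G T \<sigma>1" "rep_dim G \<sigma>1 = m" "A \<in> rep_Hom G \<sigma>1 \<rho>"
      unfolding \<sigma>1_def by (rule unitary_subrep[OF \<rho> A invA]; assumption)+
    have s2: "unitary_rep G T \<sigma>2" "rep_dim G \<sigma>2 = k" "B \<in> rep_Hom G \<sigma>2 \<rho>"
      unfolding \<sigma>2_def by (rule unitary_subrep[OF \<rho> B invB]; assumption)+
    obtain L1 where dec1: "decomposition \<sigma>1 L1" using less.hyps[of \<sigma>1] s1 mk by auto
    have L1: "\<And>\<sigma> C. (\<sigma>, C) \<in> set L1 \<Longrightarrow> irreducible_rep G T \<sigma> \<and> C \<in> rep_Hom G \<sigma> \<sigma>1 \<and> isometry m (rep_dim G \<sigma>) C"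
      "\<And>g. g \<in> carrier G \<Longrightarrow> mat_trace (\<sigma>1 g) = (\<Sum>(\<sigma>, C)\<leftarrow>L1. mat_trace (\<sigma> g))"
      "\<And>l X. X \<in> carrier_mat m l \<Longrightarrow> (\<And>\<sigma> C. (\<sigma>, C) \<in> set L1 \<Longrightarrow> adj C * X = 0\<^sub>m (rep_dim G \<sigma>) l) \<Longrightarrow> X = 0\<^sub>m m l"
      using dec1 unfolding decomposition_def s1(2) by blast+
    obtain L2 where dec2: "decomposition \<sigma>2 L2" using less.hyps[of \<sigma>2] s2 mk by auto
    have L2: "\<And>\<sigma> C. (\<sigma>, C) \<in> set L2 \<Longrightarrow> irreducible_rep G T \<sigma> \<and> C \<in> rep_Hom G \<sigma> \<sigma>2 \<and> isometry k (rep_dim G \<sigma>) C"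
      "\<And>g. g \<in> carrier G \<Longrightarrow> mat_trace (\<sigma>2 g) = (\<Sum>(\<sigma>, C)\<leftarrow>L2. mat_trace (\<sigma> g))"
      "\<And>l X. X \<in> carrier_mat k l \<Longrightarrow> (\<And>\<sigma> C. (\<sigma>, C) \<in> set L2 \<Longrightarrow> adj C * X = 0\<^sub>m (rep_dim G \<sigma>) l) \<Longrightarrow> X = 0\<^sub>m k l"
      using dec2 unfolding decomposition_def s2(2) by blast+
    have comp: "isometry ?n l (D * C)" if "isometry ?n p D" "isometry p l C" for p l D C
      using that isometry_cancel[OF that(1), of C] unfolding isometry_def
      by (auto simp: mat_dim_simps intro!: carrier_matI)
    define L where "L = map (\<lambda>(\<sigma>, C). (\<sigma>, A * C)) L1 @ map (\<lambda>(\<sigma>, C). (\<sigma>, B * C)) L2"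
    have "irreducible_rep G T \<sigma> \<and> C \<in> rep_Hom G \<sigma> \<rho> \<and> isometry ?n (rep_dim G \<sigma>) C" if "(\<sigma>, C) \<in> set L" for \<sigma> C
    proof -
      from that consider D where "(\<sigma>, D) \<in> set L1" "C = A * D" | D where "(\<sigma>, D) \<in> set L2" "C = B * D"
        unfolding L_def by auto
      then show ?thesis
      proof cases
        case 1
        then show ?thesis using L1(1)[OF 1(1)] comp[OF A]
            rep_Hom_mult[OF irreducible_rep_unitary s1(1) \<rho> s1(3)] by auto
      next
        case 2
        then show ?thesis using L2(1)[OF 2(1)] comp[OF B]
            rep_Hom_mult[OF irreducible_rep_unitary s2(1) \<rho> s2(3)] by auto
      qed
    qed
    moreover have "mat_trace (\<rho> g) = (\<Sum>(\<sigma>, C)\<leftarrow>L. mat_trace (\<sigma> g))" if g: "g \<in> carrier G" for g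
    proof -
      \<comment> \<open>Cyclicity of the trace identifies the part of the trace cut out by the
        projection \<open>D * adj D\<close> with the trace of the restriction.\<close>
      have *: "mat_trace (D * (adj D * \<rho> g)) = mat_trace (adj D * (\<rho> g * D))" if "D \<in> carrier_mat ?n p" for D p
      proof -
        have "mat_trace (D * (adj D * \<rho> g)) = mat_trace (adj D * \<rho> g * D)"
          using that d[OF g] by (intro mat_trace_mult_commute[of _ ?n p]) (auto intro!: carrier_matI)
        then show ?thesis using that d[OF g] by (simp add: mat_dim_simps)
      qed
      have "\<rho> g = (A * adj A + B * adj B) * \<rho> g" unfolding AB using d[OF g] by (simp add: mat_dim_simps)
      also have "\<dots> = A * adj A * \<rho> g + B * adj B * \<rho> g"
        using d[OF g] dA dB by (intro add_mult_distrib_mat[of _ ?n ?n]) (auto intro!: carrier_matI)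
      finally have "\<rho> g = A * adj A * \<rho> g + B * adj B * \<rho> g" .
      then have "mat_trace (\<rho> g) = mat_trace (A * (adj A * \<rho> g)) + mat_trace (B * (adj B * \<rho> g))"
      proof -
        have "A * adj A * \<rho> g \<in> carrier_mat ?n ?n" "B * adj B * \<rho> g \<in> carrier_mat ?n ?n"
          using d[OF g] dA dB by (auto intro!: carrier_matI)
        from mat_trace_add[OF this] show ?thesis
          using d[OF g] dA dB \<open>\<rho> g = A * adj A * \<rho> g + B * adj B * \<rho> g\<close>
          by (simp add: mult_mat_assoc_dim)
      qed
      also have "\<dots> = mat_trace (\<sigma>1 g) + mat_trace (\<sigma>2 g)" unfolding \<sigma>1_def \<sigma>2_def using *[OF Ac] *[OF Bc] by simp
      finally show ?thesis using L1(2)[OF g] L2(2)[OF g] by (simp add: L_def o_def case_prod_beta')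
    qed
    moreover have "X = 0\<^sub>m ?n l" if X: "X \<in> carrier_mat ?n l"
      and z: "\<And>\<sigma> C. (\<sigma>, C) \<in> set L \<Longrightarrow> adj C * X = 0\<^sub>m (rep_dim G \<sigma>) l" for l X
    proof -
      have "adj A * X = 0\<^sub>m m l"
      proof (rule L1(3))
        fix \<sigma> C assume C: "(\<sigma>, C) \<in> set L1"
        then have "adj (A * C) * X = 0\<^sub>m (rep_dim G \<sigma>) l" by (intro z) (force simp: L_def)
        then show "adj C * (adj A * X) = 0\<^sub>m (rep_dim G \<sigma>) l"
          using carrier_matD[of C] L1(1)[OF C] X dA by (auto simp: mat_dim_simps isometry_def)
      qed (use X dA in \<open>auto intro!: carrier_matI\<close>)
      moreover have "adj B * X = 0\<^sub>m k l"
      proof (rule L2(3))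
        fix \<sigma> C assume C: "(\<sigma>, C) \<in> set L2"
        then have "adj (B * C) * X = 0\<^sub>m (rep_dim G \<sigma>) l" by (intro z) (force simp: L_def)
        then show "adj C * (adj B * X) = 0\<^sub>m (rep_dim G \<sigma>) l"
          using carrier_matD[of C] L2(1)[OF C] X dB by (auto simp: mat_dim_simps isometry_def)
      qed (use X dB in \<open>auto intro!: carrier_matI\<close>)
      moreover have "X = (A * adj A + B * adj B) * X" unfolding AB using X by simp
      moreover have "(A * adj A + B * adj B) * X = A * adj A * X + B * adj B * X"
        using X dA dB by (intro add_mult_distrib_mat[of _ ?n ?n]) (auto intro!: carrier_matI)
      ultimately show ?thesis using X dA dB by (simp add: mat_dim_simps)
    qed
    ultimately show ?thesis unfolding decomposition_def by blast
  qed
qed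

end

section \<open>Schur's lemma\<close>

lemma continuous_map_complex_mult:
  fixes f h :: "'c \<Rightarrow> complex"
  assumes "continuous_map X euclidean f" "continuous_map X euclidean h"
  shows "continuous_map X euclidean (\<lambda>x. f x * h x)"
proof -
  have 1: "continuous_map X (prod_topology euclidean euclidean) (\<lambda>x. (f x, h x))"
    using assms by (intro continuous_map_pairedI)
  have 2: "continuous_map (prod_topology euclidean euclidean) euclidean (\<lambda>p::complex \<times> complex. fst p * snd p)"
    unfolding euclidean_product_topology by (auto intro!: continuous_intros)
  from continuous_map_compose[OF 1 2] show ?thesis by (simp add: o_def)
qed

context topological_group
begin

lemma rep_Hom_kernel_subspace:
  assumes \<rho>: "unitary_rep G T \<rho>" and \<sigma>: "unitary_rep G T \<sigma>" and A: "A \<in> rep_Hom G \<rho> \<sigma>"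
  defines "W \<equiv> {v \<in> carrier_vec (rep_dim G \<rho>). A *\<^sub>v v = 0\<^sub>v (rep_dim G \<sigma>)}"
  shows "vec_subspace (rep_dim G \<rho>) W" "g \<in> carrier G \<Longrightarrow> v \<in> W \<Longrightarrow> \<rho> g *\<^sub>v v \<in> W"
proof -
  note Ac = rep_Hom_carrier[OF A]
  show "vec_subspace (rep_dim G \<rho>) W"
    unfolding vec_subspace_def W_def using Ac
    by (auto simp: mult_add_distrib_mat_vec[of A "rep_dim G \<sigma>" "rep_dim G \<rho>"]
        mult_mat_vec[of A "rep_dim G \<sigma>" "rep_dim G \<rho>"])
  assume g: "g \<in> carrier G" and v: "v \<in> W"
  note d = unitary_rep_dims[OF \<rho> g] unitary_rep_dims[OF \<sigma> g] rep_Hom_dims[OF A]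
  have vc: "v \<in> carrier_vec (rep_dim G \<rho>)" and v0: "A *\<^sub>v v = 0\<^sub>v (rep_dim G \<sigma>)"
    using v by (auto simp: W_def)
  have "A *\<^sub>v (\<rho> g *\<^sub>v v) = A * \<rho> g *\<^sub>v v" using vc d by (simp add: mult_mat_vec_assoc_dim)
  also have "\<dots> = \<sigma> g *\<^sub>v (A *\<^sub>v v)"
    unfolding rep_Hom_commute[OF A g] using vc d by (simp add: mult_mat_vec_assoc_dim)
  also have "\<dots> = 0\<^sub>v (rep_dim G \<sigma>)" unfolding v0
    using unitary_rep_carrier[OF \<sigma> g] by (auto intro!: eq_vecI)
  finally show "\<rho> g *\<^sub>v v \<in> W" using d by (simp add: W_def)
qed

lemma rep_Hom_image_subspace:
  assumes \<rho>: "unitary_rep G T \<rho>" and \<sigma>: "unitary_rep G T \<sigma>" and A: "A \<in> rep_Hom G \<rho> \<sigma>"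
  defines "W \<equiv> (\<lambda>v. A *\<^sub>v v) ` carrier_vec (rep_dim G \<rho>)"
  shows "vec_subspace (rep_dim G \<sigma>) W" "g \<in> carrier G \<Longrightarrow> v \<in> W \<Longrightarrow> \<sigma> g *\<^sub>v v \<in> W"
proof -
  note Ac = rep_Hom_carrier[OF A] and dA = rep_Hom_dims[OF A]
  show "vec_subspace (rep_dim G \<sigma>) W"
    unfolding vec_subspace_def
  proof (intro conjI allI ballI)
    show "W \<subseteq> carrier_vec (rep_dim G \<sigma>)" using dA by (auto simp: W_def)
    have "A *\<^sub>v 0\<^sub>v (rep_dim G \<rho>) = 0\<^sub>v (rep_dim G \<sigma>)" using Ac by (auto intro!: eq_vecI)
    then show "0\<^sub>v (rep_dim G \<sigma>) \<in> W" unfolding W_def by (metis image_eqI zero_carrier_vec)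
  next
    fix v w assume "v \<in> W" "w \<in> W"
    then obtain x y where xy: "x \<in> carrier_vec (rep_dim G \<rho>)" "y \<in> carrier_vec (rep_dim G \<rho>)"
      "v = A *\<^sub>v x" "w = A *\<^sub>v y" by (auto simp: W_def)
    then have "v + w = A *\<^sub>v (x + y)" using Ac by (simp add: mult_add_distrib_mat_vec)
    then show "v + w \<in> W" using xy by (simp add: W_def)
  next
    fix c v assume "v \<in> W"
    then obtain x where x: "x \<in> carrier_vec (rep_dim G \<rho>)" "v = A *\<^sub>v x" by (auto simp: W_def)
    then have "c \<cdot>\<^sub>v v = A *\<^sub>v (c \<cdot>\<^sub>v x)" using Ac by (simp add: mult_mat_vec)
    then show "c \<cdot>\<^sub>v v \<in> W" using x by (simp add: W_def)
  qed
  assume g: "g \<in> carrier G" and v: "v \<in> W"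
  note d = unitary_rep_dims[OF \<rho> g] unitary_rep_dims[OF \<sigma> g] dA
  obtain x where x: "x \<in> carrier_vec (rep_dim G \<rho>)" "v = A *\<^sub>v x" using v by (auto simp: W_def)
  have "\<sigma> g *\<^sub>v v = \<sigma> g * A *\<^sub>v x" using x d by (simp add: mult_mat_vec_assoc_dim)
  also have "\<dots> = A *\<^sub>v (\<rho> g *\<^sub>v x)"
    unfolding rep_Hom_commute[OF A g, symmetric] using x d by (simp add: mult_mat_vec_assoc_dim)
  finally show "\<sigma> g *\<^sub>v v \<in> W" using d by (simp add: W_def)
qed

text \<open>Kernel and image of \<open>A\<close> are invariant, so \<open>A\<close> is injective and
  surjective. The columns of \<open>B\<close> are preimages of the unit vectors.\<close>

lemma schur_inverse:
  assumes \<rho>: "irreducible_rep G T \<rho>" and \<sigma>: "irreducible_rep G T \<sigma>"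
    and A: "A \<in> rep_Hom G \<rho> \<sigma>" and A0: "A \<noteq> 0\<^sub>m (rep_dim G \<sigma>) (rep_dim G \<rho>)"
  obtains B where "rep_dim G \<sigma> = rep_dim G \<rho>" "B \<in> carrier_mat (rep_dim G \<rho>) (rep_dim G \<rho>)"
    "A * B = 1\<^sub>m (rep_dim G \<rho>)" "B * A = 1\<^sub>m (rep_dim G \<rho>)"
proof -
  let ?m = "rep_dim G \<rho>" and ?n = "rep_dim G \<sigma>"
  note u = irreducible_rep_unitary[OF \<rho>] irreducible_rep_unitary[OF \<sigma>]
  note Ac = rep_Hom_carrier[OF A] and dA = rep_Hom_dims[OF A]
  have ker: "v = 0\<^sub>v ?m" if v: "v \<in> carrier_vec ?m" "A *\<^sub>v v = 0\<^sub>v ?n" for v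
  proof -
    let ?W = "{v \<in> carrier_vec ?m. A *\<^sub>v v = 0\<^sub>v ?n}"
    have "?W = {0\<^sub>v ?m} \<or> ?W = carrier_vec ?m"
      using \<rho> rep_Hom_kernel_subspace[OF u A] unfolding irreducible_rep_iff by blast
    moreover have "?W \<noteq> carrier_vec ?m"
    proof
      assume W: "?W = carrier_vec ?m"
      have "A = 0\<^sub>m ?n ?m" by (rule zero_mat_vecI[OF Ac]) (use W in blast)
      with A0 show False by simp
    qed
    ultimately show ?thesis using v by blast
  qed
  have im: "\<exists>v\<in>carrier_vec ?m. A *\<^sub>v v = w" if w: "w \<in> carrier_vec ?n" for w
  proof -
    let ?W = "(\<lambda>v. A *\<^sub>v v) ` carrier_vec ?m"
    have "?W = {0\<^sub>v ?n} \<or> ?W = carrier_vec ?n"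
      using \<sigma> rep_Hom_image_subspace[OF u A] unfolding irreducible_rep_iff by blast
    moreover have "?W \<noteq> {0\<^sub>v ?n}"
    proof
      assume W: "?W = {0\<^sub>v ?n}"
      have "A = 0\<^sub>m ?n ?m" by (rule zero_mat_vecI[OF Ac]) (use W in blast)
      with A0 show False by simp
    qed
    ultimately have "w \<in> ?W" using w by simp
    then show ?thesis by auto
  qed
  then obtain V where V: "\<And>j. j < ?n \<Longrightarrow> V j \<in> carrier_vec ?m \<and> A *\<^sub>v V j = unit_vec ?n j"
  proof -
    have "\<forall>j. \<exists>v. v \<in> carrier_vec ?m \<and> A *\<^sub>v v = unit_vec ?n j"
      using im[OF unit_vec_carrier] by blast
    from choice[OF this] show thesis using that by blast
  qed
  define B where "B = mat ?m ?n (\<lambda>(i, j). V j $ i)"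
  have Bc: "B \<in> carrier_mat ?m ?n" by (simp add: B_def)
  have AB: "A * B = 1\<^sub>m ?n"
  proof (rule eq_matI)
    fix i j assume "i < dim_row (1\<^sub>m ?n :: complex mat)" "j < dim_col (1\<^sub>m ?n :: complex mat)"
    then have ij: "i < ?n" "j < ?n" by auto
    have "col B j = V j" using V[OF ij(2)] ij by (intro eq_vecI) (auto simp: B_def)
    then have "(A * B) $$ (i, j) = (A *\<^sub>v V j) $ i" using ij dA Bc by simp
    then show "(A * B) $$ (i, j) = 1\<^sub>m ?n $$ (i, j)" using V[OF ij(2)] ij by auto
  qed (use dA Bc in auto)
  have BA: "B * A = 1\<^sub>m ?m"
  proof (rule eq_mat_vecI[of _ ?m ?m])
    fix v :: "complex vec" assume v: "v \<in> carrier_vec ?m"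
    define w where "w = B *\<^sub>v (A *\<^sub>v v)"
    have w: "w \<in> carrier_vec ?m" using Bc by (simp add: w_def)
    have "A *\<^sub>v w = A * B *\<^sub>v (A *\<^sub>v v)" unfolding w_def using Ac Bc v by (simp add: mult_mat_vec_assoc_dim)
    also have "\<dots> = A *\<^sub>v v" unfolding AB using dA by simp
    finally have "A *\<^sub>v (w - v) = 0\<^sub>v ?n" using v w Ac by (simp add: mult_minus_distrib_mat_vec[OF Ac w v])
    then have z: "w - v = 0\<^sub>v ?m" using v w by (intro ker) auto
    have "w = v"
    proof (rule eq_vecI)
      fix i assume "i < dim_vec v"
      then show "w $ i = v $ i" using arg_cong[OF z, of "\<lambda>x. x $ i"] v w by simp
    qed (use v w in simp)
    then show "B * A *\<^sub>v v = 1\<^sub>m ?m *\<^sub>v v" using v Ac Bc by (simp add: w_def mult_mat_vec_assoc_dim)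
  qed (use Ac Bc in auto)
  \<comment> \<open>The traces of \<open>A * B\<close> and \<open>B * A\<close> coincide, and they
    are the two dimensions.\<close>
  have "complex_of_nat ?n = complex_of_nat ?m"
    using mat_trace_mult_commute[OF Ac Bc] AB BA by (simp add: mat_trace_one)
  then have "?n = ?m" by simp
  with that Bc AB BA show thesis by simp
qed

text \<open>A complex matrix of positive size has an eigenvalue \<open>c\<close>. The intertwiner
  \<open>A - c\<close> kills an eigenvector, so it is not invertible and must vanish.\<close>

lemma schur_scalar:
  assumes \<rho>: "irreducible_rep G T \<rho>" and A: "A \<in> rep_Hom G \<rho> \<rho>"
  obtains c where "A = c \<cdot>\<^sub>m 1\<^sub>m (rep_dim G \<rho>)"
proof -
  let ?n = "rep_dim G \<rho>"
  note u = irreducible_rep_unitary[OF \<rho>] and Ac = rep_Hom_carrier[OF A]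
  have "?n > 0" using \<rho> by (simp add: irreducible_rep_def)
  from spectrum_non_empty[OF Ac this] obtain c v where v: "v \<in> carrier_vec ?n" "v \<noteq> 0\<^sub>v ?n" "A *\<^sub>v v = c \<cdot>\<^sub>v v"
    using Ac by (auto simp: spectrum_def eigenvalue_def eigenvector_def)
  define D where "D = A + (- c) \<cdot>\<^sub>m 1\<^sub>m ?n"
  have Dc: "D \<in> carrier_mat ?n ?n" using Ac by (simp add: D_def)
  have D: "D \<in> rep_Hom G \<rho> \<rho>"
  proof (rule rep_HomI[OF Dc])
    fix g assume g: "g \<in> carrier G"
    note rc = unitary_rep_carrier[OF u g]
    have "D * \<rho> g = A * \<rho> g + (- c) \<cdot>\<^sub>m \<rho> g"
      unfolding D_def using Ac rc by (simp add: add_mult_distrib_mat[of _ ?n ?n _ _ ?n] mult_smult_assoc_mat[of _ ?n ?n])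
    also have "\<dots> = \<rho> g * D"
      unfolding D_def rep_Hom_commute[OF A g] using Ac rc
      by (simp add: mult_add_distrib_mat[of _ ?n ?n _ ?n]
          mult_smult_distrib[OF rc one_carrier_mat])
    finally show "D * \<rho> g = \<rho> g * D" .
  qed
  have "D = 0\<^sub>m ?n ?n"
  proof (rule ccontr)
    assume "D \<noteq> 0\<^sub>m ?n ?n"
    from schur_inverse[OF \<rho> \<rho> D this] obtain B where B: "B \<in> carrier_mat ?n ?n" "B * D = 1\<^sub>m ?n" by metis
    have "(- c) \<cdot>\<^sub>m 1\<^sub>m ?n *\<^sub>v v = (- c) \<cdot>\<^sub>v v"
      using v by (intro eq_vecI) (auto simp: smult_scalar_prod_distrib[of _ ?n] row_def[symmetric])
    then have "D *\<^sub>v v = c \<cdot>\<^sub>v v + (- c) \<cdot>\<^sub>v v"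
      unfolding D_def using v Ac by (simp add: add_mult_distrib_mat_vec[of _ ?n ?n])
    also have "\<dots> = 0\<^sub>v ?n" using v by (intro eq_vecI) auto
    finally have "B *\<^sub>v (D *\<^sub>v v) = 0\<^sub>v ?n" using B by (auto intro!: eq_vecI)
    then have "v = 0\<^sub>v ?n" using B Dc v by (simp flip: mult_mat_vec_assoc_dim)
    then show False using v by simp
  qed
  then have "A = c \<cdot>\<^sub>m 1\<^sub>m ?n"
  proof -
    have "A $$ (i, j) = (c \<cdot>\<^sub>m 1\<^sub>m ?n) $$ (i, j)" if ij: "i < ?n" "j < ?n" for i j
    proof -
      have "D $$ (i, j) = 0" using \<open>D = 0\<^sub>m ?n ?n\<close> ij by simp
      then show ?thesis using ij Ac by (auto simp: D_def split: if_splits)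
    qed
    then show ?thesis using Ac by (intro eq_matI) auto
  qed
  with that show thesis .
qed

end

section \<open>The dimension of a space of intertwiners\<close>

text \<open>Independent subsets of \<open>N\<close> are independent in \<open>V\<close>, hence of
  size at most \<open>dim\<close>; a maximal one generates \<open>N\<close>.\<close>

lemma (in vectorspace) subspace_fin_dim:
  assumes fd: "fin_dim" and N: "VectorSpace.subspace K N V"
  shows "vectorspace.fin_dim K (vs N)"
proof -
  interpret w: vectorspace K "vs N" by (rule subspace_is_vs[OF N])
  have sm: "submodule K N V" using N by (simp add: VectorSpace.subspace_def)
  have NV: "N \<subseteq> carrier V" using sm by (simp add: submodule_def)
  define P where "P = (\<lambda>A. A \<subseteq> carrier (vs N) \<and> w.lin_indpt A)"
  have bd: "finite A \<and> card A \<le> dim" if "P A" for A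
  proof -
    have A: "A \<subseteq> N" "w.lin_indpt A" using that by (auto simp: P_def)
    have "lin_indpt A" using A span_li_not_depend(2)[OF A(1) sm] by simp
    then show ?thesis using li_le_dim[OF fd, of A] A NV by auto
  qed
  have "P {}" by (simp add: P_def w.lin_dep_def)
  from maximal_exists[of P dim "{}", OF bd this]
  obtain A where A: "finite A" "maximal A P" by blast
  then have "w.gen_set A" unfolding P_def by (intro w.max_li_is_gen)
  moreover have "A \<subseteq> carrier (vs N)" using A(2) unfolding maximal_def P_def by blast
  ultimately show ?thesis using A(1) unfolding w.fin_dim_def by blast
qed

text \<open>\<open>dim\<close> is the least size of a finite generating set; finite dimension
  ensures that this minimum is attained, so that 0 means generation by the empty set.\<close>

lemma (in vectorspace) dim_eq_0_iff:
  assumes fd: "fin_dim"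
  shows "dim = 0 \<longleftrightarrow> carrier V = {\<zero>\<^bsub>V\<^esub>}"
proof
  assume "dim = 0"
  obtain A where "finite A" "A \<subseteq> carrier V" "gen_set A" using fd unfolding fin_dim_def by blast
  then have "\<exists>n A. finite A \<and> card A = n \<and> A \<subseteq> carrier V \<and> gen_set A" by blast
  from LeastI_ex[OF this] obtain A where "finite A" "card A = dim" "gen_set A" unfolding dim_def by blast
  then have "span {} = carrier V" using \<open>dim = 0\<close> by simp
  then show "carrier V = {\<zero>\<^bsub>V\<^esub>}" by (simp add: span_empty)
next
  assume "carrier V = {\<zero>\<^bsub>V\<^esub>}"
  then have "finite {} \<and> card {} = 0 \<and> {} \<subseteq> carrier V \<and> gen_set {}" by (simp add: span_empty)
  then have "dim \<le> 0" unfolding dim_def by (intro Least_le) blast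
  then show "dim = 0" by simp
qed

text \<open>\<open>F\<close> fills a matrix row by row from a vector of length
  \<open>nr * nc\<close> and is linear and surjective.\<close>

lemma module_mat_fin_dim:
  "vectorspace.fin_dim class_ring (module_mat TYPE('a :: field) nr nc)"
proof -
  interpret V: vec_space "TYPE('a)" "nr * nc" .
  interpret W: vectorspace class_ring "module_mat TYPE('a) nr nc" by (rule matrix_vs)
  define F :: "'a vec \<Rightarrow> 'a mat" where "F = (\<lambda>v. mat nr nc (\<lambda>(i, j). v $ (i * nc + j)))"
  have bound: "i * nc + j < nr * nc" if "i < nr" "j < nc" for i j
  proof -
    have "i * nc + j < Suc i * nc" using that by simp
    also have "\<dots> \<le> nr * nc" using that by (intro mult_le_mono1) simp
    finally show ?thesis .
  qed
  interpret linear_map class_ring "module_vec TYPE('a) (nr * nc)" "module_mat TYPE('a) nr nc" F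
  proof unfold_locales
    show "F \<in> module_hom class_ring (module_vec TYPE('a) (nr * nc)) (module_mat TYPE('a) nr nc)"
      unfolding module_hom_def F_def
      by (auto simp: module_vec_simps module_mat_simps bound intro!: eq_matI)
  qed
  have "F ` carrier_vec (nr * nc) = carrier_mat nr nc"
  proof (intro equalityI subsetI)
    fix M :: "'a mat" assume M: "M \<in> carrier_mat nr nc"
    define v where "v = vec (nr * nc) (\<lambda>k. M $$ (k div nc, k mod nc))"
    have "F v = M" using M bound by (intro eq_matI) (auto simp: F_def v_def)
    then show "M \<in> F ` carrier_vec (nr * nc)" by (intro image_eqI[of _ _ v]) (auto simp: v_def)
  qed (auto simp: F_def)
  then show ?thesis using surj_fin_dim[OF V.fin_dim] by (simp add: module_vec_simps module_mat_simps)
qed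

context topological_group
begin

text \<open>The relations on \<omega> see only whether a multiplicity vanishes; this trades the
  dimension for the existence of a nonzero intertwiner.\<close>

lemma dim_Hom_nonzero_iff:
  assumes \<rho>: "unitary_rep G T \<rho>" and \<sigma>: "unitary_rep G T \<sigma>"
  shows "dim_Hom G \<rho> \<sigma> \<noteq> 0 \<longleftrightarrow> (\<exists>A\<in>rep_Hom G \<rho> \<sigma>. A \<noteq> 0\<^sub>m (rep_dim G \<sigma>) (rep_dim G \<rho>))"
proof -
  let ?m = "rep_dim G \<rho>" and ?n = "rep_dim G \<sigma>"
  interpret M: vectorspace class_ring "module_mat TYPE(complex) ?n ?m" by (rule matrix_vs)
  have zero: "0\<^sub>m ?n ?m \<in> rep_Hom G \<rho> \<sigma>"
    by (rule rep_HomI) (use unitary_rep_dims[OF \<rho>] unitary_rep_dims[OF \<sigma>] in \<open>auto simp: mat_dim_simps\<close>)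
  have "submodule class_ring (rep_Hom G \<rho> \<sigma>) (module_mat TYPE(complex) ?n ?m)"
  proof (unfold submodule_def, intro conjI allI impI)
    show "Module.module class_ring (module_mat TYPE(complex) ?n ?m)" by (rule M.module_axioms)
    show "rep_Hom G \<rho> \<sigma> \<subseteq> carrier (module_mat TYPE(complex) ?n ?m)"
      using rep_Hom_carrier by (auto simp: module_mat_simps)
    show "\<zero>\<^bsub>module_mat TYPE(complex) ?n ?m\<^esub> \<in> rep_Hom G \<rho> \<sigma>" using zero by (simp add: module_mat_simps)
  next
    fix A B assume A: "A \<in> rep_Hom G \<rho> \<sigma>" and B: "B \<in> rep_Hom G \<rho> \<sigma>"
    have "A + B \<in> rep_Hom G \<rho> \<sigma>"
    proof (rule rep_HomI)
      fix g assume g: "g \<in> carrier G"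
      note c = rep_Hom_carrier[OF A] rep_Hom_carrier[OF B] unitary_rep_carrier[OF \<rho> g] unitary_rep_carrier[OF \<sigma> g]
      show "(A + B) * \<rho> g = \<sigma> g * (A + B)"
        using rep_Hom_commute[OF A g] rep_Hom_commute[OF B g]
          add_mult_distrib_mat[OF c(1,2,3)] mult_add_distrib_mat[OF c(4,1,2)] by simp
    qed (use rep_Hom_carrier A B in auto)
    then show "A \<oplus>\<^bsub>module_mat TYPE(complex) ?n ?m\<^esub> B \<in> rep_Hom G \<rho> \<sigma>" by (simp add: module_mat_simps)
  next
    fix c A assume A: "A \<in> rep_Hom G \<rho> \<sigma>"
    have "c \<cdot>\<^sub>m A \<in> rep_Hom G \<rho> \<sigma>"
    proof (rule rep_HomI)
      fix g assume g: "g \<in> carrier G"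
      note k = rep_Hom_carrier[OF A] unitary_rep_carrier[OF \<rho> g] unitary_rep_carrier[OF \<sigma> g]
      show "(c \<cdot>\<^sub>m A) * \<rho> g = \<sigma> g * (c \<cdot>\<^sub>m A)"
        using rep_Hom_commute[OF A g] mult_smult_assoc_mat[OF k(1,2)] mult_smult_distrib[OF k(3,1)] by simp
    qed (use rep_Hom_carrier[OF A] in auto)
    then show "c \<odot>\<^bsub>module_mat TYPE(complex) ?n ?m\<^esub> A \<in> rep_Hom G \<rho> \<sigma>" by (simp add: module_mat_simps)
  qed
  then have sub: "VectorSpace.subspace class_ring (rep_Hom G \<rho> \<sigma>) (module_mat TYPE(complex) ?n ?m)"
    unfolding VectorSpace.subspace_def using M.vectorspace_axioms by blast
  interpret H: vectorspace class_ring "module_mat TYPE(complex) ?n ?m\<lparr>carrier := rep_Hom G \<rho> \<sigma>\<rparr>"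
    by (rule M.subspace_is_vs[OF sub])
  have "dim_Hom G \<rho> \<sigma> = 0 \<longleftrightarrow> rep_Hom G \<rho> \<sigma> = {0\<^sub>m ?n ?m}"
    unfolding dim_Hom_def
    using H.dim_eq_0_iff[OF M.subspace_fin_dim[OF module_mat_fin_dim sub]] by (simp add: module_mat_simps)
  then show ?thesis using zero by auto
qed

end

section \<open>Kronecker products\<close>

text \<open>Division with remainder by \<open>m\<close> matches the positions of a Kronecker product
  with pairs of indices.\<close>

lemma sum_div_mod:
  fixes f :: "nat \<Rightarrow> nat \<Rightarrow> 'c :: comm_monoid_add"
  shows "(\<Sum>k<n * m. f (k div m) (k mod m)) = (\<Sum>p<n. \<Sum>q<m. f p q)"
proof -
  have b: "p * m + q < n * m" if "p < n" "q < m" for p q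
  proof -
    have "p * m + q < Suc p * m" using that by simp
    also have "\<dots> \<le> n * m" using that by (intro mult_le_mono1) simp
    finally show ?thesis .
  qed
  have "(\<Sum>k<n * m. f (k div m) (k mod m)) = (\<Sum>(p, q)\<in>{..<n} \<times> {..<m}. f p q)"
    by (rule sum.reindex_bij_witness[of _ "\<lambda>(p, q). p * m + q" "\<lambda>k. (k div m, k mod m)"])
      (auto simp: b less_mult_imp_div_less intro!: mod_less_divisor gr_zeroI)
  also have "\<dots> = (\<Sum>p<n. \<Sum>q<m. f p q)" by (simp add: sum.cartesian_product)
  finally show ?thesis .
qed

lemma kronecker_dim [simp]:
  "dim_row (kronecker A B) = dim_row A * dim_row B" "dim_col (kronecker A B) = dim_col A * dim_col B"
  by (auto simp: kronecker_def)

lemma div_mod_less: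
  assumes "i < n * (m :: nat)"
  shows "i div m < n" "i mod m < m"
  using assms by (auto simp: less_mult_imp_div_less intro!: mod_less_divisor gr_zeroI)

lemma kronecker_index:
  assumes "i < dim_row A * dim_row B" "j < dim_col A * dim_col B"
  shows "kronecker A B $$ (i, j) =
    A $$ (i div dim_row B, j div dim_col B) * B $$ (i mod dim_row B, j mod dim_col B)"
  using assms by (simp add: kronecker_def)

lemma kronecker_mult:
  assumes "dim_col A = dim_row A'" "dim_col B = dim_row B'"
  shows "kronecker (A * A') (B * B') = kronecker A B * kronecker A' B'"
proof (rule eq_matI)
  fix i j assume "i < dim_row (kronecker A B * kronecker A' B')" "j < dim_col (kronecker A B * kronecker A' B')"
  then have i: "i < dim_row A * dim_row B" and j: "j < dim_col A' * dim_col B'" by auto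
  note di = div_mod_less[OF i] and dj = div_mod_less[OF j]
  have "(kronecker A B * kronecker A' B') $$ (i, j) =
     (\<Sum>k<dim_row A' * dim_row B'. kronecker A B $$ (i, k) * kronecker A' B' $$ (k, j))"
    using i j assms by (subst index_mult_mat_sum) auto
  also have "\<dots> = (\<Sum>k<dim_row A' * dim_row B'.
     (A $$ (i div dim_row B, k div dim_row B') * B $$ (i mod dim_row B, k mod dim_row B')) *
     (A' $$ (k div dim_row B', j div dim_col B') * B' $$ (k mod dim_row B', j mod dim_col B')))"
    using i j assms by (intro sum.cong) (auto simp: kronecker_index)
  also have "\<dots> = (\<Sum>p<dim_row A'. \<Sum>q<dim_row B'.
     (A $$ (i div dim_row B, p) * B $$ (i mod dim_row B, q)) *
     (A' $$ (p, j div dim_col B') * B' $$ (q, j mod dim_col B')))"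
    by (rule sum_div_mod[of "\<lambda>p q. (A $$ (i div dim_row B, p) * B $$ (i mod dim_row B, q)) *
     (A' $$ (p, j div dim_col B') * B' $$ (q, j mod dim_col B'))"])
  also have "\<dots> = (\<Sum>p<dim_row A'. A $$ (i div dim_row B, p) * A' $$ (p, j div dim_col B')) *
     (\<Sum>q<dim_row B'. B $$ (i mod dim_row B, q) * B' $$ (q, j mod dim_col B'))"
    by (simp add: sum_product mult_ac)
  also have "\<dots> = (A * A') $$ (i div dim_row B, j div dim_col B') * (B * B') $$ (i mod dim_row B, j mod dim_col B')"
    using di dj assms by (simp add: index_mult_mat_sum del: index_mult_mat(1))
  finally show "kronecker (A * A') (B * B') $$ (i, j) = (kronecker A B * kronecker A' B') $$ (i, j)"
    using i j by (simp add: kronecker_index del: index_mult_mat(1))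
qed auto

lemma adj_kronecker: "adj (kronecker A B) = kronecker (adj A) (adj B)"
proof (rule eq_matI)
  fix i j assume "i < dim_row (kronecker (adj A) (adj B))" "j < dim_col (kronecker (adj A) (adj B))"
  then have i: "i < dim_col A * dim_col B" and j: "j < dim_row A * dim_row B" by auto
  show "adj (kronecker A B) $$ (i, j) = kronecker (adj A) (adj B) $$ (i, j)"
    using i j div_mod_less[OF i] div_mod_less[OF j] by (simp add: kronecker_index)
qed auto

lemma kronecker_one: "kronecker (1\<^sub>m n) (1\<^sub>m m) = 1\<^sub>m (n * m)"
proof (rule eq_matI)
  fix i j assume "i < dim_row (1\<^sub>m (n * m) :: complex mat)" "j < dim_col (1\<^sub>m (n * m) :: complex mat)"
  then have i: "i < n * m" and j: "j < n * m" by auto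
  have "i div m = j div m \<and> i mod m = j mod m \<longleftrightarrow> i = j" by (metis div_mult_mod_eq)
  then show "kronecker (1\<^sub>m n) (1\<^sub>m m) $$ (i, j) = 1\<^sub>m (n * m) $$ (i, j)"
    using i j div_mod_less[OF i] div_mod_less[OF j] by (auto simp: kronecker_index)
qed auto

lemma mat_trace_kronecker:
  assumes "A \<in> carrier_mat n n" "B \<in> carrier_mat m m"
  shows "mat_trace (kronecker A B) = mat_trace A * mat_trace B"
proof -
  have "mat_trace (kronecker A B) = (\<Sum>k<n * m. A $$ (k div m, k div m) * B $$ (k mod m, k mod m))"
    unfolding mat_trace_def using assms by (intro sum.cong) (auto simp: kronecker_index)
  also have "\<dots> = mat_trace A * mat_trace B"
    using assms by (subst sum_div_mod[of "\<lambda>p q. A $$ (p, p) * B $$ (q, q)"])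
      (simp add: mat_trace_def sum_product)
  finally show ?thesis .
qed

section \<open>Separation of points by representations\<close>

context compact_group
begin

definition orthonormal :: "nat \<Rightarrow> (nat \<Rightarrow> 'a \<Rightarrow> real) \<Rightarrow> bool" where
  "orthonormal k e \<longleftrightarrow> (\<forall>i<k. cont (e i)) \<and> (\<forall>i<k. \<forall>j<k. ip (e i) (e j) = (if i = j then 1 else 0))"

lemma orthonormal_residual:
  assumes f: "cont f" and e: "orthonormal k e"
  shows "ip (\<lambda>x. f x - (\<Sum>i<k. c i * e i x)) (\<lambda>x. f x - (\<Sum>i<k. c i * e i x)) =
     ip f f - 2 * (\<Sum>i<k. c i * ip f (e i)) + (\<Sum>i<k. (c i)\<^sup>2)"
proof -
  define g where "g = (\<lambda>x. \<Sum>i<k. c i * e i x)"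
  have ec: "\<And>i. i < k \<Longrightarrow> cont (e i)" using e by (simp add: orthonormal_def)
  have g: "cont g" unfolding g_def using ec by (rule cont_sum)
  have ge: "ip (e j) g = c j" if j: "j < k" for j
  proof -
    have "ip (e j) g = (\<Sum>i<k. c i * ip (e j) (e i))" unfolding g_def using ec j by (intro ip_sum_right)
    also have "\<dots> = (\<Sum>i<k. if j = i then c i else 0)"
      using e j by (intro sum.cong) (auto simp: orthonormal_def)
    finally show ?thesis using j by simp
  qed
  have "ip g (\<lambda>x. \<Sum>i<k. c i * e i x) = (\<Sum>i<k. c i * ip g (e i))"
    using g ec by (rule ip_sum_right)
  then have "ip g g = (\<Sum>i<k. c i * ip g (e i))" unfolding g_def[symmetric] .
  also have "(\<Sum>i<k. c i * ip g (e i)) = (\<Sum>i<k. (c i)\<^sup>2)"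
    using ge by (intro sum.cong) (auto simp: ip_commute[of g] power2_eq_square)
  finally have gg: "ip g g = (\<Sum>i<k. (c i)\<^sup>2)" .
  have fg: "ip f g = (\<Sum>i<k. c i * ip f (e i))" unfolding g_def using f ec by (intro ip_sum_right)
  show ?thesis using ip_diff_self[OF f g] unfolding gg fg by (simp only: g_def)
qed

text \<open>For idempotent \<open>p\<close> this is the range of the projection given by convolution
  with \<open>p\<close> from the left, which commutes with right translations.\<close>

definition conv_fixed :: "('a \<Rightarrow> real) \<Rightarrow> ('a \<Rightarrow> real) set" where
  "conv_fixed p = {f. cont f \<and> (\<forall>x\<in>carrier G. conv p f x = f x)}"

text \<open>Bessel's inequality for the function \<open>\<lambda>y. p (x \<otimes> inv y)\<close>:
  its coefficients are the values \<open>e i x\<close> and its squared norm is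
  \<open>p \<one>\<close>. The mean over \<open>x\<close> of the sum of the squares
  \<open>(e i x)\<^sup>2\<close> is \<open>k\<close>. So \<open>p \<one>\<close>, the trace of the
  projection, bounds the dimension of its range.\<close>

lemma orthonormal_bound:
  assumes p: "cont p" "\<And>x. x \<in> carrier G \<Longrightarrow> conv p p x = p x" "\<And>x. x \<in> carrier G \<Longrightarrow> reflect p x = p x"
    and e: "orthonormal k e" "\<And>i. i < k \<Longrightarrow> e i \<in> conv_fixed p"
  shows "real k \<le> p \<one>"
proof -
  have ec: "\<And>i. i < k \<Longrightarrow> cont (e i)" using e by (simp add: orthonormal_def)
  have pp: "ip p p = p \<one>"
  proof -
    have "ip p p = conv p (reflect p) \<one>" by (simp add: conv_reflect_one)
    also have "\<dots> = conv p p \<one>" using p by (intro conv_cong) auto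
    finally show ?thesis using p by simp
  qed
  have b: "(\<Sum>i<k. (e i x)\<^sup>2) \<le> p \<one>" if x: "x \<in> carrier G" for x
  proof -
    let ?px = "\<lambda>y. p (x \<otimes> inv y)"
    have pxc: "cont ?px" using p x by (intro cont_mult_inv)
    have ex: "ip ?px (e i) = e i x" if i: "i < k" for i
      using conv_alt[OF p(1) ec[OF i] x] e(2)[OF i] x by (simp add: conv_fixed_def)
    have "0 \<le> ip (\<lambda>y. ?px y - (\<Sum>i<k. e i x * e i y)) (\<lambda>y. ?px y - (\<Sum>i<k. e i x * e i y))"
      using pxc ec by (intro ip_self_nonneg cont_diff cont_sum) auto
    also have "\<dots> = ip ?px ?px - 2 * (\<Sum>i<k. e i x * ip ?px (e i)) + (\<Sum>i<k. (e i x)\<^sup>2)"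
      by (rule orthonormal_residual[OF pxc e(1)])
    also have "(\<Sum>i<k. e i x * ip ?px (e i)) = (\<Sum>i<k. (e i x)\<^sup>2)"
      using ex by (intro sum.cong) (auto simp: power2_eq_square)
    finally show ?thesis using ip_translate_inv[OF p(1) x] pp by simp
  qed
  have "real k = (\<Sum>i<k. ip (e i) (e i))" using e by (simp add: orthonormal_def)
  also have "\<dots> = mean (\<lambda>x. \<Sum>i<k. e i x * e i x)"
    unfolding ip_def using ec by (intro mean_sum[symmetric] cont_mult) auto
  also have "\<dots> \<le> p \<one>"
    using b ec by (intro mean_le_const continuous_map_sum cont_mult) (auto simp: power2_eq_square)
  finally show ?thesis .
qed

text \<open>The bound on orthonormal families gives one of maximal length. If some \<open>f\<close>
  differed from its expansion, the normalized residual would again be fixed by \<open>p\<close> and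
  would extend the family.\<close>

lemma finite_orthonormal_basis:
  assumes p: "cont p" "\<And>x. x \<in> carrier G \<Longrightarrow> conv p p x = p x" "\<And>x. x \<in> carrier G \<Longrightarrow> reflect p x = p x"
  obtains k e where "orthonormal k e" "\<And>i. i < k \<Longrightarrow> e i \<in> conv_fixed p"
    "\<And>f x. f \<in> conv_fixed p \<Longrightarrow> x \<in> carrier G \<Longrightarrow> f x = (\<Sum>i<k. ip (e i) f * e i x)"
proof -
  define P where "P = (\<lambda>k. \<exists>e. orthonormal k e \<and> (\<forall>i<k. e i \<in> conv_fixed p))"
  have "P 0" by (simp add: P_def orthonormal_def)
  moreover have "\<forall>k. P k \<longrightarrow> k \<le> nat \<lceil>p \<one>\<rceil>"
  proof (intro allI impI)
    fix k assume "P k"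
    then obtain e where e: "orthonormal k e" "\<forall>i<k. e i \<in> conv_fixed p" unfolding P_def by blast
    have "real k \<le> p \<one>" using orthonormal_bound[OF p e(1)] e(2) by blast
    then show "k \<le> nat \<lceil>p \<one>\<rceil>" by linarith
  qed
  ultimately obtain k where k: "P k" "\<And>j. P j \<Longrightarrow> j \<le> k"
    using GreatestI_nat[of P 0 "nat \<lceil>p \<one>\<rceil>"] Greatest_le_nat[of P _ "nat \<lceil>p \<one>\<rceil>"] by blast
  then obtain e where e: "orthonormal k e" "\<And>i. i < k \<Longrightarrow> e i \<in> conv_fixed p" unfolding P_def by blast
  have ec: "\<And>i. i < k \<Longrightarrow> cont (e i)" using e by (simp add: orthonormal_def)
  show thesis
  proof (rule that[OF e])
    fix f x assume f: "f \<in> conv_fixed p" and x: "x \<in> carrier G"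
    have fc: "cont f" using f by (simp add: conv_fixed_def)
    show "f x = (\<Sum>i<k. ip (e i) f * e i x)"
    proof (rule ccontr)
      assume neq: "f x \<noteq> (\<Sum>i<k. ip (e i) f * e i x)"
      define h where "h = (\<lambda>x. \<Sum>i<k. ip (e i) f * e i x)"
      have hc: "cont h" unfolding h_def using ec by (rule cont_sum)
      define r where "r = (\<lambda>x. f x - h x)"
      have rc: "cont r" unfolding r_def using fc hc by (rule cont_diff)
      have rp: "ip r r > 0" using neq by (intro ip_self_pos[OF rc x]) (simp add: r_def h_def)
      have re: "ip (e j) r = 0" if j: "j < k" for j
      proof -
        have "ip (e j) h = (\<Sum>i<k. ip (e i) f * ip (e j) (e i))"
          unfolding h_def using ec j by (intro ip_sum_right)
        also have "\<dots> = (\<Sum>i<k. if j = i then ip (e i) f else 0)"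
          using e(1) j by (intro sum.cong) (auto simp: orthonormal_def)
        finally have "ip (e j) h = ip (e j) f" using j by simp
        then show ?thesis unfolding r_def using ip_diff_right[OF ec[OF j] fc hc] by simp
      qed
      have hW: "conv p h y = h y" if y: "y \<in> carrier G" for y
      proof -
        have px: "cont (\<lambda>z. p (y \<otimes> inv z))" using p y by (intro cont_mult_inv)
        have "conv p h y = ip (\<lambda>z. p (y \<otimes> inv z)) (\<lambda>x. \<Sum>i<k. ip (e i) f * e i x)"
          unfolding conv_alt[OF p(1) hc y] unfolding h_def ..
        also have "\<dots> = (\<Sum>i<k. ip (e i) f * ip (\<lambda>z. p (y \<otimes> inv z)) (e i))"
          using px ec by (rule ip_sum_right)
        also have "\<dots> = (\<Sum>i<k. ip (e i) f * conv p (e i) y)"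
          using ec y by (intro sum.cong) (auto simp: conv_alt[OF p(1)])
        also have "(\<Sum>i<k. ip (e i) f * conv p (e i) y) = h y" unfolding h_def using e(2) y by (intro sum.cong) (auto simp: conv_fixed_def)
        finally show ?thesis .
      qed
      define u where "u = (\<lambda>x. (1 / sqrt (ip r r)) * r x)"
      have uc: "cont u" unfolding u_def using rc by (rule cont_cmult)
      have uW: "u \<in> conv_fixed p"
      proof -
        have "conv p u y = u y" if y: "y \<in> carrier G" for y
        proof -
          have "conv p r y = r y" unfolding r_def
            using conv_diff_right[OF p(1) fc hc y] f hW[OF y] y by (simp add: conv_fixed_def)
          then show ?thesis unfolding u_def conv_cmult_right[OF p(1) rc y] by simp
        qed
        then show ?thesis using uc by (simp add: conv_fixed_def)
      qed
      have uu: "ip u u = 1"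
        unfolding u_def ip_cmult_left[OF rc cont_cmult[OF rc]] ip_cmult_right[OF rc rc] using rp by simp
      have ue: "ip (e j) u = 0" if "j < k" for j
        unfolding u_def ip_cmult_right[OF ec[OF that] rc] re[OF that] by simp
      define e' where "e' = e(k := u)"
      have "orthonormal (Suc k) e'"
      proof -
        have "ip u (e j) = 0" if "j < k" for j using ue[OF that] ip_commute[of u "e j"] by simp
        then show ?thesis using e(1) uc uu ue unfolding orthonormal_def e'_def
          by (auto simp: less_Suc_eq)
      qed
      moreover have "\<forall>i<Suc k. e' i \<in> conv_fixed p"
        using e(2) uW by (auto simp: e'_def less_Suc_eq)
      ultimately have "P (Suc k)" unfolding P_def by blast
      then show False using k(2) by fastforce
    qed
  qed
qed

text \<open>The matrices of the right translations in the basis \<open>e\<close>. They are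
  orthogonal because the mean is right invariant, and continuous because means depend continuously
  on a parameter. If \<open>\<rho> g\<close> is the identity, translation by \<open>g\<close> fixes
  each basis function, hence all of \<open>W\<close>.\<close>

lemma right_translation_rep:
  assumes e: "orthonormal k e" and W: "\<And>i. i < k \<Longrightarrow> e i \<in> W"
    and expand: "\<And>f x. f \<in> W \<Longrightarrow> x \<in> carrier G \<Longrightarrow> f x = (\<Sum>i<k. ip (e i) f * e i x)"
    and trans: "\<And>f g. f \<in> W \<Longrightarrow> g \<in> carrier G \<Longrightarrow> (\<lambda>x. f (x \<otimes> g)) \<in> W"
  obtains \<rho> where "unitary_rep G T \<rho>" "\<And>f g x. f \<in> W \<Longrightarrow> g \<in> carrier G \<Longrightarrow> x \<in> carrier G \<Longrightarrow>
      \<rho> g = 1\<^sub>m (rep_dim G \<rho>) \<Longrightarrow> f (x \<otimes> g) = f x"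
proof -
  have ec: "\<And>i. i < k \<Longrightarrow> cont (e i)" using e by (simp add: orthonormal_def)
  define r where "r = (\<lambda>i j g. ip (e i) (\<lambda>x. e j (x \<otimes> g)))"
  define \<rho> where "\<rho> = (\<lambda>g. mat k k (\<lambda>(i, j). complex_of_real (r i j g)))"
  have rexp: "e j (x \<otimes> g) = (\<Sum>l<k. r l j g * e l x)" if "j < k" "g \<in> carrier G" "x \<in> carrier G" for j g x
    using expand[OF trans[OF W[OF that(1)] that(2)] that(3)] by (simp add: r_def)
  have rone: "r i j \<one> = (if i = j then 1 else 0)" if "i < k" "j < k" for i j
  proof -
    have "r i j \<one> = ip (e i) (e j)" unfolding r_def by (intro ip_cong) auto
    then show ?thesis using e that by (simp add: orthonormal_def)
  qed
  have rmult: "r i j (g \<otimes> h) = (\<Sum>l<k. r i l g * r l j h)"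
    if "i < k" "j < k" "g \<in> carrier G" "h \<in> carrier G" for i j g h
  proof -
    have "r i j (g \<otimes> h) = ip (e i) (\<lambda>x. \<Sum>l<k. r l j h * e l (x \<otimes> g))"
      unfolding r_def
    proof (rule ip_cong)
      fix x assume x: "x \<in> carrier G"
      have "e j (x \<otimes> (g \<otimes> h)) = e j ((x \<otimes> g) \<otimes> h)" using that x by (simp add: m_assoc)
      also have "\<dots> = (\<Sum>l<k. r l j h * e l (x \<otimes> g))" using that x by (intro rexp) auto
      finally show "e j (x \<otimes> (g \<otimes> h)) = (\<Sum>l<k. ip (e l) (\<lambda>x. e j (x \<otimes> h)) * e l (x \<otimes> g))"
        by (simp add: r_def)
    qed simp
    also have "\<dots> = (\<Sum>l<k. r l j h * ip (e i) (\<lambda>x. e l (x \<otimes> g)))"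
      using that ec by (intro ip_sum_right continuous_map_right_translate) auto
    finally show ?thesis by (simp add: r_def mult.commute)
  qed
  have rinv: "r j i g = r i j (inv g)" if "i < k" "j < k" "g \<in> carrier G" for i j g
  proof -
    have c: "cont (\<lambda>x. e j (x \<otimes> inv g) * e i x)"
      using that ec by (intro cont_mult continuous_map_right_translate) auto
    have "r j i g = mean (\<lambda>x. e j (x \<otimes> g \<otimes> inv g) * e i (x \<otimes> g))"
      unfolding r_def ip_def using that by (intro mean_cong) (simp add: m_assoc)
    also have "\<dots> = mean (\<lambda>x. e j (x \<otimes> inv g) * e i x)" using mean_right[OF c that(3)] by simp
    finally show ?thesis by (simp add: r_def ip_def mult.commute)
  qed
  have rcont: "cont (r i j)" if "i < k" "j < k" for i j
  proof -
    have "continuous_map (prod_topology T T) euclideanreal (\<lambda>(g, x). e i x * e j (x \<otimes> g))"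
      unfolding case_prod_beta'
      by (intro continuous_map_real_mult continuous_map_real_comp[OF ec] group_continuous_intros that)
    from continuous_map_mean[OF this] show ?thesis by (simp add: r_def[abs_def] ip_def)
  qed
  have mult: "\<rho> (g \<otimes> h) = \<rho> g * \<rho> h" if "g \<in> carrier G" "h \<in> carrier G" for g h
  proof (rule eq_matI)
    fix i j assume "i < dim_row (\<rho> g * \<rho> h)" "j < dim_col (\<rho> g * \<rho> h)"
    then have ij: "i < k" "j < k" by (auto simp: \<rho>_def)
    have "(\<rho> g * \<rho> h) $$ (i, j) = (\<Sum>l<k. complex_of_real (r i l g) * complex_of_real (r l j h))"
      using ij by (subst index_mult_mat_sum) (auto simp: \<rho>_def)
    also have "\<dots> = complex_of_real (r i j (g \<otimes> h))" using rmult[OF ij that] by simp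
    finally show "\<rho> (g \<otimes> h) $$ (i, j) = (\<rho> g * \<rho> h) $$ (i, j)" using ij by (simp add: \<rho>_def)
  qed (auto simp: \<rho>_def)
  have one: "\<rho> \<one> = 1\<^sub>m k" by (rule eq_matI) (auto simp: \<rho>_def rone)
  have adj: "adj (\<rho> g) = \<rho> (inv g)" if "g \<in> carrier G" for g
  proof (rule eq_matI)
    fix i j assume "i < dim_row (\<rho> (inv g))" "j < dim_col (\<rho> (inv g))"
    then have ij: "i < k" "j < k" by (auto simp: \<rho>_def)
    show "adj (\<rho> g) $$ (i, j) = \<rho> (inv g) $$ (i, j)" using ij rinv[OF ij that] by (simp add: \<rho>_def)
  qed (auto simp: \<rho>_def)
  have unit: "adj (\<rho> g) * \<rho> g = 1\<^sub>m k" if "g \<in> carrier G" for g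
    unfolding adj[OF that] using mult[of "inv g" g] that one by simp
  have cont: "continuous_map T euclidean (\<lambda>g. \<rho> g $$ (i, j))" if "i < k" "j < k" for i j
  proof -
    have "continuous_map euclideanreal euclidean complex_of_real" by (auto intro!: continuous_intros)
    from continuous_map_compose[OF rcont[OF that] this] show ?thesis using that by (simp add: \<rho>_def o_def)
  qed
  have car: "\<rho> g \<in> carrier_mat k k" for g by (simp add: \<rho>_def)
  note rep = unitary_repI[of \<rho> k, OF car unit one mult cont]
  show thesis
  proof (rule that[of \<rho>])
    show "unitary_rep G T \<rho>" by (rule rep(1))
    fix f g x assume f: "f \<in> W" and g: "g \<in> carrier G" and x: "x \<in> carrier G" and r1: "\<rho> g = 1\<^sub>m (rep_dim G \<rho>)"
    have "complex_of_real (r l j g) = (if l = j then 1 else 0)" if "l < k" "j < k" for l j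
      using arg_cong[OF r1, of "\<lambda>M. M $$ (l, j)"] that rep(2) by (simp add: \<rho>_def)
    then have rl: "r l j g = (if l = j then 1 else 0)" if "l < k" "j < k" for l j
      using that by (metis of_real_eq_0_iff of_real_eq_1_iff)
    have ej: "e j (x \<otimes> g) = e j x" if "j < k" for j
    proof -
      have "e j (x \<otimes> g) = (\<Sum>l<k. if j = l then e l x else 0)"
        unfolding rexp[OF that g x] using rl that by (intro sum.cong) auto
      then show ?thesis using that by simp
    qed
    have "f (x \<otimes> g) = (\<Sum>i<k. ip (e i) f * e i (x \<otimes> g))" using g x by (intro expand f) auto
    also have "\<dots> = f x" using ej expand[OF f x] by simp
    finally show "f (x \<otimes> g) = f x" .
  qed
qed

text \<open>For \<open>h x = f (x g) - f x\<close> and the projection \<open>p\<close> belonging to \<open>h * h~\<close>, the function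
  \<open>p * f\<close> lies in a finite-dimensional space invariant under right translations, and it is not
  invariant under translation by \<open>g\<close>, since \<open>p * h = 0\<close> would force \<open>p = 0\<close>.\<close>

theorem unitary_reps_separate_one:
  assumes g: "g \<in> carrier G" "g \<noteq> \<one>"
  shows "\<exists>\<rho>. unitary_rep G T \<rho> \<and> \<rho> g \<noteq> 1\<^sub>m (rep_dim G \<rho>)"
proof (rule ccontr)
  assume "\<not> ?thesis"
  then have triv: "\<rho> g = 1\<^sub>m (rep_dim G \<rho>)" if "unitary_rep G T \<rho>" for \<rho> using that by blast
  obtain f where f: "cont f" "f g \<noteq> f \<one>"
  proof -
    have "normal_space T" using compact Hausdorff by (simp add: compact_Hausdorff_or_regular_imp_normal_space)
    moreover have "closedin T {g}" "closedin T {\<one>}" "disjnt {g} {\<one>}"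
      using g Hausdorff topspace_eq by (auto simp: closedin_Hausdorff_singleton disjnt_def)
    ultimately obtain f where "continuous_map T (top_of_set {0..1::real}) f" "f ` {g} \<subseteq> {0}" "f ` {\<one>} \<subseteq> {1}"
      using Urysohn_lemma[of T "{g}" "{\<one>}" 0 1] by auto
    then show thesis using that by (auto simp: continuous_map_in_subtopology)
  qed
  define h where "h = (\<lambda>x. f (x \<otimes> g) - f x)"
  have fg: "cont (\<lambda>x. f (x \<otimes> g))" using f g by (intro continuous_map_right_translate)
  have h: "cont h" unfolding h_def using fg f(1) by (rule cont_diff)
  have h': "cont (reflect h)" using h by (rule cont_reflect)
  define \<phi> where "\<phi> = conv h (reflect h)"
  have phi: "cont \<phi>" unfolding \<phi>_def using h h' by (rule cont_conv)
  have sym: "reflect \<phi> x = \<phi> x" if x: "x \<in> carrier G" for x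
  proof -
    have "reflect \<phi> x = conv (reflect (reflect h)) (reflect h) x"
      unfolding \<phi>_def by (rule reflect_conv[OF h h' x])
    also have "\<dots> = \<phi> x" unfolding \<phi>_def using x by (intro conv_cong) (auto simp: reflect_def)
    finally show ?thesis .
  qed
  have "ip h h > 0" using f g by (intro ip_self_pos[OF h, of \<one>]) (auto simp: h_def)
  then have "\<phi> \<one> \<noteq> 0" by (simp add: \<phi>_def conv_reflect_one)
  then have phi1: "\<phi> \<one> \<noteq> 0" .
  have "\<exists>p \<mu>. cont p \<and> p \<one> \<ge> 1 \<and> \<mu> > 0 \<and> (\<forall>x\<in>carrier G. conv p p x = p x) \<and>
      (\<forall>x\<in>carrier G. reflect p x = p x) \<and> (\<forall>x\<in>carrier G. conv p (conv \<phi> \<phi>) x = \<mu> * p x)"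
    by (rule spectral_projection[OF phi sym one_closed phi1]) blast+
  then obtain p \<mu> where pq: "cont p \<and> p \<one> \<ge> 1 \<and> \<mu> > 0 \<and> (\<forall>x\<in>carrier G. conv p p x = p x) \<and>
      (\<forall>x\<in>carrier G. reflect p x = p x) \<and> (\<forall>x\<in>carrier G. conv p (conv \<phi> \<phi>) x = \<mu> * p x)"
    by (elim exE)
  then have p: "cont p" "p \<one> \<ge> 1" "\<mu> > 0"
    "\<And>x. x \<in> carrier G \<Longrightarrow> conv p p x = p x"
    "\<And>x. x \<in> carrier G \<Longrightarrow> reflect p x = p x"
    "\<And>x. x \<in> carrier G \<Longrightarrow> conv p (conv \<phi> \<phi>) x = \<mu> * p x" by blast+
  have conv_trans: "conv p (\<lambda>x. q (x \<otimes> a)) x = conv p q (x \<otimes> a)" if "a \<in> carrier G" "x \<in> carrier G" for q a x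
    unfolding conv_def using that by (intro mean_cong) (simp add: m_assoc)
  have trans: "(\<lambda>x. q (x \<otimes> a)) \<in> conv_fixed p" if "q \<in> conv_fixed p" "a \<in> carrier G" for q a
    using that by (auto simp: conv_fixed_def conv_trans intro: continuous_map_right_translate)
  have "\<exists>\<rho>. unitary_rep G T \<rho> \<and> (\<forall>f\<in>conv_fixed p. \<forall>g\<in>carrier G. \<forall>x\<in>carrier G.
      \<rho> g = 1\<^sub>m (rep_dim G \<rho>) \<longrightarrow> f (x \<otimes> g) = f x)"
  proof (rule finite_orthonormal_basis[OF p(1,4,5)])
    fix k e assume e: "orthonormal k e" "\<And>i. i < k \<Longrightarrow> e i \<in> conv_fixed p"
      "\<And>f x. f \<in> conv_fixed p \<Longrightarrow> x \<in> carrier G \<Longrightarrow> f x = (\<Sum>i<k. ip (e i) f * e i x)"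
    show ?thesis by (rule right_translation_rep[OF e trans]) blast+
  qed
  then obtain \<rho> where \<rho>: "unitary_rep G T \<rho>" "\<forall>f\<in>conv_fixed p. \<forall>g\<in>carrier G. \<forall>x\<in>carrier G.
      \<rho> g = 1\<^sub>m (rep_dim G \<rho>) \<longrightarrow> f (x \<otimes> g) = f x" by (elim exE conjE)
  have pf: "conv p f \<in> conv_fixed p"
  proof -
    have "conv p (conv p f) x = conv p f x" if x: "x \<in> carrier G" for x
    proof -
      have "conv p (conv p f) x = conv (conv p p) f x" using conv_assoc[OF p(1) p(1) f(1) x] by simp
      also have "\<dots> = conv p f x" using x p(4) by (intro conv_cong) auto
      finally show ?thesis .
    qed
    then show ?thesis using cont_conv[OF p(1) f(1)] by (simp add: conv_fixed_def)
  qed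
  \<comment> \<open>If every representation were trivial at \<open>g\<close>, translation by
    \<open>g\<close> would fix \<open>conv p f\<close>, so the convolution of \<open>p\<close> with
    the difference \<open>h\<close> would vanish.\<close>
  have ph: "conv p h x = 0" if x: "x \<in> carrier G" for x
    unfolding h_def conv_diff_right[OF p(1) fg f(1) x] conv_trans[OF g(1) x]
    using \<rho>(2) pf g(1) x triv[OF \<rho>(1)] by simp
  have zero: "conv (\<lambda>x. 0) q x = 0" for q x by (simp add: conv_def mean_const)
  have pphi: "conv p \<phi> x = 0" if x: "x \<in> carrier G" for x
  proof -
    have "conv p \<phi> x = conv (conv p h) (reflect h) x"
      unfolding \<phi>_def using conv_assoc[OF p(1) h h' x] by simp
    also have "\<dots> = conv (\<lambda>x. 0) (reflect h) x" using x ph by (intro conv_cong) auto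
    finally show ?thesis by (simp add: zero)
  qed
  have "\<mu> * p \<one> = conv p (conv \<phi> \<phi>) \<one>" using p(6) by simp
  also have "\<dots> = conv (conv p \<phi>) \<phi> \<one>" using conv_assoc[OF p(1) phi phi] by simp
  also have "\<dots> = conv (\<lambda>x. 0) \<phi> \<one>" using pphi by (intro conv_cong) auto
  finally have "\<mu> * p \<one> = 0" by (simp add: zero)
  then show False using p(2,3) by simp
qed

end

section \<open>Classes of irreducible representations and their fusion\<close>

lemma invertible_matI:
  fixes A :: "complex mat"
  assumes "A \<in> carrier_mat n n" "B \<in> carrier_mat n n" "A * B = 1\<^sub>m n" "B * A = 1\<^sub>m n"
  shows "invertible_mat A"
  using assms unfolding invertible_mat_def inverts_mat_def by auto

lemma adj_nonzero: "A \<noteq> 0\<^sub>m n m \<Longrightarrow> adj A \<noteq> 0\<^sub>m m n"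
  by (metis adj_adj adj_zero)

context topological_group
begin

abbreviation irreps :: "'a rep set set" where
  "irreps \<equiv> irrep_classes G T"

text \<open>The same choice as in \<open>multiplicity_coeff\<close>, so that the coefficients unfold
  to intertwiners between these representatives.\<close>

definition rep_of :: "'a rep set \<Rightarrow> 'a rep" where
  "rep_of k = (SOME \<rho>. \<rho> \<in> k)"

definition iso_class :: "'a rep \<Rightarrow> 'a rep set" where
  "iso_class \<rho> = irrep_rel G T `` {\<rho>}"

text \<open>By Schur's lemma a nonzero intertwiner between irreducible representations is already
  invertible.\<close>

lemma irrep_rel_iff:
  "(\<rho>, \<sigma>) \<in> irrep_rel G T \<longleftrightarrow> irreducible_rep G T \<rho> \<and> irreducible_rep G T \<sigma> \<and>
     (\<exists>A\<in>rep_Hom G \<rho> \<sigma>. A \<noteq> 0\<^sub>m (rep_dim G \<sigma>) (rep_dim G \<rho>))"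
proof -
  have "(\<exists>A\<in>rep_Hom G \<rho> \<sigma>. invertible_mat A) \<longleftrightarrow> (\<exists>A\<in>rep_Hom G \<rho> \<sigma>. A \<noteq> 0\<^sub>m (rep_dim G \<sigma>) (rep_dim G \<rho>))"
    if \<rho>: "irreducible_rep G T \<rho>" and \<sigma>: "irreducible_rep G T \<sigma>"
  proof
    assume "\<exists>A\<in>rep_Hom G \<rho> \<sigma>. invertible_mat A"
    then obtain A where A: "A \<in> rep_Hom G \<rho> \<sigma>" "invertible_mat A" by blast
    have "A \<noteq> 0\<^sub>m (rep_dim G \<sigma>) (rep_dim G \<rho>)"
    proof
      assume 0: "A = 0\<^sub>m (rep_dim G \<sigma>) (rep_dim G \<rho>)"
      obtain B where B: "A * B = 1\<^sub>m (dim_row A)" "B * A = 1\<^sub>m (dim_row B)"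
        using A(2) unfolding invertible_mat_def inverts_mat_def by blast
      have dB: "dim_row B = dim_col A" using arg_cong[OF B(2), of dim_col] by simp
      have "A * B = 0\<^sub>m (rep_dim G \<sigma>) (dim_col B)"
        unfolding 0 by (rule zero_mult_mat_dim) (simp add: dB 0)
      then have "(1\<^sub>m (rep_dim G \<sigma>) :: complex mat) = 0\<^sub>m (rep_dim G \<sigma>) (dim_col B)"
        using B(1) unfolding 0 by simp
      from arg_cong[OF this, of "\<lambda>M. M $$ (0, 0)"] arg_cong[OF this, of dim_col]
      show False using \<sigma> by (simp add: irreducible_rep_def)
    qed
    then show "\<exists>A\<in>rep_Hom G \<rho> \<sigma>. A \<noteq> 0\<^sub>m (rep_dim G \<sigma>) (rep_dim G \<rho>)" using A by blast
  next
    assume "\<exists>A\<in>rep_Hom G \<rho> \<sigma>. A \<noteq> 0\<^sub>m (rep_dim G \<sigma>) (rep_dim G \<rho>)"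
    then obtain A where A: "A \<in> rep_Hom G \<rho> \<sigma>" "A \<noteq> 0\<^sub>m (rep_dim G \<sigma>) (rep_dim G \<rho>)" by blast
    from schur_inverse[OF \<rho> \<sigma> A] obtain B where "rep_dim G \<sigma> = rep_dim G \<rho>"
      "B \<in> carrier_mat (rep_dim G \<rho>) (rep_dim G \<rho>)"
      "A * B = 1\<^sub>m (rep_dim G \<rho>)" "B * A = 1\<^sub>m (rep_dim G \<rho>)" by metis
    then have "invertible_mat A" using rep_Hom_carrier[OF A(1)] by (intro invertible_matI) auto
    then show "\<exists>A\<in>rep_Hom G \<rho> \<sigma>. invertible_mat A" using A by blast
  qed
  then show ?thesis unfolding irrep_rel_def rep_iso_def by auto
qed

lemma one_in_rep_Hom:
  assumes "unitary_rep G T \<rho>"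
  shows "1\<^sub>m (rep_dim G \<rho>) \<in> rep_Hom G \<rho> \<rho>"
  by (rule rep_HomI) (use unitary_rep_dims[OF assms] in \<open>auto simp: mat_dim_simps\<close>)

text \<open>By Schur's lemma \<open>B\<close> has a right inverse, so \<open>A * B = 0\<close> would
  give \<open>A = 0\<close>.\<close>

lemma rep_Hom_mult_nonzero:
  assumes \<rho>: "irreducible_rep G T \<rho>" and \<sigma>: "irreducible_rep G T \<sigma>" and \<tau>: "unitary_rep G T \<tau>"
    and A: "A \<in> rep_Hom G \<sigma> \<tau>" "A \<noteq> 0\<^sub>m (rep_dim G \<tau>) (rep_dim G \<sigma>)"
    and B: "B \<in> rep_Hom G \<rho> \<sigma>" "B \<noteq> 0\<^sub>m (rep_dim G \<sigma>) (rep_dim G \<rho>)"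
  shows "A * B \<in> rep_Hom G \<rho> \<tau>" "A * B \<noteq> 0\<^sub>m (rep_dim G \<tau>) (rep_dim G \<rho>)"
proof -
  note u = irreducible_rep_unitary[OF \<rho>] irreducible_rep_unitary[OF \<sigma>]
  show "A * B \<in> rep_Hom G \<rho> \<tau>" using rep_Hom_mult[OF u \<tau> A(1) B(1)] .
  from schur_inverse[OF \<rho> \<sigma> B] obtain C where C: "rep_dim G \<sigma> = rep_dim G \<rho>"
      "C \<in> carrier_mat (rep_dim G \<rho>) (rep_dim G \<rho>)" "B * C = 1\<^sub>m (rep_dim G \<rho>)" by metis
  show "A * B \<noteq> 0\<^sub>m (rep_dim G \<tau>) (rep_dim G \<rho>)"
  proof
    assume z: "A * B = 0\<^sub>m (rep_dim G \<tau>) (rep_dim G \<rho>)"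
    have "A = A * (B * C)" unfolding C(3) using rep_Hom_dims[OF A(1)] C(1) by (simp add: mat_dim_simps)
    also have "\<dots> = (A * B) * C"
      using rep_Hom_dims[OF A(1)] rep_Hom_dims[OF B(1)] C by (simp add: mult_mat_assoc_dim)
    also have "\<dots> = 0\<^sub>m (rep_dim G \<tau>) (rep_dim G \<sigma>)" unfolding z using C by simp
    finally show False using A(2) by simp
  qed
qed

text \<open>With isomorphism weakened to a nonzero intertwiner, symmetry comes from the adjoint and
  transitivity from the product.\<close>

lemma irrep_rel_equiv: "equiv {\<rho>. irreducible_rep G T \<rho>} (irrep_rel G T)"
proof (rule equivI)
  show "irrep_rel G T \<subseteq> {\<rho>. irreducible_rep G T \<rho>} \<times> {\<rho>. irreducible_rep G T \<rho>}"
    by (auto simp: irrep_rel_def)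
  show "refl_on {\<rho>. irreducible_rep G T \<rho>} (irrep_rel G T)"
  proof (rule refl_onI)
    fix \<rho> assume "\<rho> \<in> {\<rho>. irreducible_rep G T \<rho>}"
    then have \<rho>: "irreducible_rep G T \<rho>" by simp
    have "1\<^sub>m (rep_dim G \<rho>) \<noteq> (0\<^sub>m (rep_dim G \<rho>) (rep_dim G \<rho>) :: complex mat)"
    proof
      assume "1\<^sub>m (rep_dim G \<rho>) = (0\<^sub>m (rep_dim G \<rho>) (rep_dim G \<rho>) :: complex mat)"
      then have "1\<^sub>m (rep_dim G \<rho>) $$ (0, 0) = (0\<^sub>m (rep_dim G \<rho>) (rep_dim G \<rho>) :: complex mat) $$ (0, 0)"
        by simp
      then show False using \<rho> by (simp add: irreducible_rep_def)
    qed
    then show "(\<rho>, \<rho>) \<in> irrep_rel G T"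
      using \<rho> one_in_rep_Hom[OF irreducible_rep_unitary[OF \<rho>]] by (auto simp: irrep_rel_iff)
  qed
  show "sym (irrep_rel G T)"
  proof (rule symI)
    fix \<rho> \<sigma> assume "(\<rho>, \<sigma>) \<in> irrep_rel G T"
    then show "(\<sigma>, \<rho>) \<in> irrep_rel G T"
      unfolding irrep_rel_iff
      by (meson rep_Hom_adj irreducible_rep_unitary adj_nonzero)
  qed
  show "trans (irrep_rel G T)"
  proof (rule transI)
    fix \<rho> \<sigma> \<tau> assume "(\<rho>, \<sigma>) \<in> irrep_rel G T" "(\<sigma>, \<tau>) \<in> irrep_rel G T"
    then show "(\<rho>, \<tau>) \<in> irrep_rel G T"
      unfolding irrep_rel_iff using rep_Hom_mult_nonzero irreducible_rep_unitary by meson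
  qed
qed

lemma iso_class_in_irreps: "irreducible_rep G T \<rho> \<Longrightarrow> iso_class \<rho> \<in> irreps"
  unfolding iso_class_def irrep_classes_def by (intro quotientI) simp

lemma rep_of_mem: "k \<in> irreps \<Longrightarrow> rep_of k \<in> k"
  using in_quotient_imp_non_empty[OF irrep_rel_equiv, of k]
  unfolding rep_of_def irrep_classes_def by (simp add: some_in_eq)

lemma rep_of_irreducible: "k \<in> irreps \<Longrightarrow> irreducible_rep G T (rep_of k)"
  using rep_of_mem in_quotient_imp_subset[OF irrep_rel_equiv] unfolding irrep_classes_def by blast

lemma rep_of_unitary: "k \<in> irreps \<Longrightarrow> unitary_rep G T (rep_of k)"
  using rep_of_irreducible irreducible_rep_unitary by blast

lemma iso_class_eqI: "(\<rho>, \<sigma>) \<in> irrep_rel G T \<Longrightarrow> iso_class \<rho> = iso_class \<sigma>"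
  unfolding iso_class_def by (rule equiv_class_eq[OF irrep_rel_equiv])

lemma iso_class_rep_of:
  assumes "k \<in> irreps"
  shows "iso_class (rep_of k) = k"
proof -
  from assms obtain \<rho> where \<rho>: "k = iso_class \<rho>"
    unfolding irrep_classes_def iso_class_def by (rule quotientE)
  then have "(\<rho>, rep_of k) \<in> irrep_rel G T" using rep_of_mem[OF assms] by (simp add: iso_class_def)
  from iso_class_eqI[OF this] \<rho> show ?thesis by simp
qed

lemma rep_of_iso_class:
  assumes "irreducible_rep G T \<rho>"
  shows "(rep_of (iso_class \<rho>), \<rho>) \<in> irrep_rel G T"
proof -
  have "rep_of (iso_class \<rho>) \<in> iso_class \<rho>" by (rule rep_of_mem[OF iso_class_in_irreps[OF assms]])
  then have "(\<rho>, rep_of (iso_class \<rho>)) \<in> irrep_rel G T" by (simp add: iso_class_def)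
  then show ?thesis using irrep_rel_equiv by (meson equivE symE)
qed

lemma irrep_rel_conjugate:
  assumes "(\<rho>, \<sigma>) \<in> irrep_rel G T"
  obtains A B where "rep_dim G \<sigma> = rep_dim G \<rho>" "A \<in> carrier_mat (rep_dim G \<rho>) (rep_dim G \<rho>)"
    "B \<in> carrier_mat (rep_dim G \<rho>) (rep_dim G \<rho>)" "A * B = 1\<^sub>m (rep_dim G \<rho>)" "B * A = 1\<^sub>m (rep_dim G \<rho>)"
    "\<And>g. g \<in> carrier G \<Longrightarrow> \<sigma> g = A * (\<rho> g * B)"
proof -
  have \<rho>: "irreducible_rep G T \<rho>" and \<sigma>: "irreducible_rep G T \<sigma>" using assms by (auto simp: irrep_rel_iff)
  note u = irreducible_rep_unitary[OF \<rho>] irreducible_rep_unitary[OF \<sigma>]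
  obtain A where A: "A \<in> rep_Hom G \<rho> \<sigma>" "A \<noteq> 0\<^sub>m (rep_dim G \<sigma>) (rep_dim G \<rho>)"
    using assms by (auto simp: irrep_rel_iff)
  from schur_inverse[OF \<rho> \<sigma> A] obtain B where B: "rep_dim G \<sigma> = rep_dim G \<rho>"
      "B \<in> carrier_mat (rep_dim G \<rho>) (rep_dim G \<rho>)" "A * B = 1\<^sub>m (rep_dim G \<rho>)" "B * A = 1\<^sub>m (rep_dim G \<rho>)" by metis
  have Ac: "A \<in> carrier_mat (rep_dim G \<rho>) (rep_dim G \<rho>)" using rep_Hom_carrier[OF A(1)] B(1) by simp
  have "\<sigma> g = A * (\<rho> g * B)" if g: "g \<in> carrier G" for g
  proof -
    note d = unitary_rep_dims[OF u(1) g] unitary_rep_dims[OF u(2) g] carrier_matD[OF Ac] carrier_matD[OF B(2)] B(1)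
    have "A * (\<rho> g * B) = A * \<rho> g * B" using d by (simp add: mult_mat_assoc_dim)
    also have "\<dots> = \<sigma> g * (A * B)" unfolding rep_Hom_commute[OF A(1) g] using d by (simp add: mult_mat_assoc_dim)
    also have "\<dots> = \<sigma> g" unfolding B(3) using d by (simp add: mat_dim_simps)
    finally show ?thesis by simp
  qed
  with that[OF B(1) Ac B(2,3,4)] show thesis by blast
qed

lemma irrep_rel_trace:
  assumes "(\<rho>, \<sigma>) \<in> irrep_rel G T" and g: "g \<in> carrier G"
  shows "mat_trace (\<sigma> g) = mat_trace (\<rho> g)"
proof (rule irrep_rel_conjugate[OF assms(1)])
  fix A B
  assume A: "A \<in> carrier_mat (rep_dim G \<rho>) (rep_dim G \<rho>)"
    and B: "B \<in> carrier_mat (rep_dim G \<rho>) (rep_dim G \<rho>)" "B * A = 1\<^sub>m (rep_dim G \<rho>)"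
    and eq: "\<And>g. g \<in> carrier G \<Longrightarrow> \<sigma> g = A * (\<rho> g * B)"
  have "unitary_rep G T \<rho>" using assms by (auto simp: irrep_rel_iff irreducible_rep_unitary)
  note rc = unitary_rep_carrier[OF this g]
  have "mat_trace (\<sigma> g) = mat_trace (\<rho> g * B * A)"
    unfolding eq[OF g] using A B rc by (intro mat_trace_mult_commute) auto
  also have "\<rho> g * B * A = \<rho> g" using rc A B by (simp add: mult_mat_assoc_dim)
  finally show ?thesis .
qed

lemma irrep_rel_one:
  assumes "(\<rho>, \<sigma>) \<in> irrep_rel G T" and g: "g \<in> carrier G" and "\<rho> g = 1\<^sub>m (rep_dim G \<rho>)"
  shows "\<sigma> g = 1\<^sub>m (rep_dim G \<sigma>)"
proof (rule irrep_rel_conjugate[OF assms(1)])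
  fix A B
  assume d: "rep_dim G \<sigma> = rep_dim G \<rho>" and A: "A \<in> carrier_mat (rep_dim G \<rho>) (rep_dim G \<rho>)"
    and B: "B \<in> carrier_mat (rep_dim G \<rho>) (rep_dim G \<rho>)" "A * B = 1\<^sub>m (rep_dim G \<rho>)"
    and eq: "\<And>g. g \<in> carrier G \<Longrightarrow> \<sigma> g = A * (\<rho> g * B)"
  show ?thesis unfolding eq[OF g] assms(3) using A B d by (simp add: mat_dim_simps)
qed

section \<open>Tensor products, their constituents and characters\<close>

lemma tensor_unitary:
  assumes \<rho>: "unitary_rep G T \<rho>" and \<sigma>: "unitary_rep G T \<sigma>"
  shows "unitary_rep G T (tensor_rep \<rho> \<sigma>)" "rep_dim G (tensor_rep \<rho> \<sigma>) = rep_dim G \<rho> * rep_dim G \<sigma>"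
proof -
  let ?n = "rep_dim G \<rho>" and ?m = "rep_dim G \<sigma>"
  note d = unitary_rep_dims[OF \<rho>] unitary_rep_dims[OF \<sigma>]
  have 1: "tensor_rep \<rho> \<sigma> g \<in> carrier_mat (?n * ?m) (?n * ?m)" if "g \<in> carrier G" for g
    using d that by (intro carrier_matI) (auto simp: tensor_rep_def)
  have 2: "adj (tensor_rep \<rho> \<sigma> g) * tensor_rep \<rho> \<sigma> g = 1\<^sub>m (?n * ?m)" if g: "g \<in> carrier G" for g
    unfolding tensor_rep_def adj_kronecker using d g unitary_rep_unitary[OF \<rho> g] unitary_rep_unitary[OF \<sigma> g]
    by (subst kronecker_mult[symmetric]) (auto simp: kronecker_one)
  have 3: "tensor_rep \<rho> \<sigma> \<one> = 1\<^sub>m (?n * ?m)"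
    unfolding tensor_rep_def unitary_rep_one[OF \<rho>] unitary_rep_one[OF \<sigma>] by (rule kronecker_one)
  have 4: "tensor_rep \<rho> \<sigma> (g \<otimes> h) = tensor_rep \<rho> \<sigma> g * tensor_rep \<rho> \<sigma> h" if "g \<in> carrier G" "h \<in> carrier G" for g h
    unfolding tensor_rep_def unitary_rep_mult[OF \<rho> that] unitary_rep_mult[OF \<sigma> that]
    using d that by (intro kronecker_mult) auto
  have 5: "continuous_map T euclidean (\<lambda>g. tensor_rep \<rho> \<sigma> g $$ (i, j))"
    if i: "i < ?n * ?m" and j: "j < ?n * ?m" for i j
  proof -
    have c: "continuous_map T euclidean (\<lambda>g. \<rho> g $$ (i div ?m, j div ?m) * \<sigma> g $$ (i mod ?m, j mod ?m))"
      using div_mod_less[OF i] div_mod_less[OF j]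
      by (intro continuous_map_complex_mult unitary_rep_continuous[OF \<rho>] unitary_rep_continuous[OF \<sigma>])
    have "\<rho> g $$ (i div ?m, j div ?m) * \<sigma> g $$ (i mod ?m, j mod ?m) = tensor_rep \<rho> \<sigma> g $$ (i, j)"
      if "g \<in> topspace T" for g
      using that i j d topspace_eq by (simp add: tensor_rep_def kronecker_index)
    from continuous_map_eq[OF c this] show ?thesis .
  qed
  show "unitary_rep G T (tensor_rep \<rho> \<sigma>)" "rep_dim G (tensor_rep \<rho> \<sigma>) = ?n * ?m"
    by (rule unitary_repI[of _ "?n * ?m"]; (rule 1 2 3 4 5; assumption)?)+
qed

lemma multiplicity_nonzero_iff:
  assumes "i \<in> irreps" "j \<in> irreps" "k \<in> irreps"
  shows "multiplicity_coeff G i j k \<noteq> 0 \<longleftrightarrow> (\<exists>A\<in>rep_Hom G (rep_of k) (tensor_rep (rep_of i) (rep_of j)).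
     A \<noteq> 0\<^sub>m (rep_dim G (rep_of i) * rep_dim G (rep_of j)) (rep_dim G (rep_of k)))"
  using dim_Hom_nonzero_iff[OF rep_of_unitary[OF assms(3)] tensor_unitary(1)[OF assms(1,2)[THEN rep_of_unitary]]]
  unfolding multiplicity_coeff_def rep_of_def[symmetric] tensor_unitary(2)[OF assms(1,2)[THEN rep_of_unitary]] .

text \<open>A nonzero intertwiner from \<open>rep_of k\<close> into the tensor product has a nonzero
  component \<open>adj C * A\<close> in some member of a decomposition, and Schur's lemma identifies
  \<open>k\<close> with the class of that member. Hence the inner sum of
  \<open>rep_ring_mult\<close> is over a finite set and does not collapse to the default value
  0.\<close>

lemma finite_constituents:
  assumes "i \<in> irreps" "j \<in> irreps"
  shows "finite {k \<in> irreps. multiplicity_coeff G i j k \<noteq> 0}"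
proof -
  let ?\<tau> = "tensor_rep (rep_of i) (rep_of j)"
  note \<tau> = tensor_unitary[OF assms[THEN rep_of_unitary]]
  obtain L where L: "decomposition ?\<tau> L" using irreducible_decomposition[OF \<tau>(1)] by blast
  have "k \<in> (\<lambda>(\<sigma>, C). iso_class \<sigma>) ` set L"
    if k: "k \<in> irreps" and n0: "multiplicity_coeff G i j k \<noteq> 0" for k
  proof -
    obtain A where A: "A \<in> rep_Hom G (rep_of k) ?\<tau>" "A \<noteq> 0\<^sub>m (rep_dim G ?\<tau>) (rep_dim G (rep_of k))"
      using n0 multiplicity_nonzero_iff[OF assms k] \<tau>(2) by auto
    then obtain \<sigma> C where C: "(\<sigma>, C) \<in> set L" "adj C * A \<noteq> 0\<^sub>m (rep_dim G \<sigma>) (rep_dim G (rep_of k))"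
      using L rep_Hom_carrier[OF A(1)] unfolding decomposition_def by blast
    have \<sigma>: "irreducible_rep G T \<sigma>" "C \<in> rep_Hom G \<sigma> ?\<tau>" using L C(1) unfolding decomposition_def by blast+
    note u\<sigma> = irreducible_rep_unitary[OF \<sigma>(1)]
    have "adj C * A \<in> rep_Hom G (rep_of k) \<sigma>"
      by (rule rep_Hom_mult[OF rep_of_unitary[OF k] \<tau>(1) u\<sigma> rep_Hom_adj[OF u\<sigma> \<tau>(1) \<sigma>(2)] A(1)])
    then have "(rep_of k, \<sigma>) \<in> irrep_rel G T"
      using C(2) \<sigma>(1) rep_of_irreducible[OF k] unfolding irrep_rel_iff by blast
    then have "k = iso_class \<sigma>" using iso_class_eqI iso_class_rep_of[OF k] by metis
    then show ?thesis using C(1) by force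
  qed
  then have "{k \<in> irreps. multiplicity_coeff G i j k \<noteq> 0} \<subseteq> (\<lambda>(\<sigma>, C). iso_class \<sigma>) ` set L" by blast
  then show ?thesis by (rule finite_subset) simp
qed

text \<open>The value 0 off the carrier makes products of characters decompose as functions on the
  whole type, which the relation \<open>twist\<close> between functions requires.\<close>

definition char :: "'a rep set \<Rightarrow> 'a \<Rightarrow> complex" where
  "char k g = (if g \<in> carrier G then mat_trace (rep_of k g) else 0)"

text \<open>The product is the trace of the tensor representation, which is decomposed. For a member
  of the list, its embedding \<open>C\<close> composed with an isomorphism from
  \<open>rep_of k\<close> is a nonzero intertwiner, whence the coefficient of its class does not
  vanish.\<close>

lemma char_mult:
  assumes "i \<in> irreps" "j \<in> irreps"
  obtains ks where "\<And>k. k \<in> set ks \<Longrightarrow> k \<in> irreps \<and> multiplicity_coeff G i j k \<noteq> 0"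
    "\<And>g. char i g * char j g = (\<Sum>k\<leftarrow>ks. char k g)"
proof -
  let ?\<tau> = "tensor_rep (rep_of i) (rep_of j)"
  note \<tau> = tensor_unitary[OF assms[THEN rep_of_unitary]]
  obtain L where L: "decomposition ?\<tau> L" using irreducible_decomposition[OF \<tau>(1)] by blast
  show thesis
  proof (rule that[of "map (\<lambda>(\<sigma>, C). iso_class \<sigma>) L"])
    fix k assume "k \<in> set (map (\<lambda>(\<sigma>, C). iso_class \<sigma>) L)"
    then obtain \<sigma> C where C: "(\<sigma>, C) \<in> set L" "k = iso_class \<sigma>" by auto
    have \<sigma>: "irreducible_rep G T \<sigma>" "C \<in> rep_Hom G \<sigma> ?\<tau>" "isometry (rep_dim G ?\<tau>) (rep_dim G \<sigma>) C"
      using L C(1) unfolding decomposition_def by blast+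
    have k: "k \<in> irreps" using C(2) iso_class_in_irreps[OF \<sigma>(1)] by simp
    have C0: "C \<noteq> 0\<^sub>m (rep_dim G ?\<tau>) (rep_dim G \<sigma>)"
      using isometry_nonzero[OF \<sigma>(3)] \<sigma>(1) by (simp add: irreducible_rep_def)
    obtain B where B: "B \<in> rep_Hom G (rep_of k) \<sigma>" "B \<noteq> 0\<^sub>m (rep_dim G \<sigma>) (rep_dim G (rep_of k))"
      using rep_of_iso_class[OF \<sigma>(1)] unfolding C(2) irrep_rel_iff by blast
    show "k \<in> irreps \<and> multiplicity_coeff G i j k \<noteq> 0"
      using k rep_Hom_mult_nonzero[OF rep_of_irreducible[OF k] \<sigma>(1) \<tau>(1) \<sigma>(2) C0 B]
      unfolding multiplicity_nonzero_iff[OF assms k] \<tau>(2) by blast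
  next
    fix g
    show "char i g * char j g = (\<Sum>k\<leftarrow>map (\<lambda>(\<sigma>, C). iso_class \<sigma>) L. char k g)"
    proof (cases "g \<in> carrier G")
      case True
      have "char i g * char j g = mat_trace (?\<tau> g)"
        using True assms[THEN rep_of_unitary, THEN unitary_rep_carrier, OF True]
        by (simp add: char_def tensor_rep_def mat_trace_kronecker)
      also have "\<dots> = (\<Sum>(\<sigma>, C)\<leftarrow>L. mat_trace (\<sigma> g))" using L True unfolding decomposition_def by blast
      also have "\<dots> = (\<Sum>(\<sigma>, C)\<leftarrow>L. char (iso_class \<sigma>) g)"
      proof (intro arg_cong[where f=sum_list] map_cong refl)
        fix x assume x: "x \<in> set L"
        obtain \<sigma> C where sC: "x = (\<sigma>, C)" by (cases x)
        have "irreducible_rep G T \<sigma>" using L x sC unfolding decomposition_def by blast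
        from irrep_rel_trace[OF rep_of_iso_class[OF this] True]
        show "(case x of (\<sigma>, C) \<Rightarrow> mat_trace (\<sigma> g)) = (case x of (\<sigma>, C) \<Rightarrow> char (iso_class \<sigma>) g)"
          using True sC by (simp add: char_def)
      qed
      finally show ?thesis by (simp add: o_def case_prod_beta')
    next
      case False
      have "(\<Sum>k\<leftarrow>ks. char k g) = 0" for ks using False by (induction ks) (auto simp: char_def)
      then show ?thesis using False by (simp add: char_def)
    qed
  qed
qed

section \<open>The trivial class and elementary properties of characters\<close>

definition trivial_class :: "'a rep set" where
  "trivial_class = iso_class trivial_rep"

lemma trivial_rep_irreducible: "irreducible_rep G T trivial_rep"
proof -
  have u: "unitary_rep G T trivial_rep" and d: "rep_dim G trivial_rep = 1"
    by (rule unitary_repI[of _ 1]; auto simp: trivial_rep_def mat_dim_simps)+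
  have "W = {0\<^sub>v 1} \<or> W = carrier_vec 1" if W: "vec_subspace 1 W" for W
  proof (cases "W = {0\<^sub>v 1}")
    case False
    have W': "W \<subseteq> carrier_vec 1" "0\<^sub>v 1 \<in> W" "\<And>c v. v \<in> W \<Longrightarrow> c \<cdot>\<^sub>v v \<in> W"
      using W by (auto simp: vec_subspace_def)
    obtain w where w: "w \<in> W" "w \<noteq> 0\<^sub>v 1" using False W'(2) by blast
    have w1: "w \<in> carrier_vec 1" "w $ 0 \<noteq> 0"
      using w W'(1) by (auto simp: less_Suc0 intro!: eq_vecI)
    have "v \<in> W" if v: "v \<in> carrier_vec 1" for v
    proof -
      have "v = (v $ 0 / w $ 0) \<cdot>\<^sub>v w" using v w1 by (intro eq_vecI) auto
      then show ?thesis using W'(3)[OF w(1)] by metis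
    qed
    then show ?thesis using W'(1) by blast
  qed simp
  then show ?thesis unfolding irreducible_rep_iff d using u by simp
qed

lemma trivial_class: "trivial_class \<in> irreps"
  unfolding trivial_class_def by (rule iso_class_in_irreps[OF trivial_rep_irreducible])

lemma rep_of_trivial_class:
  shows "rep_dim G (rep_of trivial_class) = 1"
    and "g \<in> carrier G \<Longrightarrow> rep_of trivial_class g = 1\<^sub>m 1"
proof -
  have "(rep_of trivial_class, trivial_rep) \<in> irrep_rel G T"
    unfolding trivial_class_def by (rule rep_of_iso_class[OF trivial_rep_irreducible])
  then have rel: "(trivial_rep, rep_of trivial_class) \<in> irrep_rel G T"
    using irrep_rel_equiv by (meson equivE symE)
  have d1: "rep_dim G trivial_rep = 1" by (simp add: rep_dim_def trivial_rep_def)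
  show d: "rep_dim G (rep_of trivial_class) = 1"
    using irrep_rel_conjugate[OF rel] d1 by metis
  show "rep_of trivial_class g = 1\<^sub>m 1" if "g \<in> carrier G"
    using irrep_rel_one[OF rel that] d d1 by (simp add: trivial_rep_def)
qed

lemma char_trivial: "char trivial_class g = (if g \<in> carrier G then 1 else 0)"
  by (simp add: char_def rep_of_trivial_class mat_trace_one)

lemma char_one: "k \<in> irreps \<Longrightarrow> char k \<one> = of_nat (rep_dim G (rep_of k))"
  by (simp add: char_def unitary_rep_one[OF rep_of_unitary] mat_trace_one)

lemma char_continuous:
  assumes k: "k \<in> irreps"
  shows "continuous_map T euclidean (char k)"
proof -
  note u = rep_of_unitary[OF k]
  have c: "continuous_map T euclidean (\<lambda>g. \<Sum>i<rep_dim G (rep_of k). rep_of k g $$ (i, i))"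
    by (intro continuous_map_sum unitary_rep_continuous[OF u]) auto
  have "(\<Sum>i<rep_dim G (rep_of k). rep_of k g $$ (i, i)) = char k g" if "g \<in> topspace T" for g
    using that unitary_rep_dims[OF u, of g] topspace_eq by (simp add: char_def mat_trace_def)
  from continuous_map_eq[OF c this] show ?thesis .
qed

end

section \<open>Orthogonality of characters\<close>

context compact_group
begin

abbreviation ccont :: "('a \<Rightarrow> complex) \<Rightarrow> bool" where
  "ccont \<equiv> continuous_map T euclidean"

definition cmean :: "('a \<Rightarrow> complex) \<Rightarrow> complex" where
  "cmean f = Complex (mean (\<lambda>x. Re (f x))) (mean (\<lambda>x. Im (f x)))"

lemma cont_Re: "ccont f \<Longrightarrow> cont (\<lambda>x. Re (f x))"
  and cont_Im: "ccont f \<Longrightarrow> cont (\<lambda>x. Im (f x))"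
  and ccont_cnj: "ccont f \<Longrightarrow> ccont (\<lambda>x. cnj (f x))"
  and cont_cmod: "ccont f \<Longrightarrow> cont (\<lambda>x. cmod (f x))"
proof -
  assume f: "ccont f"
  have c: "continuous_map euclidean euclideanreal Re" "continuous_map euclidean euclideanreal Im"
    "continuous_map euclidean euclidean cnj" "continuous_map euclidean euclideanreal cmod"
    by (auto intro!: continuous_intros)
  show "cont (\<lambda>x. Re (f x))" using continuous_map_compose[OF f c(1)] by (simp add: o_def)
  show "cont (\<lambda>x. Im (f x))" using continuous_map_compose[OF f c(2)] by (simp add: o_def)
  show "ccont (\<lambda>x. cnj (f x))" using continuous_map_compose[OF f c(3)] by (simp add: o_def)
  show "cont (\<lambda>x. cmod (f x))" using continuous_map_compose[OF f c(4)] by (simp add: o_def)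
qed

lemma ccont_cmult: "ccont f \<Longrightarrow> ccont (\<lambda>x. c * f x)"
  by (rule continuous_map_complex_mult) auto

lemma cmean_cong: "(\<And>x. x \<in> carrier G \<Longrightarrow> f x = h x) \<Longrightarrow> cmean f = cmean h"
  unfolding cmean_def by (intro arg_cong2[where f=Complex] mean_cong) auto

lemma cmean_add: "ccont f \<Longrightarrow> ccont h \<Longrightarrow> cmean (\<lambda>x. f x + h x) = cmean f + cmean h"
  by (simp add: cmean_def mean_add cont_Re cont_Im complex_eq_iff)

lemma cmean_cmult:
  assumes f: "ccont f"
  shows "cmean (\<lambda>x. c * f x) = c * cmean f"
proof -
  note r = cont_Re[OF f] cont_Im[OF f]
  note s = cont_cmult[OF r(1)] cont_cmult[OF r(2)]
  show ?thesis
    by (simp add: cmean_def complex_eq_iff mean_diff[OF s(1) s(2)] mean_add[OF s(1) s(2)]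
        mean_add[OF s(2) s(1)] mean_cmult[OF r(1)] mean_cmult[OF r(2)])
qed

lemma cmean_zero: "cmean (\<lambda>x. 0) = 0"
  by (simp add: cmean_def mean_const complex_eq_iff)

lemma cmean_sum:
  assumes "finite I" "\<And>i. i \<in> I \<Longrightarrow> ccont (f i)"
  shows "cmean (\<lambda>x. \<Sum>i\<in>I. f i x) = (\<Sum>i\<in>I. cmean (f i))"
  using assms by (induction I) (auto simp: cmean_zero cmean_add continuous_map_sum)

lemma cmean_right: "ccont f \<Longrightarrow> a \<in> carrier G \<Longrightarrow> cmean (\<lambda>x. f (x \<otimes> a)) = cmean f"
  unfolding cmean_def using mean_right[OF cont_Re] mean_right[OF cont_Im] by simp

lemma cmean_norm: "cmean (\<lambda>x. f x * cnj (f x)) = complex_of_real (mean (\<lambda>x. (cmod (f x))\<^sup>2))"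
  unfolding complex_norm_square[symmetric] cmean_def
  by (simp add: mean_const complex_eq_iff del: of_real_power)

text \<open>For fixed \<open>i\<close> and \<open>a\<close> the means form a matrix \<open>B\<close>
  in the other two indices. Right invariance makes \<open>B\<close> an intertwiner, and one between
  inequivalent irreducible representations is zero.\<close>

lemma coefficient_orthogonality:
  assumes \<rho>: "irreducible_rep G T \<rho>" and \<tau>: "irreducible_rep G T \<tau>" and nr: "(\<rho>, \<tau>) \<notin> irrep_rel G T"
    and i: "i < rep_dim G \<rho>" "j < rep_dim G \<rho>" and a: "a < rep_dim G \<tau>" "b < rep_dim G \<tau>"
  shows "cmean (\<lambda>g. \<rho> g $$ (i, j) * cnj (\<tau> g $$ (a, b))) = 0"
proof -
  let ?n = "rep_dim G \<rho>" and ?m = "rep_dim G \<tau>"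
  note u = irreducible_rep_unitary[OF \<rho>] irreducible_rep_unitary[OF \<tau>]
  have cc: "ccont (\<lambda>g. \<rho> g $$ (i, q) * cnj (\<tau> g $$ (a, p)))" if "q < ?n" "p < ?m" for p q
    using that i a by (intro continuous_map_complex_mult ccont_cnj unitary_rep_continuous[OF u(1)]
        unitary_rep_continuous[OF u(2)])
  define B where "B = mat ?m ?n (\<lambda>(p, q). cmean (\<lambda>g. \<rho> g $$ (i, q) * cnj (\<tau> g $$ (a, p))))"
  have Bc: "B \<in> carrier_mat ?m ?n" by (simp add: B_def)
  have "B \<in> rep_Hom G \<rho> \<tau>"
  proof (rule rep_HomI[OF Bc])
    fix h assume h: "h \<in> carrier G"
    note d = unitary_rep_dims[OF u(1)] unitary_rep_dims[OF u(2)]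
    show "B * \<rho> h = \<tau> h * B"
    proof (rule eq_matI)
      fix p q assume "p < dim_row (\<tau> h * B)" "q < dim_col (\<tau> h * B)"
      then have pq: "p < ?m" "q < ?n" using d h Bc by auto
      have "(B * \<rho> h) $$ (p, q) = (\<Sum>s<?n. \<rho> h $$ (s, q) * cmean (\<lambda>g. \<rho> g $$ (i, s) * cnj (\<tau> g $$ (a, p))))"
        using pq d h Bc by (subst index_mult_mat_sum) (auto simp: B_def mult.commute)
      also have "\<dots> = (\<Sum>s<?n. cmean (\<lambda>g. \<rho> h $$ (s, q) * (\<rho> g $$ (i, s) * cnj (\<tau> g $$ (a, p)))))"
        using cc pq by (intro sum.cong cmean_cmult[symmetric]) auto
      also have "\<dots> = cmean (\<lambda>g. \<Sum>s<?n. \<rho> h $$ (s, q) * (\<rho> g $$ (i, s) * cnj (\<tau> g $$ (a, p))))"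
        using cc pq by (intro cmean_sum[symmetric] ccont_cmult) auto
      \<comment> \<open>Writing \<open>g\<close> as \<open>g \<otimes> h \<otimes> inv h\<close> in
        the second factor prepares the substitution of \<open>g\<close> for
        \<open>g \<otimes> h\<close>, which moves \<open>h\<close> from \<rho> over to
        \<tau>.\<close>
      also have "\<dots> = cmean (\<lambda>g. \<rho> (g \<otimes> h) $$ (i, q) * cnj (\<tau> (g \<otimes> h \<otimes> inv h) $$ (a, p)))"
      proof (rule cmean_cong)
        fix g assume g: "g \<in> carrier G"
        have "\<rho> (g \<otimes> h) $$ (i, q) = (\<Sum>s<?n. \<rho> g $$ (i, s) * \<rho> h $$ (s, q))"
          unfolding unitary_rep_mult[OF u(1) g h] using pq i d g h by (subst index_mult_mat_sum) auto
        moreover have "g \<otimes> h \<otimes> inv h = g" using g h by (simp add: m_assoc)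
        ultimately show "(\<Sum>s<?n. \<rho> h $$ (s, q) * (\<rho> g $$ (i, s) * cnj (\<tau> g $$ (a, p)))) =
           \<rho> (g \<otimes> h) $$ (i, q) * cnj (\<tau> (g \<otimes> h \<otimes> inv h) $$ (a, p))"
          by (simp add: sum_distrib_left mult_ac)
      qed
      also have "\<dots> = cmean (\<lambda>g. \<rho> g $$ (i, q) * cnj (\<tau> (g \<otimes> inv h) $$ (a, p)))"
      proof -
        have "ccont (\<lambda>g. \<tau> (g \<otimes> inv h) $$ (a, p))"
          using continuous_map_right_translate[OF unitary_rep_continuous[OF u(2) a(1) pq(1)], of "inv h"] h by simp
        then have "ccont (\<lambda>g. \<rho> g $$ (i, q) * cnj (\<tau> (g \<otimes> inv h) $$ (a, p)))"
          using pq i by (intro continuous_map_complex_mult ccont_cnj unitary_rep_continuous[OF u(1)])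
        from cmean_right[OF this h] show ?thesis by simp
      qed
      also have "\<dots> = cmean (\<lambda>g. \<Sum>s<?m. \<tau> h $$ (p, s) * (\<rho> g $$ (i, q) * cnj (\<tau> g $$ (a, s))))"
      proof (rule cmean_cong)
        fix g assume g: "g \<in> carrier G"
        have "\<tau> (g \<otimes> inv h) $$ (a, p) = (\<Sum>s<?m. \<tau> g $$ (a, s) * \<tau> (inv h) $$ (s, p))"
          unfolding unitary_rep_mult[OF u(2) g inv_closed[OF h]]
          using pq a d g h by (subst index_mult_mat_sum) auto
        also have "\<dots> = (\<Sum>s<?m. \<tau> g $$ (a, s) * cnj (\<tau> h $$ (p, s)))"
          unfolding unitary_rep_adj[OF u(2) h, symmetric] using pq d h by (intro sum.cong) auto
        finally show "\<rho> g $$ (i, q) * cnj (\<tau> (g \<otimes> inv h) $$ (a, p)) =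
           (\<Sum>s<?m. \<tau> h $$ (p, s) * (\<rho> g $$ (i, q) * cnj (\<tau> g $$ (a, s))))"
          by (simp add: sum_distrib_left mult_ac)
      qed
      also have "\<dots> = (\<Sum>s<?m. cmean (\<lambda>g. \<tau> h $$ (p, s) * (\<rho> g $$ (i, q) * cnj (\<tau> g $$ (a, s)))))"
        using cc pq by (intro cmean_sum ccont_cmult) auto
      also have "\<dots> = (\<Sum>s<?m. \<tau> h $$ (p, s) * cmean (\<lambda>g. \<rho> g $$ (i, q) * cnj (\<tau> g $$ (a, s))))"
        using cc pq by (intro sum.cong cmean_cmult) auto
      also have "\<dots> = (\<tau> h * B) $$ (p, q)"
        using pq d h Bc by (subst index_mult_mat_sum) (auto simp: B_def)
      finally show "(B * \<rho> h) $$ (p, q) = (\<tau> h * B) $$ (p, q)" .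
    qed (use d h Bc in auto)
  qed
  then have "B = 0\<^sub>m ?m ?n" using nr \<rho> \<tau> by (auto simp: irrep_rel_iff)
  then have "B $$ (b, j) = 0" using i a by simp
  then show ?thesis using i a by (simp add: B_def)
qed

lemma char_orthogonality:
  assumes k: "k \<in> irreps" and l: "l \<in> irreps" and "k \<noteq> l"
  shows "cmean (\<lambda>g. char k g * cnj (char l g)) = 0"
proof -
  let ?\<rho> = "rep_of k" and ?\<tau> = "rep_of l"
  let ?n = "rep_dim G ?\<rho>" and ?m = "rep_dim G ?\<tau>"
  note u = rep_of_unitary[OF k] rep_of_unitary[OF l]
  have nr: "(?\<rho>, ?\<tau>) \<notin> irrep_rel G T"
    using iso_class_eqI iso_class_rep_of[OF k] iso_class_rep_of[OF l] \<open>k \<noteq> l\<close> by metis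
  have c: "ccont (\<lambda>g. ?\<rho> g $$ (i, i) * cnj (?\<tau> g $$ (a, a)))" if "i < ?n" "a < ?m" for i a
    using that by (intro continuous_map_complex_mult ccont_cnj unitary_rep_continuous[OF u(1)]
        unitary_rep_continuous[OF u(2)])
  have "cmean (\<lambda>g. char k g * cnj (char l g)) =
    cmean (\<lambda>g. \<Sum>i<?n. \<Sum>a<?m. ?\<rho> g $$ (i, i) * cnj (?\<tau> g $$ (a, a)))"
    using unitary_rep_dims[OF u(1)] unitary_rep_dims[OF u(2)]
    by (intro cmean_cong) (simp add: char_def mat_trace_def sum_product)
  also have "\<dots> = (\<Sum>i<?n. cmean (\<lambda>g. \<Sum>a<?m. ?\<rho> g $$ (i, i) * cnj (?\<tau> g $$ (a, a))))"
    using c by (intro cmean_sum continuous_map_sum) auto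
  also have "\<dots> = (\<Sum>i<?n. \<Sum>a<?m. cmean (\<lambda>g. ?\<rho> g $$ (i, i) * cnj (?\<tau> g $$ (a, a))))"
    using c by (intro sum.cong cmean_sum) auto
  also have "\<dots> = 0"
    using coefficient_orthogonality[OF rep_of_irreducible[OF k] rep_of_irreducible[OF l] nr]
    by (intro sum.neutral ballI) auto
  finally show ?thesis .
qed

end

section \<open>Characters of the fusion rules\<close>

context topological_group
begin

text \<open>These are the unitary characters of the chain group of the fusion rules: the group
  generated by the classes, with the relation that \<open>k\<close> is the product of
  \<open>i\<close> and \<open>j\<close> whenever \<open>k\<close> occurs in their tensor
  product.\<close>

definition fusion_character :: "('a rep set \<Rightarrow> complex) \<Rightarrow> bool" where
  "fusion_character \<omega> \<longleftrightarrow> (\<forall>k\<in>irreps. cmod (\<omega> k) = 1) \<and>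
     (\<forall>i\<in>irreps. \<forall>j\<in>irreps. \<forall>k\<in>irreps. multiplicity_coeff G i j k \<noteq> 0 \<longrightarrow> \<omega> k = \<omega> i * \<omega> j)"

text \<open>A relation rather than a map \<open>f \<mapsto> f'\<close>, so that the uniqueness of the expansion of \<open>f\<close> into
  irreducible characters is not needed.\<close>

inductive twist :: "('a rep set \<Rightarrow> complex) \<Rightarrow> ('a \<Rightarrow> complex) \<Rightarrow> ('a \<Rightarrow> complex) \<Rightarrow> bool"
  for \<omega> where
  twist_char: "k \<in> irreps \<Longrightarrow> twist \<omega> (char k) (\<lambda>g. \<omega> k * char k g)"
| twist_zero: "twist \<omega> (\<lambda>g. 0) (\<lambda>g. 0)"
| twist_add: "twist \<omega> f f' \<Longrightarrow> twist \<omega> h h' \<Longrightarrow> twist \<omega> (\<lambda>g. f g + h g) (\<lambda>g. f' g + h' g)"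

lemma twist_sum_list:
  assumes "\<And>k. k \<in> set ks \<Longrightarrow> k \<in> irreps \<and> \<omega> k = c"
  shows "twist \<omega> (\<lambda>g. \<Sum>k\<leftarrow>ks. char k g) (\<lambda>g. c * (\<Sum>k\<leftarrow>ks. char k g))"
  using assms
proof (induction ks)
  case Nil
  show ?case using twist_zero by simp
next
  case (Cons k ks)
  then show ?case using twist_add[OF twist_char[of k \<omega>], of "\<lambda>g. \<Sum>k\<leftarrow>ks. char k g"]
    by (simp add: distrib_left)
qed

text \<open>By bilinearity the claim reduces to two irreducible characters. All constituents of
  their product carry the same factor \<open>\<omega> i * \<omega> j\<close>, so the product is
  twisted by that factor as a whole.\<close>

lemma twist_mult:
  assumes \<omega>: "fusion_character \<omega>" and f: "twist \<omega> f f'" and h: "twist \<omega> h h'"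
  shows "twist \<omega> (\<lambda>g. f g * h g) (\<lambda>g. f' g * h' g)"
  using f
proof induction
  case (twist_char i)
  show ?case using h
  proof induction
    case (twist_char j)
    obtain ks where ks: "\<And>k. k \<in> set ks \<Longrightarrow> k \<in> irreps \<and> multiplicity_coeff G i j k \<noteq> 0"
      "\<And>g. char i g * char j g = (\<Sum>k\<leftarrow>ks. char k g)"
      using char_mult[OF \<open>i \<in> irreps\<close> \<open>j \<in> irreps\<close>] by metis
    have "twist \<omega> (\<lambda>g. \<Sum>k\<leftarrow>ks. char k g) (\<lambda>g. (\<omega> i * \<omega> j) * (\<Sum>k\<leftarrow>ks. char k g))"
      using ks(1) \<omega> \<open>i \<in> irreps\<close> \<open>j \<in> irreps\<close> by (intro twist_sum_list) (auto simp: fusion_character_def)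
    then show ?case unfolding ks(2)[symmetric] by (simp add: mult_ac)
  next
    case twist_zero
    show ?case using twist.twist_zero by simp
  next
    case (twist_add f1 f1' f2 f2')
    then show ?case using twist.twist_add[OF twist_add.IH] by (simp add: distrib_left)
  qed
next
  case twist_zero
  show ?case using twist.twist_zero by simp
next
  case (twist_add f1 f1' f2 f2')
  then show ?case using twist.twist_add[OF twist_add.IH] by (simp add: distrib_right)
qed

lemma twist_power:
  assumes "fusion_character \<omega>" "twist \<omega> f f'"
  shows "twist \<omega> (\<lambda>g. f g ^ Suc n) (\<lambda>g. f' g ^ Suc n)"
proof (induction n)
  case (Suc n)
  then show ?case using twist_mult[OF assms(1) assms(2) Suc] by simp
qed (use assms in simp)

lemma twist_sum:
  assumes "finite F" "F \<subseteq> irreps"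
  shows "twist \<omega> (\<lambda>g. \<Sum>k\<in>F. char k g) (\<lambda>g. \<Sum>k\<in>F. \<omega> k * char k g)"
  using assms
proof (induction F)
  case (insert k F)
  then show ?case using twist_add[OF twist_char[of k \<omega>] insert.IH] by simp
qed (simp add: twist_zero)

lemma twist_continuous:
  assumes "twist \<omega> f f'"
  shows "continuous_map T euclidean f \<and> continuous_map T euclidean f'"
  using assms
proof induction
  case (twist_char k)
  have "continuous_map T euclidean (\<lambda>g. \<omega> k * char k g)"
    by (rule continuous_map_complex_mult) (use char_continuous[OF twist_char] in auto)
  then show ?case using char_continuous[OF twist_char] by blast
qed (auto intro: continuous_map_add)

end

context compact_group
begin

text \<open>Twisting preserves the inner product, because distinct irreducible characters are orthogonal
  and \<open>\<omega>\<close> has modulus 1.\<close>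

lemma twist_inner:
  assumes \<omega>: "fusion_character \<omega>" and f: "twist \<omega> f f'" and h: "twist \<omega> h h'"
  shows "cmean (\<lambda>g. f g * cnj (h g)) = cmean (\<lambda>g. f' g * cnj (h' g))"
  using f
proof induction
  case (twist_char i)
  note i = twist_char
  show ?case using h
  proof induction
    case (twist_char j)
    note j = twist_char
    have c: "ccont (\<lambda>g. char i g * cnj (char j g))"
      by (intro continuous_map_complex_mult ccont_cnj char_continuous i j)
    have "cmean (\<lambda>g. \<omega> i * char i g * cnj (\<omega> j * char j g)) =
        (\<omega> i * cnj (\<omega> j)) * cmean (\<lambda>g. char i g * cnj (char j g))"
      using cmean_cmult[OF c, of "\<omega> i * cnj (\<omega> j)"] by (simp add: mult_ac)
    also have "\<dots> = cmean (\<lambda>g. char i g * cnj (char j g))"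
    proof (cases "i = j")
      case True
      have "\<omega> i * cnj (\<omega> i) = 1"
        using \<omega> i by (simp add: fusion_character_def flip: complex_norm_square)
      then show ?thesis using True by simp
    next
      case False
      then show ?thesis using char_orthogonality[OF i j] by simp
    qed
    finally show ?case by simp
  next
    case (twist_add f1 f1' f2 f2')
    have "ccont (\<lambda>g. char i g * cnj (q g))" "ccont (\<lambda>g. \<omega> i * char i g * cnj (q g))" if "ccont q" for q
      using that char_continuous[OF i] by (auto intro!: continuous_map_complex_mult ccont_cnj ccont_cmult)
    then show ?case using twist_add.IH twist_continuous[OF twist_add.hyps(1)] twist_continuous[OF twist_add.hyps(2)]
      by (simp add: distrib_left cmean_add)
  qed simp
next
  case (twist_add f1 f1' f2 f2')
  have "ccont (\<lambda>g. q g * cnj (h g))" "ccont (\<lambda>g. q g * cnj (h' g))" if "ccont q" for q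
    using that twist_continuous[OF h] by (auto intro!: continuous_map_complex_mult ccont_cnj)
  then show ?case using twist_add.IH twist_continuous[OF twist_add.hyps(1)] twist_continuous[OF twist_add.hyps(2)]
    by (simp add: distrib_right cmean_add)
qed simp

text \<open>The power \<open>f ^ Suc n\<close> is twisted into \<open>f' ^ Suc n\<close>, and the
  moment is the squared norm of this power.\<close>

lemma twist_mean_power:
  assumes \<omega>: "fusion_character \<omega>" and f: "twist \<omega> f f'"
  shows "mean (\<lambda>g. ((cmod (f g))\<^sup>2) ^ Suc n) = mean (\<lambda>g. ((cmod (f' g))\<^sup>2) ^ Suc n)"
proof -
  have "complex_of_real (mean (\<lambda>g. (cmod (f g ^ Suc n))\<^sup>2)) = complex_of_real (mean (\<lambda>g. (cmod (f' g ^ Suc n))\<^sup>2))"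
    using twist_inner[OF \<omega> twist_power[OF \<omega> f, of n] twist_power[OF \<omega> f, of n]] unfolding cmean_norm .
  then show ?thesis by (simp add: norm_power power_mult[symmetric] norm_mult power_mult_distrib mult.commute)
qed

text \<open>The moments of \<open>|f|\<close> and \<open>|f'|\<close> with respect to the Haar mean agree, hence so do the suprema.\<close>

lemma twist_attains:
  assumes \<omega>: "fusion_character \<omega>" and f: "twist \<omega> f f'"
  shows "\<exists>g\<in>carrier G. cmod (f \<one>) \<le> cmod (f' g)"
proof (rule ccontr)
  assume "\<not> ?thesis"
  then have less: "cmod (f' g) < cmod (f \<one>)" if "g \<in> carrier G" for g using that by force
  define v where "v = (\<lambda>g. (cmod (f g))\<^sup>2)"
  define v' where "v' = (\<lambda>g. (cmod (f' g))\<^sup>2)"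
  have v: "cont v" "cont v'" unfolding v_def v'_def using twist_continuous[OF f]
    by (auto intro!: continuous_map_real_pow cont_cmod)
  have "compact (v' ` carrier G)"
    using image_compactin[OF _ v(2)] compact by (simp add: compact_space_def topspace_eq)
  then obtain m where m: "m \<in> v' ` carrier G" "\<And>y. y \<in> v' ` carrier G \<Longrightarrow> y \<le> m"
    using compact_attains_sup[of "v' ` carrier G"] by auto
  have m0: "0 \<le> m" using m(1) by (auto simp: v'_def)
  have mn: "m < v \<one>" using m(1) less by (auto simp: v_def v'_def intro!: power_strict_mono)
  \<comment> \<open>A level strictly between the maximum \<open>m\<close> of \<open>v'\<close> and
    the value \<open>v \<one>\<close>. On a neighborhood of \<open>\<one>\<close> the function
    \<open>v / r\<close> exceeds 1, so its moments stay above a fixed \<open>d\<close>; those of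
    \<open>v' / r\<close> are at most the powers of \<open>m / r < 1\<close>.\<close>
  define r where "r = (m + v \<one>) / 2"
  have r: "m < r" "r < v \<one>" "0 < r" using mn m0 by (auto simp: r_def)
  define U where "U = {g \<in> topspace T. v g \<in> {r <..}}"
  have "openin T U" unfolding U_def by (rule openin_continuous_map_preimage[OF v(1)]) auto
  moreover have "\<one> \<in> U" using r by (simp add: U_def topspace_eq)
  ultimately obtain d where d: "d > 0" "\<And>h. cont h \<Longrightarrow> (\<And>x. x \<in> carrier G \<Longrightarrow> 0 \<le> h x) \<Longrightarrow>
      (\<And>x. x \<in> U \<Longrightarrow> 1 \<le> h x) \<Longrightarrow> d * 1 \<le> mean h"
    using mean_lower_bound[of U \<one> 1] by blast
  have bound: "d \<le> (m / r) ^ Suc n" for n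
  proof -
    have cv: "cont (\<lambda>g. v g ^ Suc n)" "cont (\<lambda>g. v' g ^ Suc n)"
      by (rule continuous_map_real_pow[OF v(1)], rule continuous_map_real_pow[OF v(2)])
    have sc: "mean (\<lambda>g. inverse (r ^ Suc n) * q g ^ Suc n) = inverse (r ^ Suc n) * mean (\<lambda>g. q g ^ Suc n)"
      if "cont (\<lambda>g. q g ^ Suc n)" for q by (rule mean_cmult[OF that])
    have "d * 1 \<le> mean (\<lambda>g. inverse (r ^ Suc n) * v g ^ Suc n)"
    proof (rule d(2))
      show "cont (\<lambda>g. inverse (r ^ Suc n) * v g ^ Suc n)" by (rule cont_cmult[OF cv(1)])
      show "0 \<le> inverse (r ^ Suc n) * v x ^ Suc n" if "x \<in> carrier G" for x
        using r by (simp add: v_def)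
      show "1 \<le> inverse (r ^ Suc n) * v x ^ Suc n" if "x \<in> U" for x
      proof -
        have "r ^ Suc n \<le> v x ^ Suc n" using that r by (intro power_mono) (auto simp: U_def)
        then show ?thesis using r by (simp add: field_simps del: power_Suc)
      qed
    qed
    also have "\<dots> = mean (\<lambda>g. inverse (r ^ Suc n) * v' g ^ Suc n)"
      unfolding sc[OF cv(1)] sc[OF cv(2)] using twist_mean_power[OF \<omega> f, of n] by (simp only: v_def v'_def)
    also have "\<dots> \<le> (m / r) ^ Suc n"
    proof (rule mean_le_const[OF cont_cmult[OF cv(2)]])
      fix x assume "x \<in> carrier G"
      then have "v' x ^ Suc n \<le> m ^ Suc n" using m(2) by (intro power_mono) (auto simp: v'_def)
      then show "inverse (r ^ Suc n) * v' x ^ Suc n \<le> (m / r) ^ Suc n"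
        using r by (simp add: power_divide field_simps del: power_Suc)
    qed
    finally show ?thesis by simp
  qed
  have mr: "m / r < 1" "0 \<le> m / r" using r m0 by auto
  obtain n where n: "(m / r) ^ n < d" using real_arch_pow_inv[OF d(1) mr(1)] by blast
  have "(m / r) ^ Suc n \<le> (m / r) ^ n" using mr by (intro power_decreasing) auto
  with n bound[of n] show False by linarith
qed

end

text \<open>The equality case of the triangle inequality. Equality alone determines the summands up
  to a common phase, and the summand \<open>z t = 1\<close> fixes that phase.\<close>

lemma sum_norm_extremal:
  fixes z :: "'c \<Rightarrow> complex" and n :: "'c \<Rightarrow> real"
  assumes F: "finite F" and t: "t \<in> F" "z t = 1" "n t = 1"
    and le: "\<And>k. k \<in> F \<Longrightarrow> cmod (z k) \<le> n k" and ge: "(\<Sum>k\<in>F. n k) \<le> cmod (\<Sum>k\<in>F. z k)" and k: "k \<in> F"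
  shows "z k = complex_of_real (n k)"
proof (cases "k = t")
  case True
  then show ?thesis using t by simp
next
  case False
  \<comment> \<open>The summands other than those at \<open>t\<close> and \<open>k\<close> are
    estimated by \<open>n\<close> and cancel, leaving \<open>1 + n k \<le> cmod (1 + z k)\<close>;
    squaring then isolates the real part of \<open>z k\<close>.\<close>
  define R where "R = F - {t} - {k}"
  have split: "(\<Sum>x\<in>F. q x) = q t + (q k + (\<Sum>x\<in>R. q x))" for q :: "'c \<Rightarrow> 'd :: comm_monoid_add"
    using F t(1) k False by (simp add: R_def sum.remove[of F t] sum.remove[of "F - {t}" k])
  have "1 + (n k + (\<Sum>x\<in>R. n x)) \<le> cmod ((1 + z k) + (\<Sum>x\<in>R. z x))"
    using ge t unfolding split by (simp add: add.assoc)
  also have "\<dots> \<le> cmod (1 + z k) + (\<Sum>x\<in>R. n x)"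
    using le by (intro order.trans[OF norm_triangle_ineq] add_left_mono order.trans[OF norm_sum] sum_mono)
      (auto simp: R_def)
  finally have 1: "1 + n k \<le> cmod (1 + z k)" by simp
  have nz: "cmod (z k) \<le> n k" using le k by simp
  have n0: "0 \<le> n k" using nz norm_ge_zero order.trans by blast
  have "(1 + n k)\<^sup>2 \<le> (cmod (1 + z k))\<^sup>2" using 1 n0 by (intro power_mono) auto
  also have "(cmod (1 + z k))\<^sup>2 = 1 + 2 * Re (z k) + (cmod (z k))\<^sup>2"
    unfolding cmod_power2 by (simp add: power2_eq_square algebra_simps)
  finally have "1 + 2 * n k + (n k)\<^sup>2 \<le> 1 + 2 * Re (z k) + (cmod (z k))\<^sup>2"
    by (simp add: power2_eq_square algebra_simps)
  moreover have "(cmod (z k))\<^sup>2 \<le> (n k)\<^sup>2" using nz by (intro power_mono) auto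
  ultimately have re: "n k \<le> Re (z k)" by linarith
  then have "Re (z k) = cmod (z k)" "cmod (z k) = n k" using nz complex_Re_le_cmod[of "z k"] by linarith+
  have "(Re (z k))\<^sup>2 + (Im (z k))\<^sup>2 = (Re (z k))\<^sup>2"
    using \<open>Re (z k) = cmod (z k)\<close> cmod_power2[of "z k"] by simp
  then have "Im (z k) = 0" by simp
  then show ?thesis using \<open>Re (z k) = cmod (z k)\<close> \<open>cmod (z k) = n k\<close> by (simp add: complex_eq_iff)
qed

section \<open>The center and the characters of the fusion rules\<close>

text \<open>The left side is the squared Frobenius distance from \<open>U\<close> to the scalar
  matrix with entry \<open>cnj c\<close>. It is expanded with the squared norm of each of the two
  unitary matrices equal to \<open>n\<close>.\<close>

lemma unitary_scalar_distance:
  assumes U: "U \<in> carrier_mat n n" and UU: "adj U * U = 1\<^sub>m n" and c: "cmod c = 1"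
  shows "(\<Sum>i<n. \<Sum>j<n. (cmod (U $$ (i, j) - (if i = j then cnj c else 0)))\<^sup>2) =
    2 * real n - 2 * Re (c * mat_trace U)"
proof -
  define q where "q = (\<Sum>j<n. \<Sum>i<n. (cmod (U $$ (i, j)))\<^sup>2)"
  have "complex_of_real q = of_nat n"
    using mat_trace_adj_mult[OF U] unfolding UU q_def by (simp add: mat_trace_one)
  then have s: "q = real n" using of_real_eq_iff[of q "real n", where 'a=complex] by simp
  have e: "(cmod (U $$ (i, j) - (if i = j then cnj c else 0)))\<^sup>2 =
     (cmod (U $$ (i, j)))\<^sup>2 + (if i = j then 1 - 2 * Re (c * U $$ (i, j)) else 0)" for i j
  proof (cases "i = j")
    case True
    have "(cmod (u - cnj c))\<^sup>2 = (cmod u)\<^sup>2 + (cmod c)\<^sup>2 - 2 * Re (c * u)" for u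
      unfolding cmod_power2 by (simp add: power2_eq_square algebra_simps)
    then show ?thesis using True c by simp
  qed simp
  have "(\<Sum>i<n. \<Sum>j<n. (cmod (U $$ (i, j) - (if i = j then cnj c else 0)))\<^sup>2) =
     (\<Sum>i<n. \<Sum>j<n. (cmod (U $$ (i, j)))\<^sup>2) + (\<Sum>i<n. 1 - 2 * Re (c * U $$ (i, i)))"
    unfolding e by (simp add: sum.distrib)
  also have "(\<Sum>i<n. \<Sum>j<n. (cmod (U $$ (i, j)))\<^sup>2) = q" unfolding q_def by (rule sum.swap)
  also note s
  also have "(\<Sum>i<n. 1 - 2 * Re (c * U $$ (i, i))) = real n - 2 * Re (c * mat_trace U)"
    using U by (simp add: mat_trace_def sum_subtractf sum_distrib_left Re_sum)
  finally show ?thesis by simp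
qed

text \<open>Choose \<open>c\<close> to rotate the trace onto the positive axis; the squared distance
  above is nonnegative.\<close>

lemma unitary_trace_bound:
  assumes U: "U \<in> carrier_mat n n" and UU: "adj U * U = 1\<^sub>m n"
  shows "cmod (mat_trace U) \<le> real n"
proof (cases "mat_trace U = 0")
  case False
  define c where "c = cnj (mat_trace U) / cmod (mat_trace U)"
  have c: "cmod c = 1" using False by (simp add: c_def norm_divide)
  have "c * mat_trace U = complex_of_real ((cmod (mat_trace U))\<^sup>2) / cmod (mat_trace U)"
    unfolding complex_norm_square by (simp add: c_def)
  also have "\<dots> = complex_of_real (cmod (mat_trace U))" using False by (simp add: power2_eq_square)
  finally have "Re (c * mat_trace U) = cmod (mat_trace U)" by simp
  moreover have "0 \<le> 2 * real n - 2 * Re (c * mat_trace U)"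
    unfolding unitary_scalar_distance[OF U UU c, symmetric] by (intro sum_nonneg) auto
  ultimately show ?thesis by simp
qed simp

text \<open>Extremal trace means distance zero from the scalar matrix.\<close>

lemma unitary_trace_extremal:
  assumes U: "U \<in> carrier_mat n n" and UU: "adj U * U = 1\<^sub>m n" and c: "cmod c = 1"
    and eq: "c * mat_trace U = of_nat n"
  shows "U = cnj c \<cdot>\<^sub>m 1\<^sub>m n"
proof -
  have "(\<Sum>i<n. \<Sum>j<n. (cmod (U $$ (i, j) - (if i = j then cnj c else 0)))\<^sup>2) = 0"
    unfolding unitary_scalar_distance[OF U UU c] eq by simp
  then have "(\<Sum>j<n. (cmod (U $$ (i, j) - (if i = j then cnj c else 0)))\<^sup>2) = 0" if "i < n" for i
    using that by (subst (asm) sum_nonneg_eq_0_iff) (auto intro: sum_nonneg)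
  then have "(cmod (U $$ (i, j) - (if i = j then cnj c else 0)))\<^sup>2 = 0" if "i < n" "j < n" for i j
    using that by (subst (asm) sum_nonneg_eq_0_iff) auto
  then have "U $$ (i, j) = (if i = j then cnj c else 0)" if "i < n" "j < n" for i j using that by simp
  then show ?thesis using U by (intro eq_matI) auto
qed

lemma smult_one_mult:
  assumes "A \<in> carrier_mat n m"
  shows "(c \<cdot>\<^sub>m 1\<^sub>m n) * A = c \<cdot>\<^sub>m (A :: complex mat)" "A * (c \<cdot>\<^sub>m 1\<^sub>m m) = c \<cdot>\<^sub>m A"
  using mult_smult_assoc_mat[OF one_carrier_mat assms] mult_smult_distrib[OF assms one_carrier_mat] assms by simp_all

lemma smult_smult_mat: "a \<cdot>\<^sub>m (b \<cdot>\<^sub>m A) = (a * b) \<cdot>\<^sub>m (A :: complex mat)"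
  by (rule eq_matI) auto

lemma kronecker_smult_one: "kronecker (a \<cdot>\<^sub>m 1\<^sub>m n) (b \<cdot>\<^sub>m 1\<^sub>m m) = (a * b) \<cdot>\<^sub>m 1\<^sub>m (n * m)"
proof (rule eq_matI)
  fix i j assume "i < dim_row ((a * b) \<cdot>\<^sub>m 1\<^sub>m (n * m))" "j < dim_col ((a * b) \<cdot>\<^sub>m 1\<^sub>m (n * m))"
  then have i: "i < n * m" and j: "j < n * m" by auto
  have "i div m = j div m \<and> i mod m = j mod m \<longleftrightarrow> i = j" by (metis div_mult_mod_eq)
  then show "kronecker (a \<cdot>\<^sub>m 1\<^sub>m n) (b \<cdot>\<^sub>m 1\<^sub>m m) $$ (i, j) = ((a * b) \<cdot>\<^sub>m 1\<^sub>m (n * m)) $$ (i, j)"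
    using i j div_mod_less[OF i] div_mod_less[OF j] by (auto simp: kronecker_index)
qed auto

lemma smult_one_inject:
  assumes "c \<cdot>\<^sub>m 1\<^sub>m n = d \<cdot>\<^sub>m (1\<^sub>m n :: complex mat)" "n \<noteq> 0"
  shows "c = d"
  using arg_cong[OF assms(1), of "\<lambda>M. M $$ (0, 0)"] assms(2) by simp

context topological_group
begin

text \<open>For central \<open>z\<close>, the scalar by which \<open>z\<close> acts in class \<open>k\<close>.\<close>

definition central_value :: "'a \<Rightarrow> 'a rep set \<Rightarrow> complex" where
  "central_value z k = rep_of k z $$ (0, 0)"

lemma rep_of_dim_pos: "k \<in> irreps \<Longrightarrow> rep_dim G (rep_of k) \<noteq> 0"
  using rep_of_irreducible[of k] by (simp add: irreducible_rep_def)

lemma group_center_carrier: "z \<in> group_center G \<Longrightarrow> z \<in> carrier G"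
  by (simp add: group_center_def)

lemma central_value:
  assumes z: "z \<in> group_center G" and k: "k \<in> irreps"
  shows "rep_of k z = central_value z k \<cdot>\<^sub>m 1\<^sub>m (rep_dim G (rep_of k))"
proof -
  note u = rep_of_unitary[OF k] and zG = group_center_carrier[OF z]
  have "rep_of k z \<in> rep_Hom G (rep_of k) (rep_of k)"
  proof (rule rep_HomI[OF unitary_rep_carrier[OF u zG]])
    fix g assume g: "g \<in> carrier G"
    then have "z \<otimes> g = g \<otimes> z" using z by (simp add: group_center_def)
    then show "rep_of k z * rep_of k g = rep_of k g * rep_of k z"
      using unitary_rep_mult[OF u] zG g by metis
  qed
  from schur_scalar[OF rep_of_irreducible[OF k] this] obtain c
    where c: "rep_of k z = c \<cdot>\<^sub>m 1\<^sub>m (rep_dim G (rep_of k))" by metis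
  then have "central_value z k = c" using rep_of_dim_pos[OF k] by (simp add: central_value_def)
  with c show ?thesis by simp
qed

lemma central_value_eqI:
  assumes "k \<in> irreps" "rep_of k z = c \<cdot>\<^sub>m 1\<^sub>m (rep_dim G (rep_of k))"
  shows "central_value z k = c"
  using assms rep_of_dim_pos[OF assms(1)] by (simp add: central_value_def)

text \<open>Unitarity of the scalar matrix gives modulus 1. A nonzero intertwiner from
  \<open>k\<close> into the tensor product of \<open>i\<close> and \<open>j\<close> is multiplied by
  the scalar of \<open>k\<close> on one side and by the product of the other two scalars on the
  other side; a nonzero entry compares them.\<close>

lemma fusion_character_central_value:
  assumes z: "z \<in> group_center G"
  shows "fusion_character (central_value z)"
  unfolding fusion_character_def
proof (intro conjI ballI impI)
  fix k assume k: "k \<in> irreps"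
  let ?n = "rep_dim G (rep_of k)" and ?c = "central_value z k"
  have "adj (?c \<cdot>\<^sub>m 1\<^sub>m ?n) = cnj ?c \<cdot>\<^sub>m 1\<^sub>m ?n" by (rule eq_matI) auto
  moreover have "(1 :: complex) \<cdot>\<^sub>m 1\<^sub>m ?n = 1\<^sub>m ?n" by (rule eq_matI) auto
  ultimately have "(cnj ?c * ?c) \<cdot>\<^sub>m 1\<^sub>m ?n = (1 :: complex) \<cdot>\<^sub>m 1\<^sub>m ?n"
    using unitary_rep_unitary[OF rep_of_unitary[OF k] group_center_carrier[OF z]]
      smult_one_mult(1)[of "?c \<cdot>\<^sub>m 1\<^sub>m ?n" ?n ?n "cnj ?c"]
    unfolding central_value[OF z k] by (simp add: smult_smult_mat)
  from smult_one_inject[OF this rep_of_dim_pos[OF k]] have "(cmod ?c)\<^sup>2 = 1"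
    by (metis complex_norm_square mult.commute of_real_1 of_real_eq_iff)
  then show "cmod ?c = 1" by (simp add: power2_eq_1_iff) (smt (verit) norm_ge_zero)
next
  fix i j k assume ijk: "i \<in> irreps" "j \<in> irreps" "k \<in> irreps" and N: "multiplicity_coeff G i j k \<noteq> 0"
  let ?m = "rep_dim G (rep_of i) * rep_dim G (rep_of j)" and ?n = "rep_dim G (rep_of k)"
  obtain A where A: "A \<in> rep_Hom G (rep_of k) (tensor_rep (rep_of i) (rep_of j))" "A \<noteq> 0\<^sub>m ?m ?n"
    using N multiplicity_nonzero_iff[OF ijk] by blast
  have Ac: "A \<in> carrier_mat ?m ?n"
    using rep_Hom_carrier[OF A(1)] tensor_unitary(2)[OF ijk(1,2)[THEN rep_of_unitary]] by simp
  have "A * rep_of k z = tensor_rep (rep_of i) (rep_of j) z * A"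
    by (rule rep_Hom_commute[OF A(1) group_center_carrier[OF z]])
  then have eq: "central_value z k \<cdot>\<^sub>m A = (central_value z i * central_value z j) \<cdot>\<^sub>m A"
    unfolding tensor_rep_def central_value[OF z ijk(1)] central_value[OF z ijk(2)]
      central_value[OF z ijk(3)] kronecker_smult_one smult_one_mult[OF Ac] .
  have "\<exists>p<?m. \<exists>q<?n. A $$ (p, q) \<noteq> 0"
  proof (rule ccontr)
    assume "\<not> ?thesis"
    then have "A = 0\<^sub>m ?m ?n" using Ac by (intro eq_matI) auto
    with A(2) show False by simp
  qed
  then obtain p q where pq: "p < ?m" "q < ?n" "A $$ (p, q) \<noteq> 0" by blast
  show "central_value z k = central_value z i * central_value z j"
    using arg_cong[OF eq, of "\<lambda>M. M $$ (p, q)"] pq Ac by simp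
qed

lemma central_value_mult:
  assumes "z \<in> group_center G" "w \<in> group_center G" "k \<in> irreps"
  shows "central_value (z \<otimes> w) k = central_value z k * central_value w k"
proof (rule central_value_eqI[OF assms(3)])
  let ?n = "rep_dim G (rep_of k)"
  have "rep_of k (z \<otimes> w) = (central_value z k \<cdot>\<^sub>m 1\<^sub>m ?n) * (central_value w k \<cdot>\<^sub>m 1\<^sub>m ?n)"
    using unitary_rep_mult[OF rep_of_unitary[OF assms(3)] assms(1,2)[THEN group_center_carrier]]
    unfolding central_value[OF assms(1,3)] central_value[OF assms(2,3)] .
  then show "rep_of k (z \<otimes> w) = (central_value z k * central_value w k) \<cdot>\<^sub>m 1\<^sub>m ?n"
    using smult_one_mult(1)[of "central_value w k \<cdot>\<^sub>m 1\<^sub>m ?n" ?n ?n] by (simp add: smult_smult_mat)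
qed

lemma central_value_continuous:
  assumes "k \<in> irreps"
  shows "continuous_map T euclidean (\<lambda>z. central_value z k)"
  unfolding central_value_def
  by (rule unitary_rep_continuous[OF rep_of_unitary[OF assms]]) (use rep_of_dim_pos[OF assms] in simp_all)

lemma group_center_mult:
  assumes "z \<in> group_center G" "w \<in> group_center G"
  shows "z \<otimes> w \<in> group_center G"
proof -
  note zw = assms[THEN group_center_carrier]
  have "(z \<otimes> w) \<otimes> x = x \<otimes> (z \<otimes> w)" if x: "x \<in> carrier G" for x
  proof -
    have c: "w \<otimes> x = x \<otimes> w" "z \<otimes> x = x \<otimes> z" using assms x by (auto simp: group_center_def)
    have "(z \<otimes> w) \<otimes> x = z \<otimes> (w \<otimes> x)" using zw x by (simp add: m_assoc)
    also have "\<dots> = (z \<otimes> x) \<otimes> w" unfolding c(1) using zw x by (simp add: m_assoc)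
    also have "\<dots> = x \<otimes> (z \<otimes> w)" unfolding c(2) using zw x by (simp add: m_assoc)
    finally show ?thesis .
  qed
  then show ?thesis unfolding group_center_def using zw by blast
qed

end

section \<open>Realizing fusion characters by central elements\<close>

context compact_group
begin

text \<open>Some unitary representation is nontrivial at any \<open>x\<close> other than
  \<open>\<one>\<close>. In a decomposition of it, each \<open>adj C\<close> would annihilate
  \<open>\<rho> x - 1\<close>, which would then vanish.\<close>

lemma irreps_separate_one:
  assumes x: "x \<in> carrier G" and triv: "\<And>k. k \<in> irreps \<Longrightarrow> rep_of k x = 1\<^sub>m (rep_dim G (rep_of k))"
  shows "x = \<one>"
proof (rule ccontr)
  assume "x \<noteq> \<one>"
  then obtain \<rho> where \<rho>: "unitary_rep G T \<rho>" "\<rho> x \<noteq> 1\<^sub>m (rep_dim G \<rho>)"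
    using unitary_reps_separate_one[OF x] by blast
  let ?n = "rep_dim G \<rho>"
  obtain L where L: "decomposition \<rho> L" using irreducible_decomposition[OF \<rho>(1)] by blast
  note rc = unitary_rep_carrier[OF \<rho>(1) x]
  define X where "X = \<rho> x - 1\<^sub>m ?n"
  have Xc: "X \<in> carrier_mat ?n ?n" using rc by (auto simp: X_def)
  have "adj C * X = 0\<^sub>m (rep_dim G \<sigma>) ?n" if C: "(\<sigma>, C) \<in> set L" for \<sigma> C
  proof -
    have \<sigma>: "irreducible_rep G T \<sigma>" "C \<in> rep_Hom G \<sigma> \<rho>" using L C unfolding decomposition_def by blast+
    have "\<sigma> x = 1\<^sub>m (rep_dim G \<sigma>)"
      by (rule irrep_rel_one[OF rep_of_iso_class[OF \<sigma>(1)] x]) (rule triv[OF iso_class_in_irreps[OF \<sigma>(1)]])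
    moreover have "adj C * \<rho> x = \<sigma> x * adj C"
      by (rule rep_Hom_commute[OF rep_Hom_adj[OF irreducible_rep_unitary[OF \<sigma>(1)] \<rho>(1) \<sigma>(2)] x])
    ultimately have e: "adj C * \<rho> x = adj C" using rep_Hom_dims[OF \<sigma>(2)] by (simp add: mat_dim_simps)
    have Cc: "adj C \<in> carrier_mat (rep_dim G \<sigma>) ?n" using rep_Hom_carrier[OF \<sigma>(2)] by simp
    have "adj C * X = adj C * \<rho> x - adj C * 1\<^sub>m ?n"
      unfolding X_def using Cc rc by (intro mult_minus_distrib_mat) auto
    also have "\<dots> = 0\<^sub>m (rep_dim G \<sigma>) ?n" unfolding e right_mult_one_mat[OF Cc] using Cc by (intro eq_matI) auto
    finally show ?thesis .
  qed
  then have X0: "X = 0\<^sub>m ?n ?n" using L Xc unfolding decomposition_def by blast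
  have "\<rho> x = 1\<^sub>m ?n"
  proof (rule eq_matI)
    fix i j assume ij: "i < dim_row (1\<^sub>m ?n :: complex mat)" "j < dim_col (1\<^sub>m ?n :: complex mat)"
    have "X $$ (i, j) = \<rho> x $$ (i, j) - 1\<^sub>m ?n $$ (i, j)" unfolding X_def using ij rc by (intro index_minus_mat) auto
    then show "\<rho> x $$ (i, j) = 1\<^sub>m ?n $$ (i, j)" using X0 ij by simp
  qed (use rc in auto)
  with \<rho>(2) show False by simp
qed

lemma irreps_separate:
  assumes x: "x \<in> carrier G" and y: "y \<in> carrier G" and eq: "\<And>k. k \<in> irreps \<Longrightarrow> rep_of k x = rep_of k y"
  shows "x = y"
proof -
  have "x \<otimes> inv y = \<one>"
  proof (rule irreps_separate_one)
    show "x \<otimes> inv y \<in> carrier G" using x y by simp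
    fix k assume k: "k \<in> irreps"
    note u = rep_of_unitary[OF k]
    have "rep_of k (x \<otimes> inv y) = rep_of k y * rep_of k (inv y)"
      using unitary_rep_mult[OF u x, of "inv y"] y eq[OF k] by simp
    also have "\<dots> = rep_of k (y \<otimes> inv y)" using unitary_rep_mult[OF u y, of "inv y"] y by simp
    finally show "rep_of k (x \<otimes> inv y) = 1\<^sub>m (rep_dim G (rep_of k))" using y unitary_rep_one[OF u] by simp
  qed
  then show ?thesis using x y by (metis inv_closed inv_inv inv_equality)
qed

lemma central_value_inject:
  assumes "z \<in> group_center G" "w \<in> group_center G" "\<And>k. k \<in> irreps \<Longrightarrow> central_value z k = central_value w k"
  shows "z = w"
  using irreps_separate[OF assms(1,2)[THEN group_center_carrier]] central_value[OF assms(1)]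
    central_value[OF assms(2)] assms(3) by simp

lemma char_bound: "k \<in> irreps \<Longrightarrow> g \<in> carrier G \<Longrightarrow> cmod (char k g) \<le> rep_dim G (rep_of k)"
  using unitary_trace_bound[OF unitary_rep_carrier[OF rep_of_unitary] unitary_rep_unitary[OF rep_of_unitary]]
  by (simp add: char_def)

text \<open>The trivial class occurs in its own tensor square, so the value of \<omega> there is
  idempotent, and its modulus is 1.\<close>

lemma fusion_character_trivial:
  assumes "fusion_character \<omega>"
  shows "\<omega> trivial_class = 1"
proof -
  note t = trivial_class and d = rep_of_trivial_class(1)
  let ?\<tau> = "tensor_rep (rep_of trivial_class) (rep_of trivial_class)"
  have "1\<^sub>m 1 \<in> rep_Hom G (rep_of trivial_class) ?\<tau>"
  proof (rule rep_HomI)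
    show "1\<^sub>m 1 \<in> carrier_mat (rep_dim G ?\<tau>) (rep_dim G (rep_of trivial_class))"
      using tensor_unitary(2)[OF t[THEN rep_of_unitary] t[THEN rep_of_unitary]] d by simp
    fix g assume "g \<in> carrier G"
    then show "1\<^sub>m 1 * rep_of trivial_class g = ?\<tau> g * 1\<^sub>m 1"
      using kronecker_one[of 1 1] by (simp add: tensor_rep_def rep_of_trivial_class(2))
  qed
  moreover have "1\<^sub>m 1 \<noteq> (0\<^sub>m 1 1 :: complex mat)"
  proof
    assume "1\<^sub>m 1 = (0\<^sub>m 1 1 :: complex mat)"
    from arg_cong[OF this, of "\<lambda>M. M $$ (0, 0)"] show False by simp
  qed
  ultimately have "multiplicity_coeff G trivial_class trivial_class trivial_class \<noteq> 0"
    unfolding multiplicity_nonzero_iff[OF t t t] d by auto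
  then have "\<omega> trivial_class = \<omega> trivial_class * \<omega> trivial_class"
    using assms t unfolding fusion_character_def by blast
  moreover have "\<omega> trivial_class \<noteq> 0" using assms t unfolding fusion_character_def by force
  ultimately show ?thesis by simp
qed

text \<open>The twisted sum of characters reaches in modulus the sum of the dimensions, and each
  summand is bounded by its dimension; adjoining the trivial class provides the summand 1 that
  excludes a common phase.\<close>

lemma fusion_character_realize_finite:
  assumes \<omega>: "fusion_character \<omega>" and F: "finite F" "F \<subseteq> irreps"
  shows "\<exists>g\<in>carrier G. \<forall>k\<in>F. \<omega> k * char k g = of_nat (rep_dim G (rep_of k))"
proof -
  define E where "E = insert trivial_class F"
  have E: "finite E" "E \<subseteq> irreps" "trivial_class \<in> E" using F trivial_class by (auto simp: E_def)
  obtain g where g: "g \<in> carrier G" "cmod (\<Sum>k\<in>E. char k \<one>) \<le> cmod (\<Sum>k\<in>E. \<omega> k * char k g)"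
    using twist_attains[OF \<omega> twist_sum[OF E(1,2)]] by blast
  have "(\<Sum>k\<in>E. char k \<one>) = complex_of_real (\<Sum>k\<in>E. real (rep_dim G (rep_of k)))"
    unfolding of_real_sum using E(2) by (intro sum.cong) (auto simp: char_one)
  then have ge: "(\<Sum>k\<in>E. real (rep_dim G (rep_of k))) \<le> cmod (\<Sum>k\<in>E. \<omega> k * char k g)"
    using g(2) by (simp add: sum_nonneg del: of_real_sum)
  have "\<omega> k * char k g = complex_of_real (real (rep_dim G (rep_of k)))" if "k \<in> F" for k
  proof (rule sum_norm_extremal[OF E(1,3) _ _ _ ge])
    show "\<omega> trivial_class * char trivial_class g = 1"
      using fusion_character_trivial[OF \<omega>] g by (simp add: char_trivial)
    show "real (rep_dim G (rep_of trivial_class)) = 1" by (simp add: rep_of_trivial_class)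
    show "cmod (\<omega> k * char k g) \<le> real (rep_dim G (rep_of k))" if "k \<in> E" for k
      using that E(2) \<omega> char_bound[OF _ g(1)] by (auto simp: norm_mult fusion_character_def)
    show "k \<in> E" using that by (simp add: E_def)
  qed
  then show ?thesis using g(1) by (intro bexI[of _ g]) auto
qed

lemma fusion_character_realize:
  assumes \<omega>: "fusion_character \<omega>"
  obtains z where "z \<in> group_center G" "\<And>k. k \<in> irreps \<Longrightarrow> central_value z k = \<omega> k"
proof -
  \<comment> \<open>A point with \<open>\<omega> k * char k g\<close> equal to the dimension acts in
    class \<open>k\<close> by the conjugate of \<open>\<omega> k\<close>; starting from the
    conjugate makes the limit point act by \<omega> itself.\<close>
  have \<omega>': "fusion_character (\<lambda>k. cnj (\<omega> k))" using \<omega> unfolding fusion_character_def by auto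
  define C where "C = (\<lambda>k. {g \<in> topspace T. cnj (\<omega> k) * char k g \<in> {of_nat (rep_dim G (rep_of k))}})"
  have "\<Inter> (C ` irreps) \<noteq> {}"
  proof (rule compact[unfolded compact_space_fip, rule_format], intro conjI ballI allI impI)
    fix D assume "D \<in> C ` irreps"
    then obtain k where k: "k \<in> irreps" "D = C k" by blast
    show "closedin T D" unfolding k(2) C_def
      by (rule closedin_continuous_map_preimage[OF ccont_cmult[OF char_continuous[OF k(1)]]]) auto
  next
    fix \<F> assume "finite \<F> \<and> \<F> \<subseteq> C ` irreps"
    then obtain F where F: "F \<subseteq> irreps" "finite F" "\<F> = C ` F" by (meson finite_subset_image)
    obtain g where "g \<in> carrier G" "\<forall>k\<in>F. cnj (\<omega> k) * char k g = of_nat (rep_dim G (rep_of k))"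
      using fusion_character_realize_finite[OF \<omega>' F(2,1)] by blast
    then have "g \<in> \<Inter> \<F>" unfolding F(3) by (auto simp: C_def topspace_eq)
    then show "\<Inter> \<F> \<noteq> {}" by blast
  qed
  then obtain z where z: "z \<in> \<Inter> (C ` irreps)" by blast
  have zG: "z \<in> carrier G" using z trivial_class unfolding C_def topspace_eq by blast
  have sc: "rep_of k z = \<omega> k \<cdot>\<^sub>m 1\<^sub>m (rep_dim G (rep_of k))" if k: "k \<in> irreps" for k
  proof -
    note u = rep_of_unitary[OF k]
    have "cnj (\<omega> k) * mat_trace (rep_of k z) = of_nat (rep_dim G (rep_of k))"
      using z k zG by (auto simp: C_def char_def)
    moreover have "cmod (cnj (\<omega> k)) = 1" using \<omega> k by (simp add: fusion_character_def)
    ultimately show ?thesis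
      using unitary_trace_extremal[OF unitary_rep_carrier[OF u zG] unitary_rep_unitary[OF u zG]] by fastforce
  qed
  \<comment> \<open>\<open>z\<close> acts by scalars in all classes, so \<open>z \<otimes> x\<close>
    and \<open>x \<otimes> z\<close> have the same image in each of them, and the classes separate
    points.\<close>
  have "z \<in> group_center G"
    unfolding group_center_def
  proof (intro CollectI conjI ballI zG)
    fix x assume x: "x \<in> carrier G"
    show "z \<otimes> x = x \<otimes> z"
    proof (rule irreps_separate)
      fix k assume k: "k \<in> irreps"
      note u = rep_of_unitary[OF k]
      show "rep_of k (z \<otimes> x) = rep_of k (x \<otimes> z)"
        unfolding unitary_rep_mult[OF u zG x] unitary_rep_mult[OF u x zG] sc[OF k]
          smult_one_mult[OF unitary_rep_carrier[OF u x]] ..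
    qed (use x zG in auto)
  qed
  moreover have "central_value z k = \<omega> k" if "k \<in> irreps" for k
    by (rule central_value_eqI[OF that sc[OF that]])
  ultimately show thesis by (rule that)
qed

lemma closedin_group_center: "closedin T (group_center G)"
proof -
  have "closedin T {z \<in> topspace T. z \<otimes> x = x \<otimes> z}" if "x \<in> carrier G" for x
    using that by (intro closedin_continuous_maps_eq[OF Hausdorff]) (auto intro!: group_continuous_intros)
  then have "closedin T (\<Inter>x\<in>carrier G. {z \<in> topspace T. z \<otimes> x = x \<otimes> z})" using one_closed by (intro closedin_INT) auto
  also have "(\<Inter>x\<in>carrier G. {z \<in> topspace T. z \<otimes> x = x \<otimes> z}) = group_center G"
    unfolding group_center_def topspace_eq using one_closed by blast
  finally show ?thesis .
qed

end

section \<open>The ordered representation ring determines the fusion rules\<close>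

definition indecomposable :: "'c :: monoid_add set \<Rightarrow> 'c \<Rightarrow> bool" where
  "indecomposable P x \<longleftrightarrow> x \<in> P \<and> x \<noteq> 0 \<and> (\<forall>a\<in>P. \<forall>b\<in>P. x = a + b \<longrightarrow> a = 0 \<or> b = 0)"

lemma single_int_Suc:
  "Poly_Mapping.single k (int (Suc n)) = Poly_Mapping.single k (int n) + Poly_Mapping.single k 1"
  by (simp add: add.commute flip: single_add)

lemma single_one_inject:
  assumes "Poly_Mapping.single k (1 :: int) = Poly_Mapping.single l 1"
  shows "k = l"
proof (rule ccontr)
  assume "k \<noteq> l"
  then have "Poly_Mapping.lookup (Poly_Mapping.single k (1 :: int)) k \<noteq> Poly_Mapping.lookup (Poly_Mapping.single l 1) k"
    by (simp add: lookup_single when_def)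
  with assms show False by simp
qed

context topological_group
begin

lemma rep_ring_pos_iff:
  "c \<in> rep_ring_pos G T \<longleftrightarrow> Poly_Mapping.keys c \<subseteq> irreps \<and> (\<forall>k. 0 \<le> Poly_Mapping.lookup c k)"
  by (simp add: rep_ring_pos_def rep_ring_def)

text \<open>A nonzero element of the cone has a coefficient at least 1, and the corresponding basis
  element can be split off inside the cone. Conversely, of two nonnegative integers with sum 1 one
  is 0.\<close>

lemma indecomposable_rep_ring_pos_iff:
  "indecomposable (rep_ring_pos G T) x \<longleftrightarrow> (\<exists>k\<in>irreps. x = Poly_Mapping.single k 1)"
proof
  assume x: "indecomposable (rep_ring_pos G T) x"
  then have xP: "Poly_Mapping.keys x \<subseteq> irreps" "\<And>k. 0 \<le> Poly_Mapping.lookup x k" and "x \<noteq> 0"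
    by (auto simp: indecomposable_def rep_ring_pos_iff)
  then obtain k where k: "k \<in> Poly_Mapping.keys x" by (metis ex_in_conv keys_eq_empty)
  then have xk: "Poly_Mapping.lookup x k \<ge> 1" using xP(2)[of k] by (simp add: in_keys_iff)
  define a where "a = (Poly_Mapping.single k 1 :: 'a rep set \<Rightarrow>\<^sub>0 int)"
  define b where "b = x - a"
  have kI: "k \<in> irreps" using k xP by blast
  have a: "a \<in> rep_ring_pos G T" using kI by (auto simp: a_def rep_ring_pos_iff lookup_single when_def)
  have "Poly_Mapping.lookup b l \<noteq> 0 \<Longrightarrow> l \<in> irreps" for l
    using xP(1) kI by (auto simp: b_def a_def lookup_minus lookup_single when_def in_keys_iff split: if_splits)
  then have b: "b \<in> rep_ring_pos G T"
    using xP(2) xk by (auto simp: rep_ring_pos_iff in_keys_iff b_def a_def lookup_minus lookup_single when_def)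
  have "x = a + b" by (simp add: b_def)
  then have "a = 0 \<or> b = 0" using x a b by (auto simp: indecomposable_def)
  moreover have "a \<noteq> 0" by (simp add: a_def)
  ultimately show "\<exists>k\<in>irreps. x = Poly_Mapping.single k 1" using kI by (auto simp: b_def a_def)
next
  assume "\<exists>k\<in>irreps. x = Poly_Mapping.single k 1"
  then obtain k where k: "k \<in> irreps" "x = Poly_Mapping.single k 1" by blast
  show "indecomposable (rep_ring_pos G T) x"
    unfolding indecomposable_def
  proof (intro conjI ballI impI)
    show "x \<in> rep_ring_pos G T" using k by (auto simp: rep_ring_pos_iff lookup_single when_def)
    show "x \<noteq> 0" using k by simp
    fix a b assume ab: "a \<in> rep_ring_pos G T" "b \<in> rep_ring_pos G T" "x = a + b"
    have nn: "0 \<le> Poly_Mapping.lookup a l" "0 \<le> Poly_Mapping.lookup b l" for l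
      using ab by (auto simp: rep_ring_pos_iff)
    have s: "Poly_Mapping.lookup a l + Poly_Mapping.lookup b l = (if l = k then 1 else 0)" for l
      using arg_cong[OF ab(3), of "\<lambda>c. Poly_Mapping.lookup c l"] k(2)
      by (simp add: lookup_add lookup_single when_def)
    have z: "Poly_Mapping.lookup a l = 0 \<and> Poly_Mapping.lookup b l = 0" if "l \<noteq> k" for l
      using s[of l] nn[of l] that by simp
    have "Poly_Mapping.lookup a k = 0 \<or> Poly_Mapping.lookup b k = 0"
      using s[of k] nn[of k] by auto
    then show "a = 0 \<or> b = 0"
    proof
      assume "Poly_Mapping.lookup a k = 0"
      then have "a = 0" using z by (intro poly_mapping_eqI) (metis lookup_zero)
      then show ?thesis ..
    next
      assume "Poly_Mapping.lookup b k = 0"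
      then have "b = 0" using z by (intro poly_mapping_eqI) (metis lookup_zero)
      then show ?thesis ..
    qed
  qed
qed

lemma rep_ring_mult_basis:
  "Poly_Mapping.single i 1 \<otimes>\<^bsub>rep_ring G T\<^esub> Poly_Mapping.single j 1 =
    (\<Sum>k\<in>{k \<in> irreps. multiplicity_coeff G i j k \<noteq> 0}. Poly_Mapping.single k (int (multiplicity_coeff G i j k)))"
  by (simp add: rep_ring_def rep_ring_mult_def)

lemma rep_ring_mult_basis_lookup:
  assumes "i \<in> irreps" "j \<in> irreps" "k \<in> irreps"
  shows "Poly_Mapping.lookup (Poly_Mapping.single i 1 \<otimes>\<^bsub>rep_ring G T\<^esub> Poly_Mapping.single j 1) k =
    int (multiplicity_coeff G i j k)"
proof -
  let ?K = "{k \<in> irreps. multiplicity_coeff G i j k \<noteq> 0}"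
  have "Poly_Mapping.lookup (Poly_Mapping.single i 1 \<otimes>\<^bsub>rep_ring G T\<^esub> Poly_Mapping.single j 1) k =
      (\<Sum>l\<in>?K. if l = k then int (multiplicity_coeff G i j l) else 0)"
    unfolding rep_ring_mult_basis lookup_sum by (intro sum.cong) (auto simp: lookup_single when_def)
  also have "\<dots> = int (multiplicity_coeff G i j k)"
    using finite_constituents[OF assms(1,2)] assms(3) by (simp add: sum.delta)
  finally show ?thesis .
qed

end

context
  fixes G :: "'a monoid" and T :: "'a topology" and H :: "'b monoid" and S :: "'b topology"
  assumes G: "compact_group G T" and H: "compact_group H S"
begin

interpretation G: compact_group G T by (rule G)
interpretation H: compact_group H S by (rule H)

text \<open>Sums and the cone are preserved in both directions, hence so are the indecomposable
  elements, and \<open>\<Phi>\<close> restricts to a bijection of the bases. The coefficients of the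
  product of two basis elements then give the multiplicities.\<close>

lemma ordered_ring_iso_basis:
  assumes iso: "\<Phi> \<in> ring_iso (rep_ring G T) (rep_ring H S)" and pos: "\<Phi> ` rep_ring_pos G T = rep_ring_pos H S"
  obtains \<phi> where "bij_betw \<phi> (irrep_classes G T) (irrep_classes H S)"
    "\<And>i j k. i \<in> irrep_classes G T \<Longrightarrow> j \<in> irrep_classes G T \<Longrightarrow> k \<in> irrep_classes G T \<Longrightarrow>
       multiplicity_coeff H (\<phi> i) (\<phi> j) (\<phi> k) = multiplicity_coeff G i j k"
proof -
  let ?R = "rep_ring G T" and ?P = "rep_ring_pos G T" and ?Q = "rep_ring_pos H S"
  let ?s = "\<lambda>k. Poly_Mapping.single k (1 :: int)"
  have hom: "\<Phi> \<in> Ring.ring_hom ?R (rep_ring H S)" and bij: "bij_betw \<Phi> (carrier ?R) (carrier (rep_ring H S))"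
    using iso by (auto simp: ring_iso_def)
  have PR: "?P \<subseteq> carrier ?R" by (auto simp: rep_ring_pos_def)
  have carrier_iff: "c \<in> carrier ?R \<longleftrightarrow> Poly_Mapping.keys c \<subseteq> irrep_classes G T" for c by (simp add: rep_ring_def)
  have add_closed: "a + b \<in> carrier ?R" if "a \<in> carrier ?R" "b \<in> carrier ?R" for a b
    using that keys_add[of a b] unfolding carrier_iff by blast
  have zero: "0 \<in> carrier ?R" by (simp add: carrier_iff)
  have add: "\<Phi> (a + b) = \<Phi> a + \<Phi> b" if "a \<in> carrier ?R" "b \<in> carrier ?R" for a b
    using Ring.ring_hom_add[OF hom that] by (simp add: rep_ring_def)
  have mult: "\<Phi> (a \<otimes>\<^bsub>?R\<^esub> b) = \<Phi> a \<otimes>\<^bsub>rep_ring H S\<^esub> \<Phi> b" if "a \<in> carrier ?R" "b \<in> carrier ?R" for a b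
    by (rule Ring.ring_hom_mult[OF hom that])
  have Phi0: "\<Phi> 0 = 0" using add[OF zero zero] by simp
  have inj: "a = b" if "\<Phi> a = \<Phi> b" "a \<in> carrier ?R" "b \<in> carrier ?R" for a b
    using bij that by (auto simp: bij_betw_def dest: inj_onD)
  have nz: "\<Phi> a = 0 \<longleftrightarrow> a = 0" if "a \<in> carrier ?R" for a using inj[of a 0] that zero Phi0 by auto
  have ind1: "indecomposable ?Q (\<Phi> x)" if x: "indecomposable ?P x" for x
    unfolding indecomposable_def
  proof (intro conjI ballI impI)
    have xP: "x \<in> ?P" "x \<noteq> 0" using x by (auto simp: indecomposable_def)
    show "\<Phi> x \<in> ?Q" using xP pos by blast
    show "\<Phi> x \<noteq> 0" using nz[of x] xP PR by auto
    fix a' b' assume "a' \<in> ?Q" "b' \<in> ?Q" and eq: "\<Phi> x = a' + b'"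
    then obtain a b where ab: "a \<in> ?P" "b \<in> ?P" "a' = \<Phi> a" "b' = \<Phi> b" unfolding pos[symmetric] by blast
    have abR: "a \<in> carrier ?R" "b \<in> carrier ?R" using ab PR by auto
    have "x = a + b"
    proof (rule inj)
      show "\<Phi> x = \<Phi> (a + b)" using eq ab add[OF abR] by simp
      show "x \<in> carrier ?R" using xP PR by blast
      show "a + b \<in> carrier ?R" by (rule add_closed[OF abR])
    qed
    then have "a = 0 \<or> b = 0" using x ab by (auto simp: indecomposable_def)
    then show "a' = 0 \<or> b' = 0" using ab Phi0 by auto
  qed
  have ind2: "indecomposable ?P x" if x: "indecomposable ?Q (\<Phi> x)" "x \<in> ?P" for x
    unfolding indecomposable_def
  proof (intro conjI ballI impI)
    show "x \<in> ?P" by (rule x)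
    show "x \<noteq> 0" using x Phi0 by (auto simp: indecomposable_def)
    fix a b assume ab: "a \<in> ?P" "b \<in> ?P" "x = a + b"
    then have "\<Phi> x = \<Phi> a + \<Phi> b" using add[of a b] PR by auto
    then have "\<Phi> a = 0 \<or> \<Phi> b = 0" using x(1) ab pos unfolding indecomposable_def by blast
    then show "a = 0 \<or> b = 0" using nz ab PR by auto
  qed
  have "\<exists>l\<in>irrep_classes H S. \<Phi> (?s k) = ?s l" if "k \<in> irrep_classes G T" for k
    using ind1[of "?s k"] that unfolding G.indecomposable_rep_ring_pos_iff H.indecomposable_rep_ring_pos_iff by blast
  then obtain \<phi> where \<phi>: "\<And>k. k \<in> irrep_classes G T \<Longrightarrow> \<phi> k \<in> irrep_classes H S \<and> \<Phi> (?s k) = ?s (\<phi> k)"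
    by metis
  have sR: "Poly_Mapping.single k c \<in> carrier ?R" if "k \<in> irrep_classes G T" for k c
    using that by (auto simp: carrier_iff)
  have bij\<phi>: "bij_betw \<phi> (irrep_classes G T) (irrep_classes H S)"
    unfolding bij_betw_def
  proof
    show "inj_on \<phi> (irrep_classes G T)"
    proof (rule inj_onI)
      fix k l assume kl: "k \<in> irrep_classes G T" "l \<in> irrep_classes G T" "\<phi> k = \<phi> l"
      have "?s k = ?s l" using kl \<phi>[OF kl(1)] \<phi>[OF kl(2)] by (intro inj sR) auto
      then show "k = l" by (rule single_one_inject)
    qed
    show "\<phi> ` irrep_classes G T = irrep_classes H S"
    proof (intro equalityI subsetI)
      fix l assume l: "l \<in> irrep_classes H S"
      have Q: "indecomposable ?Q (?s l)" using l H.indecomposable_rep_ring_pos_iff by blast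
      then obtain x where x: "x \<in> ?P" "?s l = \<Phi> x" using pos unfolding indecomposable_def by blast
      have "indecomposable ?P x" using Q x by (intro ind2) auto
      then obtain k where k: "k \<in> irrep_classes G T" "x = ?s k"
        using G.indecomposable_rep_ring_pos_iff by blast
      then have "?s l = ?s (\<phi> k)" using \<phi>[OF k(1)] x by simp
      then have "l = \<phi> k" by (rule single_one_inject)
      then show "l \<in> \<phi> ` irrep_classes G T" using k by blast
    qed (use \<phi> in auto)
  qed
  \<comment> \<open>Additivity of \<open>\<Phi>\<close> extends the correspondence from basis
    elements to their natural multiples, which are the terms occurring in a product of basis
    elements.\<close>
  have Phi_single: "\<Phi> (Poly_Mapping.single k (int n)) = Poly_Mapping.single (\<phi> k) (int n)"
    if k: "k \<in> irrep_classes G T" for k n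
  proof (induction n)
    case (Suc n)
    then show ?case using add[OF sR[OF k] sR[OF k], of "int n" 1] \<phi>[OF k]
      by (simp only: single_int_Suc)
  qed (simp add: Phi0)
  have Phi_sum: "(\<Sum>k\<in>K. Poly_Mapping.single k (int (n k))) \<in> carrier ?R \<and>
      \<Phi> (\<Sum>k\<in>K. Poly_Mapping.single k (int (n k))) = (\<Sum>k\<in>K. Poly_Mapping.single (\<phi> k) (int (n k)))"
    if "finite K" "K \<subseteq> irrep_classes G T" for K n
    using that
  proof (induction K)
    case (insert k K)
    then show ?case using add[OF sR, of k] add_closed[OF sR, of k] Phi_single[of k] by simp
  qed (simp add: zero Phi0)
  have "multiplicity_coeff H (\<phi> i) (\<phi> j) (\<phi> k) = multiplicity_coeff G i j k"
    if i: "i \<in> irrep_classes G T" and j: "j \<in> irrep_classes G T" and k: "k \<in> irrep_classes G T" for i j k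
  proof -
    let ?K = "{k \<in> irrep_classes G T. multiplicity_coeff G i j k \<noteq> 0}"
    have "int (multiplicity_coeff H (\<phi> i) (\<phi> j) (\<phi> k)) =
        Poly_Mapping.lookup (\<Phi> (?s i \<otimes>\<^bsub>?R\<^esub> ?s j)) (\<phi> k)"
      unfolding mult[OF sR[OF i] sR[OF j]] using \<phi>[OF i] \<phi>[OF j] \<phi>[OF k]
      by (simp add: H.rep_ring_mult_basis_lookup)
    also have "\<dots> = (\<Sum>l\<in>?K. Poly_Mapping.lookup (Poly_Mapping.single (\<phi> l) (int (multiplicity_coeff G i j l))) (\<phi> k))"
      unfolding G.rep_ring_mult_basis lookup_sum[symmetric]
      using Phi_sum[OF G.finite_constituents[OF i j]] by simp
    also have "\<dots> = (\<Sum>l\<in>?K. if l = k then int (multiplicity_coeff G i j l) else 0)"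
      using bij\<phi> k by (intro sum.cong) (auto simp: lookup_single when_def bij_betw_def dest: inj_onD)
    also have "\<dots> = int (multiplicity_coeff G i j k)"
      using G.finite_constituents[OF i j] k by (simp add: sum.delta)
    finally show ?thesis by simp
  qed
  with bij\<phi> show thesis by (rule that)
qed

section \<open>Transport of the center\<close>

context
  fixes \<phi>
  assumes \<phi>: "bij_betw \<phi> (irrep_classes G T) (irrep_classes H S)"
    and fusion: "\<And>i j k. i \<in> irrep_classes G T \<Longrightarrow> j \<in> irrep_classes G T \<Longrightarrow> k \<in> irrep_classes G T \<Longrightarrow>
       multiplicity_coeff H (\<phi> i) (\<phi> j) (\<phi> k) = multiplicity_coeff G i j k"
begin

lemma irreps_image: "k \<in> irrep_classes G T \<Longrightarrow> \<phi> k \<in> irrep_classes H S"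
  using \<phi> by (auto simp: bij_betw_def)

lemma fusion_character_iff: "H.fusion_character \<omega> \<longleftrightarrow> G.fusion_character (\<lambda>k. \<omega> (\<phi> k))"
proof -
  have im: "irrep_classes H S = \<phi> ` irrep_classes G T" using \<phi> by (simp add: bij_betw_def)
  show ?thesis unfolding H.fusion_character_def G.fusion_character_def im using fusion by simp
qed

text \<open>A relation treats the two groups symmetrically; it turns out to be the graph of a
  bijection of the centers, and it is closed since each condition equates continuous
  functions.\<close>

definition center_corr :: "'a \<Rightarrow> 'b \<Rightarrow> bool" where
  "center_corr z w \<longleftrightarrow> (\<forall>k\<in>irrep_classes G T. H.central_value w (\<phi> k) = G.central_value z k)"

lemma center_corr_ex_right:
  assumes z: "z \<in> group_center G"
  shows "\<exists>w\<in>group_center H. center_corr z w"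
proof -
  define \<omega> where "\<omega> = (\<lambda>l. G.central_value z (inv_into (irrep_classes G T) \<phi> l))"
  have \<omega>: "\<omega> (\<phi> k) = G.central_value z k" if "k \<in> irrep_classes G T" for k
    using that \<phi> by (simp add: \<omega>_def bij_betw_def)
  have "G.fusion_character (\<lambda>k. \<omega> (\<phi> k))"
    using G.fusion_character_central_value[OF z] unfolding G.fusion_character_def by (simp add: \<omega>)
  then have "H.fusion_character \<omega>" by (simp add: fusion_character_iff)
  from H.fusion_character_realize[OF this] obtain w
    where "w \<in> group_center H" "\<And>l. l \<in> irrep_classes H S \<Longrightarrow> H.central_value w l = \<omega> l" by metis
  then show ?thesis using \<omega> irreps_image by (intro bexI[of _ w]) (auto simp: center_corr_def)
qed

lemma center_corr_ex_left:
  assumes w: "w \<in> group_center H"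
  shows "\<exists>z\<in>group_center G. center_corr z w"
proof -
  have "G.fusion_character (\<lambda>k. H.central_value w (\<phi> k))"
    using H.fusion_character_central_value[OF w] by (simp add: fusion_character_iff)
  from G.fusion_character_realize[OF this] obtain z
    where "z \<in> group_center G" "\<And>k. k \<in> irrep_classes G T \<Longrightarrow> G.central_value z k = H.central_value w (\<phi> k)"
    by metis
  then show ?thesis by (intro bexI[of _ z]) (auto simp: center_corr_def)
qed

lemma center_corr_unique_right:
  assumes "w \<in> group_center H" "w' \<in> group_center H" "center_corr z w" "center_corr z w'"
  shows "w = w'"
proof (rule H.central_value_inject[OF assms(1,2)])
  fix l assume "l \<in> irrep_classes H S"
  then obtain k where "k \<in> irrep_classes G T" "l = \<phi> k" using \<phi> by (auto simp: bij_betw_def)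
  then show "H.central_value w l = H.central_value w' l" using assms(3,4) by (simp add: center_corr_def)
qed

lemma center_corr_unique_left:
  assumes "z \<in> group_center G" "z' \<in> group_center G" "center_corr z w" "center_corr z' w"
  shows "z = z'"
  using assms(3,4) by (intro G.central_value_inject[OF assms(1,2)]) (auto simp: center_corr_def)

lemma topspace_center:
  "topspace (subtopology T (group_center G)) = group_center G"
  "topspace (subtopology S (group_center H)) = group_center H"
  using G.group_center_carrier H.group_center_carrier by (auto simp: G.topspace_eq H.topspace_eq)

lemma compact_center:
  "compact_space (subtopology T (group_center G))" "compact_space (subtopology S (group_center H))"
  using G.closedin_group_center H.closedin_group_center G.compact H.compact
  by (auto simp: compact_space_subtopology closedin_compact_space)

text \<open>The correspondence is closed, so by compactness of the target the map with this graph is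
  continuous.\<close>

lemma center_map_continuous:
  assumes f: "\<And>z. z \<in> group_center G \<Longrightarrow> f z \<in> group_center H \<and> center_corr z (f z)"
  shows "continuous_map (subtopology T (group_center G)) (subtopology S (group_center H)) f"
    (is "continuous_map ?X ?Y f")
  unfolding continuous_map_closedin topspace_center
proof (intro conjI allI impI funcsetI)
  show "f z \<in> group_center H" if "z \<in> group_center G" for z using f[OF that] by simp
  fix C assume C: "closedin ?Y C"
  have CH: "C \<subseteq> group_center H" using closedin_subset[OF C] by (simp add: topspace_center)
  define \<Gamma> where "\<Gamma> = (\<Inter>k\<in>irrep_classes G T. {p \<in> topspace (prod_topology ?X ?Y).
      H.central_value (snd p) (\<phi> k) = G.central_value (fst p) k})"
  have "closedin (prod_topology ?X ?Y) \<Gamma>"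
    unfolding \<Gamma>_def
  proof (rule closedin_INT)
    show "irrep_classes G T \<noteq> {}" using G.trivial_class by blast
    fix k assume k: "k \<in> irrep_classes G T"
    have 1: "continuous_map (prod_topology ?X ?Y) euclidean (\<lambda>p. H.central_value (snd p) (\<phi> k))"
      using continuous_map_compose[OF continuous_map_snd
          continuous_map_from_subtopology[OF H.central_value_continuous[OF irreps_image[OF k]]]]
      by (simp add: o_def)
    have 2: "continuous_map (prod_topology ?X ?Y) euclidean (\<lambda>p. G.central_value (fst p) k)"
      using continuous_map_compose[OF continuous_map_fst
          continuous_map_from_subtopology[OF G.central_value_continuous[OF k]]]
      by (simp add: o_def)
    show "closedin (prod_topology ?X ?Y) {p \<in> topspace (prod_topology ?X ?Y).
      H.central_value (snd p) (\<phi> k) = G.central_value (fst p) k}"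
      by (rule closedin_continuous_maps_eq[OF _ 1 2]) simp
  qed
  moreover have "closedin (prod_topology ?X ?Y) (topspace ?X \<times> C)"
    using C closedin_topspace[of ?X] unfolding closedin_prod_Times_iff by blast
  ultimately have "closedin (prod_topology ?X ?Y) (\<Gamma> \<inter> (topspace ?X \<times> C))" by (rule closedin_Int)
  \<comment> \<open>Projection along a compact factor is a closed map, and the projected set is the
    preimage of \<open>C\<close>, as the relation determines \<open>w\<close> from
    \<open>z\<close>.\<close>
  then have "closedin ?X (fst ` (\<Gamma> \<inter> (topspace ?X \<times> C)))"
    using closed_map_fst[OF compact_center(2), of ?X] unfolding closed_map_def by blast
  also have "fst ` (\<Gamma> \<inter> (topspace ?X \<times> C)) = {z \<in> group_center G. f z \<in> C}"
  proof (intro equalityI subsetI)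
    fix z assume "z \<in> fst ` (\<Gamma> \<inter> (topspace ?X \<times> C))"
    then obtain w where w: "(z, w) \<in> \<Gamma>" "z \<in> group_center G" "w \<in> C" by (auto simp: topspace_center)
    have "center_corr z w" using w(1) by (auto simp: \<Gamma>_def center_corr_def)
    then have "w = f z" using center_corr_unique_right[of w "f z" z] f[OF w(2)] w(3) CH by blast
    then show "z \<in> {z \<in> group_center G. f z \<in> C}" using w by simp
  next
    fix z assume "z \<in> {z \<in> group_center G. f z \<in> C}"
    then have z: "z \<in> group_center G" "f z \<in> C" by auto
    then have "(z, f z) \<in> \<Gamma> \<inter> (topspace ?X \<times> C)"
      using f[OF z(1)] G.group_center_carrier H.group_center_carrier
      by (auto simp: \<Gamma>_def center_corr_def G.topspace_eq H.topspace_eq)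
    then show "z \<in> fst ` (\<Gamma> \<inter> (topspace ?X \<times> C))" by force
  qed
  finally show "closedin ?X {z \<in> group_center G. f z \<in> C}" .
qed

text \<open>Multiplicativity follows from uniqueness, since the scalars of a product are the
  products of the scalars. A continuous bijection from a compact space onto a Hausdorff space is a
  homeomorphism.\<close>

lemma center_topological_iso:
  "\<exists>f. f \<in> topological_group_iso
     (G\<lparr>carrier := group_center G\<rparr>) (subtopology T (group_center G))
     (H\<lparr>carrier := group_center H\<rparr>) (subtopology S (group_center H))"
proof -
  let ?X = "subtopology T (group_center G)" and ?Y = "subtopology S (group_center H)"
  obtain f where f: "\<And>z. z \<in> group_center G \<Longrightarrow> f z \<in> group_center H \<and> center_corr z (f z)"
    using center_corr_ex_right by metis
  have cont: "continuous_map ?X ?Y f" by (rule center_map_continuous[OF f])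
  have inj: "inj_on f (group_center G)"
  proof (rule inj_onI)
    fix z z' assume z: "z \<in> group_center G" "z' \<in> group_center G" "f z = f z'"
    then show "z = z'" using center_corr_unique_left[OF z(1,2), of "f z"] f by metis
  qed
  have im: "f ` group_center G = group_center H"
  proof (intro equalityI subsetI)
    fix w assume w: "w \<in> group_center H"
    then obtain z where z: "z \<in> group_center G" "center_corr z w" using center_corr_ex_left by blast
    then have "w = f z" using center_corr_unique_right[OF w, of "f z" z] f by blast
    then show "w \<in> f ` group_center G" using z by blast
  qed (use f in auto)
  have hom: "f (z \<otimes>\<^bsub>G\<^esub> z') = f z \<otimes>\<^bsub>H\<^esub> f z'" if z: "z \<in> group_center G" "z' \<in> group_center G" for z z'
  proof (rule center_corr_unique_right)
    have zz: "z \<otimes>\<^bsub>G\<^esub> z' \<in> group_center G" by (rule G.group_center_mult[OF z])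
    show "f (z \<otimes>\<^bsub>G\<^esub> z') \<in> group_center H" "center_corr (z \<otimes>\<^bsub>G\<^esub> z') (f (z \<otimes>\<^bsub>G\<^esub> z'))" using f[OF zz] by auto
    show "f z \<otimes>\<^bsub>H\<^esub> f z' \<in> group_center H" using f z by (intro H.group_center_mult) auto
    show "center_corr (z \<otimes>\<^bsub>G\<^esub> z') (f z \<otimes>\<^bsub>H\<^esub> f z')"
      unfolding center_corr_def
    proof
      fix k assume k: "k \<in> irrep_classes G T"
      show "H.central_value (f z \<otimes>\<^bsub>H\<^esub> f z') (\<phi> k) = G.central_value (z \<otimes>\<^bsub>G\<^esub> z') k"
        using f[OF z(1)] f[OF z(2)] k irreps_image[OF k]
        by (simp add: H.central_value_mult G.central_value_mult[OF z k] center_corr_def)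
    qed
  qed
  have "closed_map ?X ?Y f"
    by (rule T1_Spaces.continuous_imp_closed_map[OF cont compact_center(1)])
      (rule Hausdorff_space_subtopology[OF H.Hausdorff])
  then have "homeomorphic_map ?X ?Y f"
    using cont inj im by (intro bijective_closed_imp_homeomorphic_map) (simp_all only: topspace_center)
  moreover have "f \<in> iso (G\<lparr>carrier := group_center G\<rparr>) (H\<lparr>carrier := group_center H\<rparr>)"
    using inj im hom f by (auto simp: Group.iso_def hom_def bij_betw_def)
  ultimately show ?thesis unfolding topological_group_iso_def by blast
qed

end

end

theorem corollary3p2:
  fixes G :: "'a monoid" and T :: "'a topology"
    and H :: "'b monoid" and S :: "'b topology"
    and \<Phi> :: "('a rep set \<Rightarrow>\<^sub>0 int) \<Rightarrow> ('b rep set \<Rightarrow>\<^sub>0 int)"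
  assumes "compact_group G T" and "compact_group H S"
    and "\<Phi> \<in> ring_iso (rep_ring G T) (rep_ring H S)"
    and "\<Phi> ` rep_ring_pos G T = rep_ring_pos H S"
  shows "\<exists>f. f \<in> topological_group_iso
           (G\<lparr>carrier := group_center G\<rparr>) (subtopology T (group_center G))
           (H\<lparr>carrier := group_center H\<rparr>) (subtopology S (group_center H))"
proof -
  from ordered_ring_iso_basis[OF assms] obtain \<phi>
    where "bij_betw \<phi> (irrep_classes G T) (irrep_classes H S)"
      and "\<And>i j k. i \<in> irrep_classes G T \<Longrightarrow> j \<in> irrep_classes G T \<Longrightarrow> k \<in> irrep_classes G T \<Longrightarrow>
        multiplicity_coeff H (\<phi> i) (\<phi> j) (\<phi> k) = multiplicity_coeff G i j k"
    by metis
  from center_topological_iso[OF assms(1,2) this] show ?thesis .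
qed

end
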